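(* Let $L$ be a finite-dimensional Leibniz CL-algebra over a field of characteristic zero. Then $L$ is solvable.
   Context: A (right) Leibniz algebra is a vector space $L$ with a bilinear product $[\,,]$ satisfying $[x,[y,z]]=[[x,y],z]-[[x,z],y]$ for all $x,y,z\in L$. The centralizer of $x\in L$ is $C_L(x)=\{y\in L\mid [x,y]=[y,x]=0\}$, and $L$ is a CL-algebra if $C_L(x)$ is a (two-sided) ideal of $L$ for every $x\in L$. Put $L^{(0)}=L$ and $L^{(k)}=[L^{(k-1)},L^{(k-1)}]$ (span of products) for $k\ge1$; $L$ is solvable if $L^{(n)}=0$ for some $n\ge 1$. *)

theory Defs
  imports Complex_Main
begin

(* Right Leibniz algebras. The underlying vector space is the whole type 'v. *)

locale leibniz_algebra = vector_space scale
  for scale :: "'k::field \<Rightarrow> 'v::ab_group_add \<Rightarrow> 'v" +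
  fixes bracket :: "'v \<Rightarrow> 'v \<Rightarrow> 'v"
  assumes linear_bracket_left: "Vector_Spaces.linear scale scale (\<lambda>x. bracket x y)"
    and linear_bracket_right: "Vector_Spaces.linear scale scale (\<lambda>y. bracket x y)"
    and leibniz_identity:
      "bracket x (bracket y z) = bracket (bracket x y) z - bracket (bracket x z) y"
begin

definition centralizer :: "'v \<Rightarrow> 'v set"
  where "centralizer x = {y. bracket x y = 0 \<and> bracket y x = 0}"

definition two_sided_ideal :: "'v set \<Rightarrow> bool"
  where "two_sided_ideal I \<longleftrightarrow>
    subspace I \<and> (\<forall>a\<in>I. \<forall>x. bracket a x \<in> I \<and> bracket x a \<in> I)"

definition CL_algebra :: bool
  where "CL_algebra \<longleftrightarrow> (\<forall>x. two_sided_ideal (centralizer x))"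

primrec derived_series :: "nat \<Rightarrow> 'v set"
  where
    "derived_series 0 = UNIV"
  | "derived_series (Suc k) =
      span {bracket x y | x y. x \<in> derived_series k \<and> y \<in> derived_series k}"

definition solvable :: bool
  where "solvable \<longleftrightarrow> (\<exists>n\<ge>1. derived_series n = {0})"

end

end

theory Submission
  imports Defs "HOL-Library.Function_Algebras" "HOL-Algebra.Algebraic_Closure_Type"
begin

text \<open>
  If \<open>L\<close> is not solvable, let \<open>S\<close> be a non-solvable subalgebra of least dimension: it is perfect and all its
  proper subalgebras are solvable. A maximal proper ideal \<open>R\<close> of \<open>S\<close> is then zero. Indeed, if \<open>[R,R] \<noteq> R\<close>,
  Levi's argument modulo \<open>[R,R]\<close> produces a proper subalgebra \<open>K\<close> with \<open>K + R = S\<close>, so \<open>S\<close> would be an extension of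
  solvable algebras; and a solvable \<open>R\<close> with \<open>[R,R] = R\<close> vanishes. Levi's argument rests on Whitehead's lemma for the
  simple quotient \<open>S/R\<close>, hence on Casimir operators and on Cartan's criterion for trace forms; working relative
  to submodules avoids forming quotient algebras.

  The span of the squares \<open>[x,x]\<close> is an abelian ideal of \<open>S\<close>, hence zero, and \<open>S\<close> is a Lie algebra. Now every \<open>x \<in> S\<close>
  lies in its own centralizer, which is an ideal, so \<open>[[y,x],x] = 0\<close>. A Lie algebra satisfying this
  identity satisfies \<open>3 [[x,y],z] = 0\<close>, which contradicts \<open>S = [S,S] \<noteq> 0\<close>.
\<close>

section \<open>Traces and generalized eigenspaces\<close>

text \<open>Levi's theorem enters only through the existence of a proper supplement of
  \<open>R\<close>: proper subalgebras of \<open>S\<close> being solvable, such a supplement is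
  already a contradiction. The argument works modulo \<open>derived R\<close> because there two
  elements of \<open>R\<close> have zero bracket, so that elements of \<open>R\<close> send a map
  that is scalar on \<open>R\<close> to a right multiplication.

  Squares cannot be discarded at the outset, since their vanishing is deduced from
  \<open>R = 0\<close>. Until then only right multiplications are represented. By the Leibniz
  identity they satisfy the Lie commutator relation with reversed order of factors, and squares act
  as zero, so the classical Lie arguments apply to them.

  Perfectness of \<open>S\<close> sharpens these arguments: Engel's theorem and Cartan's criterion
  conclude that the action is zero. Scalars are extended to an algebraic closure only inside
  Cartan's criterion, by passing to matrices. Characteristic zero makes a sum of rational squares
  times dimensions detect nonzero eigenvalues, the trace of the Casimir operator nonzero, and 3
  invertible.\<close>

lemma bezout_linear_factor_power:
  fixes q :: "'a::field poly"
  assumes "poly q c \<noteq> 0"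
  obtains a b where "a * q + b * [:- c, 1:] ^ n = 1"
proof -
  \<comment> \<open>The normalization makes \<open>X - c\<close> divide \<open>1 - r\<close>. By the
    geometric sum, \<open>1 - (1 - r)^n\<close> is a multiple of \<open>r\<close>, which yields the
    cofactor of \<open>q\<close>.\<close>
  define r where "r = smult (1 / poly q c) q"
  have "[:- c, 1:] dvd 1 - r"
    using assms by (simp add: poly_eq_0_iff_dvd[symmetric] r_def)
  then have "[:- c, 1:] ^ n dvd (1 - r) ^ n" by (rule dvd_power_same)
  then obtain b where b: "(1 - r) ^ n = [:- c, 1:] ^ n * b" by (rule dvdE)
  have "1 - (1 - r) ^ n = r * (\<Sum>i<n. (1 - r) ^ i)"
    using one_diff_power_eq[of "1 - r" n] by simp
  then have "(smult (1 / poly q c) (\<Sum>i<n. (1 - r) ^ i)) * q + b * [:- c, 1:] ^ n = 1"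
    using b by (simp add: r_def algebra_simps)
  then show thesis by (rule that)
qed

text \<open>Applied to an endomorphism, the \<open>u c\<close> give the projections onto its
  generalized eigenspaces. A new root \<open>e\<close> is adjoined by Bezout: the old polynomials
  are multiplied by a multiple of \<open>(X - e)^n\<close>, and the complementary multiple of the
  old product becomes the polynomial of \<open>e\<close>. The empty set is set apart because its sum
  is 0.\<close>

lemma partial_fraction_unity:
  fixes A :: "'a::field set"
  assumes "finite A"
  obtains u where "A = {} \<or> (\<Sum>c\<in>A. u c) = 1"
    "\<And>c. c \<in> A \<Longrightarrow> (\<Prod>d\<in>A. [:- d, 1:] ^ n) dvd [:- c, 1:] ^ n * u c"
proof -
  have "\<exists>u. (A = {} \<or> (\<Sum>c\<in>A. u c) = 1) \<and>
    (\<forall>c\<in>A. (\<Prod>d\<in>A. [:- d, 1:] ^ n) dvd [:- c, 1:] ^ n * u c)"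
    using assms
  proof (induction A rule: finite_induct)
    case empty
    then show ?case by simp
  next
    case (insert e A)
    then obtain u where u: "A = {} \<or> (\<Sum>c\<in>A. u c) = 1"
      "\<forall>c\<in>A. (\<Prod>d\<in>A. [:- d, 1:] ^ n) dvd [:- c, 1:] ^ n * u c"
      by blast
    let ?p = "\<Prod>d\<in>A. [:- d, 1:] ^ n"
    have "poly ?p e \<noteq> 0" using insert by (auto simp: poly_prod)
    then obtain a b where ab: "a * ?p + b * [:- e, 1:] ^ n = 1"
      by (rule bezout_linear_factor_power)
    show ?case
    proof (cases "A = {}")
      case True
      then show ?thesis by (auto intro!: exI[of _ "\<lambda>_. 1"])
    next
      case False
      define v where "v c = (if c = e then a * ?p else b * [:- e, 1:] ^ n * u c)" for c
      have "(\<Sum>c\<in>A. v c) = (\<Sum>c\<in>A. b * [:- e, 1:] ^ n * u c)"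
        using insert.hyps by (intro sum.cong) (auto simp: v_def)
      also have "\<dots> = b * [:- e, 1:] ^ n"
        using u(1) False by (simp flip: sum_distrib_left)
      finally have "(\<Sum>c\<in>insert e A. v c) = 1"
        using insert.hyps ab by (simp add: v_def)
      moreover have "[:- e, 1:] ^ n * ?p dvd [:- c, 1:] ^ n * v c" if "c \<in> insert e A" for c
      proof (cases "c = e")
        case False
        then have "?p dvd [:- c, 1:] ^ n * u c" using that u(2) by blast
        then have "[:- e, 1:] ^ n * ?p dvd [:- e, 1:] ^ n * ([:- c, 1:] ^ n * u c)"
          by (rule mult_dvd_mono[OF dvd_refl])
        moreover have "[:- c, 1:] ^ n * v c = [:- e, 1:] ^ n * ([:- c, 1:] ^ n * u c) * b"
          using False by (simp add: v_def mult_ac del: mult_pCons_left mult_pCons_right)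
        ultimately show ?thesis by (metis dvd_mult2)
      qed (simp add: v_def mult_ac del: mult_pCons_left mult_pCons_right)
      ultimately show ?thesis using insert.hyps by (intro exI[of _ v]) auto
    qed
  qed
  then show thesis using that by blast
qed

text \<open>All multiplicities are raised to the common exponent \<open>size F\<close>, so that one
  exponent serves every root.\<close>

lemma dvd_prod_linear_factors:
  fixes p :: "'a::alg_closed_field poly"
  assumes "p \<noteq> 0"
  obtains A n where "finite A" "p dvd (\<Prod>c\<in>A. [:- c, 1:] ^ n)"
proof -
  obtain F c where F: "p = smult c (prod_mset (image_mset (\<lambda>c. [:- c, 1:]) F))"
    using alg_closed_imp_factorization[OF assms] by blast
  have "prod_mset (image_mset (\<lambda>c. [:- c, 1:]) F) = (\<Prod>c\<in>set_mset F. [:- c, 1:] ^ count F c)"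
    by (rule image_prod_mset_multiplicity)
  also have "\<dots> dvd (\<Prod>c\<in>set_mset F. [:- c, 1:] ^ size F)"
    by (intro prod_dvd_prod le_imp_power_dvd count_le_size)
  finally have "p dvd (\<Prod>c\<in>set_mset F. [:- c, 1:] ^ size F)"
    using assms F by (auto intro: smult_dvd)
  then show thesis using that[of "set_mset F" "size F"] by simp
qed

section \<open>Finite-dimensional subspaces and traces\<close>

locale linear_space = vector_space scale for scale :: "'a::field \<Rightarrow> 'b::ab_group_add \<Rightarrow> 'b"
begin

sublocale endo: vector_space_pair scale scale ..

abbreviation endomorphism :: "('b \<Rightarrow> 'b) \<Rightarrow> bool"
  where "endomorphism \<equiv> Vector_Spaces.linear scale scale"

lemma endomorphismI:
  assumes "\<And>x y. f (x + y) = f x + f y" "\<And>c x. f (scale c x) = scale c (f x)"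
  shows "endomorphism f"
  unfolding Vector_Spaces.linear_iff using assms vector_space_axioms by blast

definition finite_dim :: "'b set \<Rightarrow> bool"
  where "finite_dim E \<longleftrightarrow> subspace E \<and> (\<exists>B. finite B \<and> E \<subseteq> span B)"

lemma finite_dim_basis:
  assumes "finite_dim E"
  obtains B where "finite B" "independent B" "span B = E" "card B = dim E"
proof -
  obtain B where B: "B \<subseteq> E" "independent B" "E \<subseteq> span B" "card B = dim E"
    by (rule basis_exists)
  moreover have "finite B"
    using assms independent_span_bound[of _ B] B(1,2) unfolding finite_dim_def by (meson order_trans)
  moreover have "span B = E"
    using B assms span_minimal[of B E] unfolding finite_dim_def by blast
  ultimately show thesis using that by blast
qed

lemma finite_dim_subspace:
  assumes "finite_dim E" "subspace F" "F \<subseteq> E"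
  shows "finite_dim F"
  using assms unfolding finite_dim_def by blast

lemma finite_dim_span: "finite B \<Longrightarrow> finite_dim (span B)"
  unfolding finite_dim_def by auto

lemma dim_psubset_finite_dim:
  assumes "finite_dim E" "subspace F" "F \<subset> E"
  shows "dim F < dim E"
proof -
  obtain C where C: "finite C" "independent C" "span C = F" "card C = dim F"
    using finite_dim_basis[OF finite_dim_subspace[OF assms(1,2)]] assms(3) by blast
  have CE: "C \<subseteq> E" using C(3) assms(3) span_superset by blast
  obtain D where D: "C \<subseteq> D" "D \<subseteq> E" "independent D" "E \<subseteq> span D"
    using maximal_independent_subset_extend[OF CE C(2)] by blast
  have finD: "finite D"
    using assms(1) independent_span_bound[of _ D] D(2,3) unfolding finite_dim_def by (meson order_trans)
  have "C \<noteq> D" using C(3) D(4) assms(3) by blast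
  then have "card C < card D" using D(1) finD by (simp add: psubsetI psubset_card_mono)
  moreover have "card D = dim E" using basis_card_eq_dim D by blast
  ultimately show ?thesis using C(4) by simp
qed

lemma finite_dim_linear_image:
  assumes "endomorphism f" "finite_dim E"
  shows "finite_dim (f ` E)"
proof -
  obtain B where B: "finite B" "span B = E" using finite_dim_basis[OF assms(2)] by metis
  have "f ` E = span (f ` B)" using endo.linear_span_image[OF assms(1), of B] B(2) by simp
  then show ?thesis using B(1) finite_dim_span by simp
qed

lemma projection_exists:
  assumes "subspace A"
  obtains p where "endomorphism p" "range p \<subseteq> A" "\<And>a. a \<in> A \<Longrightarrow> p a = a"
proof -
  have "endomorphism (\<lambda>x. x)" by (simp add: linear_ident)
  from endo.linear_exists_left_inverse_on[OF this assms] show thesis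
    using that by (auto simp: inj_on_def)
qed

text \<open>A map is traced on a subspace of the ambient type through a basis \<open>B\<close> of
  that subspace. Since \<open>representation\<close> is zero off \<open>span B\<close>, the number
  is a genuine trace only if \<open>f\<close> preserves \<open>span B\<close>; hence the invariance
  hypotheses below.\<close>

definition trace_on :: "'b set \<Rightarrow> ('b \<Rightarrow> 'b) \<Rightarrow> 'a"
  where "trace_on B f = (\<Sum>b\<in>B. representation B (f b) b)"

lemma representation_expand:
  assumes "finite B" "independent B" "v \<in> span B"
  shows "(\<Sum>b\<in>B. scale (representation B v b) b) = v"
  using sum_representation_eq[OF assms(2,3,1)] by simp

text \<open>Letting the two maps run between different subspaces makes one identity serve both for
  cyclicity and for passing to a smaller subspace. Both sides expand to the same double sum of
  products of matrix entries.\<close>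

lemma trace_on_commute:
  assumes "finite B" "independent B" "finite C" "independent C"
    and f: "endomorphism f" and g: "endomorphism g"
    and fBC: "f ` span B \<subseteq> span C" and gCB: "g ` span C \<subseteq> span B"
  shows "trace_on B (\<lambda>x. g (f x)) = trace_on C (\<lambda>x. f (g x))"
proof -
  have expand: "representation B (g (f b)) b = (\<Sum>c\<in>C. representation C (f b) c * representation B (g c) b)"
    if "finite B" "independent B" "finite C" "independent C"
      "endomorphism g" "f ` span B \<subseteq> span C" "g ` span C \<subseteq> span B" "b \<in> B" for B C f g b
  proof -
    have fb: "f b \<in> span C" using that span_base by blast
    have gc: "g c \<in> span B" if "c \<in> C" for c using that \<open>g ` span C \<subseteq> span B\<close> span_base by blast
    have "g (f b) = g (\<Sum>c\<in>C. scale (representation C (f b) c) c)"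
      using representation_expand[OF that(3,4) fb] by simp
    also have "\<dots> = (\<Sum>c\<in>C. scale (representation C (f b) c) (g c))"
      by (simp add: endo.linear_sum[OF that(5)] endo.linear_scale[OF that(5)])
    finally have "representation B (g (f b)) = (\<lambda>b'. \<Sum>c\<in>C. representation B (scale (representation C (f b) c) (g c)) b')"
      using representation_sum[OF that(2), of C "\<lambda>c. scale (representation C (f b) c) (g c)"] gc
      by (simp add: span_scale)
    then show ?thesis using representation_scale[OF that(2) gc] by simp
  qed
  have "trace_on B (\<lambda>x. g (f x)) = (\<Sum>b\<in>B. \<Sum>c\<in>C. representation C (f b) c * representation B (g c) b)"
    unfolding trace_on_def using expand[OF assms(1-4) g fBC gCB] by (simp cong: sum.cong)
  also have "\<dots> = (\<Sum>c\<in>C. \<Sum>b\<in>B. representation B (g c) b * representation C (f b) c)"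
    by (subst sum.swap) (simp add: mult.commute)
  also have "\<dots> = trace_on C (\<lambda>x. f (g x))"
    unfolding trace_on_def using expand[OF assms(3,4,1,2) f gCB fBC] by (simp cong: sum.cong)
  finally show ?thesis .
qed

lemma trace_on_cong:
  "(\<And>b. b \<in> B \<Longrightarrow> f b = g b) \<Longrightarrow> trace_on B f = trace_on B g"
  unfolding trace_on_def by simp

text \<open>On the quotient of \<open>span B\<close> by \<open>span C\<close> the map is zero, so
  nothing is lost from the trace. Formally this is \<open>trace_on_commute\<close> with the
  inclusion as second map.\<close>

lemma trace_on_subspace:
  assumes "finite B" "independent B" "finite C" "independent C"
    and "endomorphism f" "f ` span B \<subseteq> span C" "span C \<subseteq> span B"
  shows "trace_on B f = trace_on C f"
  using trace_on_commute[OF assms(1-5) linear_id[unfolded id_def] assms(6)] assms(7) by simp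

lemma trace_on_add:
  assumes "independent B" "\<And>b. b \<in> B \<Longrightarrow> f b \<in> span B" "\<And>b. b \<in> B \<Longrightarrow> g b \<in> span B"
  shows "trace_on B (\<lambda>x. f x + g x) = trace_on B f + trace_on B g"
  unfolding trace_on_def sum.distrib[symmetric]
  by (intro sum.cong refl) (simp add: representation_add[OF assms(1)] assms)

lemma trace_on_scale:
  assumes "independent B" "\<And>b. b \<in> B \<Longrightarrow> f b \<in> span B"
  shows "trace_on B (\<lambda>x. scale c (f x)) = c * trace_on B f"
  unfolding trace_on_def sum_distrib_left
  by (intro sum.cong refl) (simp add: representation_scale[OF assms(1)] assms)

lemma trace_on_diff:
  assumes "independent B" "\<And>b. b \<in> B \<Longrightarrow> f b \<in> span B" "\<And>b. b \<in> B \<Longrightarrow> g b \<in> span B"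
  shows "trace_on B (\<lambda>x. f x - g x) = trace_on B f - trace_on B g"
  unfolding trace_on_def sum_subtractf[symmetric]
  by (intro sum.cong refl) (simp add: representation_diff[OF assms(1)] assms)

lemma trace_on_zero: "trace_on B (\<lambda>x. 0) = 0"
  unfolding trace_on_def by (simp add: representation_zero)

lemma trace_on_sum:
  assumes "finite I" "independent B" "\<And>i b. i \<in> I \<Longrightarrow> b \<in> B \<Longrightarrow> f i b \<in> span B"
  shows "trace_on B (\<lambda>x. \<Sum>i\<in>I. f i x) = (\<Sum>i\<in>I. trace_on B (f i))"
  using assms(1,3)
proof (induction I rule: finite_induct)
  case empty
  then show ?case by (simp add: trace_on_zero)
next
  case (insert i I)
  have "trace_on B (\<lambda>x. f i x + (\<Sum>i\<in>I. f i x)) = trace_on B (f i) + trace_on B (\<lambda>x. \<Sum>i\<in>I. f i x)"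
    using insert.prems by (intro trace_on_add assms(2)) (auto intro: span_sum)
  then show ?case using insert by simp
qed

lemma trace_on_scalar:
  assumes "finite B" "independent B"
  shows "trace_on B (\<lambda>x. scale c x) = c * of_nat (card B)"
proof -
  have "representation B (scale c b) b = c" if "b \<in> B" for b
    using that assms(2) by (simp add: representation_scale span_base representation_basis)
  then show ?thesis unfolding trace_on_def by (simp add: mult.commute)
qed

text \<open>Replacing \<open>span B\<close> by its image under \<open>f\<close> keeps the trace, by
  \<open>trace_on_subspace\<close>, and lowers the order of nilpotency by one.\<close>

lemma trace_on_nilpotent:
  assumes "finite B" "independent B" "endomorphism f" "f ` span B \<subseteq> span B"
    and "\<And>x. x \<in> span B \<Longrightarrow> (f ^^ n) x = 0"
  shows "trace_on B f = 0"
  using assms(1,2,4,5)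
proof (induction n arbitrary: B)
  case 0
  then have "span B \<subseteq> {0}" by auto
  then have "b = 0" if "b \<in> B" for b using that span_base by blast
  then show ?case
    unfolding trace_on_def using endo.linear_0[OF assms(3)]
    by (intro sum.neutral ballI) (metis representation_zero)
next
  case (Suc n)
  have "finite_dim (f ` span B)"
    using finite_dim_linear_image[OF assms(3) finite_dim_span] Suc.prems(1) .
  then obtain C where C: "finite C" "independent C" "span C = f ` span B"
    by (metis finite_dim_basis)
  have "trace_on B f = trace_on C f"
    using trace_on_subspace[OF Suc.prems(1,2) C(1,2) assms(3)] C(3) Suc.prems(3) by simp
  also have "\<dots> = 0"
    using Suc.prems(3,4) C by (intro Suc.IH) (auto simp: funpow_swap1)
  finally show ?case .
qed

section \<open>Polynomials in an endomorphism and generalized eigenspaces\<close>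

definition poly_apply :: "'a poly \<Rightarrow> ('b \<Rightarrow> 'b) \<Rightarrow> 'b \<Rightarrow> 'b"
  where "poly_apply p f v = fold_coeffs (\<lambda>a w. scale a v + f w) p 0"

context
  fixes f :: "'b \<Rightarrow> 'b"
  assumes lin: "endomorphism f"
begin

lemma poly_apply_0 [simp]: "poly_apply 0 f v = 0"
  by (simp add: poly_apply_def)

lemma poly_apply_pCons: "poly_apply (pCons a p) f v = scale a v + f (poly_apply p f v)"
  by (cases "p = 0 \<and> a = 0") (auto simp: poly_apply_def endo.linear_0[OF lin])

lemma poly_apply_1: "poly_apply 1 f v = v"
  by (simp add: one_pCons poly_apply_pCons endo.linear_0[OF lin])

lemma poly_apply_add: "poly_apply (p + q) f v = poly_apply p f v + poly_apply q f v"
  by (induction p q rule: poly_induct2)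
    (auto simp: poly_apply_pCons endo.linear_add[OF lin] scale_left_distrib)

lemma poly_apply_smult: "poly_apply (smult c p) f v = scale c (poly_apply p f v)"
  by (induction p) (auto simp: poly_apply_pCons endo.linear_scale[OF lin] scale_right_distrib)

lemma poly_apply_uminus: "poly_apply (- p) f v = - poly_apply p f v"
  using poly_apply_smult[of "-1" p v] by simp

lemma poly_apply_diff: "poly_apply (p - q) f v = poly_apply p f v - poly_apply q f v"
  using poly_apply_add[of p "- q" v] by (simp add: poly_apply_uminus)

lemma poly_apply_mult: "poly_apply (p * q) f v = poly_apply p f (poly_apply q f v)"
  by (induction p) (auto simp: poly_apply_pCons poly_apply_add poly_apply_smult mult_pCons_left)

lemma poly_apply_sum: "poly_apply (\<Sum>i\<in>I. p i) f v = (\<Sum>i\<in>I. poly_apply (p i) f v)"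
  by (induction I rule: infinite_finite_induct) (auto simp: poly_apply_add)

lemma linear_poly_apply: "endomorphism (poly_apply p f)"
proof (induction p)
  case 0
  then show ?case by (intro endomorphismI) (simp_all add: poly_apply_def)
next
  case (pCons a p)
  then show ?case
    by (intro endomorphismI)
      (simp_all add: poly_apply_pCons endo.linear_add endo.linear_scale lin scale_right_distrib mult.commute)
qed

lemma poly_apply_in_subspace:
  assumes "subspace U" "f ` U \<subseteq> U" "v \<in> U"
  shows "poly_apply p f v \<in> U"
  using assms by (induction p) (auto simp: poly_apply_pCons subspace_0 intro!: subspace_add subspace_scale)

lemma poly_apply_dvd_zero: "p dvd q \<Longrightarrow> poly_apply p f v = 0 \<Longrightarrow> poly_apply q f v = 0"
  by (metis dvd_def poly_apply_mult mult.commute endo.linear_0[OF linear_poly_apply])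

lemma poly_apply_monom: "poly_apply (Polynomial.monom 1 n) f v = (f ^^ n) v"
  by (induction n) (auto simp: monom_0 monom_Suc poly_apply_pCons endo.linear_0[OF lin])

lemma poly_apply_linear_factor_power:
  "poly_apply ([:- c, 1:] ^ n) f v = ((\<lambda>w. f w - scale c w) ^^ n) v"
  by (induction n) (auto simp: poly_apply_1 poly_apply_mult poly_apply_pCons poly_apply_diff
      poly_apply_smult endo.linear_0[OF lin])

text \<open>The coefficient condition ensures that \<open>X^n - q\<close> is a nonzero polynomial
  when \<open>x\<close> is the next iterate \<open>(f ^^ n) v\<close>.\<close>

lemma span_iterates:
  assumes "x \<in> span ((\<lambda>i. (f ^^ i) v) ` {..<n})"
  obtains q where "x = poly_apply q f v" "Polynomial.coeff q n = 0"
proof -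
  let ?P = "\<lambda>q. \<forall>i\<ge>n. Polynomial.coeff q i = 0"
  let ?V = "{poly_apply q f v | q. ?P q}"
  have "subspace ?V"
  proof (rule subspaceI)
    show "0 \<in> ?V" by (auto intro!: exI[of _ 0])
  next
    fix x y assume "x \<in> ?V" "y \<in> ?V"
    then obtain p q where "x = poly_apply p f v" "?P p" "y = poly_apply q f v" "?P q" by blast
    then show "x + y \<in> ?V" by (auto intro!: exI[of _ "p + q"] simp: poly_apply_add)
  next
    fix c x assume "x \<in> ?V"
    then obtain p where "x = poly_apply p f v" "?P p" by blast
    then show "scale c x \<in> ?V" by (auto intro!: exI[of _ "smult c p"] simp: poly_apply_smult)
  qed
  moreover have "(\<lambda>i. (f ^^ i) v) ` {..<n} \<subseteq> ?V"
  proof (rule image_subsetI)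
    fix i assume "i \<in> {..<n}"
    then have "(f ^^ i) v = poly_apply (Polynomial.monom 1 i) f v \<and> ?P (Polynomial.monom 1 i)"
      by (simp add: poly_apply_monom)
    then show "(f ^^ i) v \<in> ?V" by blast
  qed
  ultimately have sp: "span ((\<lambda>i. (f ^^ i) v) ` {..<n}) \<subseteq> ?V" by (intro span_minimal)
  have "x \<in> ?V" by (rule subsetD[OF sp assms])
  then obtain q where "x = poly_apply q f v" "?P q" by blast
  then show thesis by (intro that[of q]) simp_all
qed

lemma annihilating_poly:
  assumes "finite_dim U" "f ` U \<subseteq> U" "v \<in> U"
  obtains p where "p \<noteq> 0" "poly_apply p f v = 0"
proof -
  let ?s = "\<lambda>n. (\<lambda>i. (f ^^ i) v) ` {..<n}"
  have sU: "(f ^^ i) v \<in> U" for i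
    by (induction i) (use assms in auto)
  obtain B where B: "finite B" "span B = U" by (metis finite_dim_basis assms(1))
  \<comment> \<open>Otherwise the iterates of \<open>v\<close> would be independent, and there would
    be more of them than a spanning set of \<open>U\<close> has elements.\<close>
  have "\<exists>n. (f ^^ n) v \<in> span (?s n)"
  proof (rule ccontr)
    assume *: "\<not> ?thesis"
    have "independent (?s n) \<and> card (?s n) = n" for n
    proof (induction n)
      case 0
      then show ?case by (simp add: independent_empty)
    next
      case (Suc n)
      have "(f ^^ n) v \<notin> span (?s n)" using * by blast
      moreover from this have "(f ^^ n) v \<notin> ?s n" by (rule contra_subsetD[OF span_superset])
      moreover have "?s (Suc n) = insert ((f ^^ n) v) (?s n)" by (simp add: lessThan_Suc)
      ultimately show ?case using Suc by (simp add: independent_insertI)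
    qed
    then have s: "independent (?s (Suc (card B)))" "card (?s (Suc (card B))) = Suc (card B)"
      by blast+
    have "?s (Suc (card B)) \<subseteq> span B" unfolding B(2) by (rule image_subsetI, rule sU)
    with independent_span_bound[OF B(1) s(1)] s(2) show False by simp
  qed
  then obtain n where "(f ^^ n) v \<in> span (?s n)" by blast
  then obtain q where q: "(f ^^ n) v = poly_apply q f v" "Polynomial.coeff q n = 0"
    by (rule span_iterates)
  have "poly_apply (Polynomial.monom 1 n - q) f v = 0"
    using q(1) by (simp add: poly_apply_diff poly_apply_monom)
  moreover have "Polynomial.coeff (Polynomial.monom 1 n - q) n = 1" using q(2) by simp
  ultimately show thesis using that by (metis coeff_0 zero_neq_one)
qed

lemma annihilating_poly_subspace:
  assumes "finite_dim U" "f ` U \<subseteq> U"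
  obtains p where "p \<noteq> 0" "\<And>v. v \<in> U \<Longrightarrow> poly_apply p f v = 0"
proof -
  obtain B where B: "finite B" "span B = U" by (metis finite_dim_basis assms(1))
  have "\<exists>p. p \<noteq> 0 \<and> poly_apply p f b = 0" if "b \<in> B" for b
  proof -
    have "b \<in> U" using that B(2) span_base by blast
    from annihilating_poly[OF assms this] show ?thesis by blast
  qed
  then have "\<forall>b\<in>B. \<exists>p. p \<noteq> 0 \<and> poly_apply p f b = 0" by (rule ballI)
  from bchoice[OF this] obtain p where p: "\<And>b. b \<in> B \<Longrightarrow> p b \<noteq> 0 \<and> poly_apply (p b) f b = 0" by blast
  let ?q = "\<Prod>b\<in>B. p b"
  have "poly_apply ?q f v = 0" if "v \<in> U" for v
  proof (rule endo.linear_eq_0_on_span[OF linear_poly_apply])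
    show "poly_apply ?q f b = 0" if "b \<in> B" for b
      using p[OF that] poly_apply_dvd_zero[OF dvd_prodI[OF B(1) that]] by blast
    show "v \<in> span B" using that B(2) by simp
  qed
  moreover have "?q \<noteq> 0" using p prod_zero_iff[OF B(1), of p] by blast
  ultimately show thesis by (intro that[of ?q])
qed

lemma generalized_eigenvectors_disjoint:
  assumes "poly_apply ([:- c, 1:] ^ m) f v = 0" "poly_apply ([:- d, 1:] ^ n) f v = 0" "c \<noteq> d"
  shows "v = 0"
proof -
  have "poly [:- c, 1:] d \<noteq> 0" using assms(3) by simp
  then have "poly ([:- c, 1:] ^ m) d \<noteq> 0" unfolding poly_power by (rule power_not_zero)
  then obtain a b where ab: "a * [:- c, 1:] ^ m + b * [:- d, 1:] ^ n = 1"
    by (rule bezout_linear_factor_power)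
  have "v = poly_apply (a * [:- c, 1:] ^ m + b * [:- d, 1:] ^ n) f v"
    by (simp only: ab poly_apply_1)
  also have "\<dots> = 0"
    by (simp only: poly_apply_add poly_apply_mult assms endo.linear_0[OF linear_poly_apply] add_0)
  finally show ?thesis .
qed

end

end

locale ac_linear_space = linear_space scale
  for scale :: "'a::{alg_closed_field,field_char_0} \<Rightarrow> 'b::ab_group_add \<Rightarrow> 'b"
begin

text \<open>The components are polynomials in \<open>f\<close> applied to \<open>v\<close>, hence
  remain in every subspace that contains \<open>v\<close> and is preserved by \<open>f\<close>. The
  annihilation hypothesis concerns single vectors, so the same statement decomposes a whole space
  and one element of a function space.\<close>

lemma generalized_eigenspace_decomposition:
  assumes "endomorphism f" "p \<noteq> 0"
  obtains A n u where "finite A"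
    "\<And>v. poly_apply p f v = 0 \<Longrightarrow> (\<Sum>c\<in>A. poly_apply (u c) f v) = v"
    "\<And>v c. poly_apply p f v = 0 \<Longrightarrow> c \<in> A \<Longrightarrow> poly_apply ([:- c, 1:] ^ n) f (poly_apply (u c) f v) = 0"
proof -
  obtain A n where A: "finite A" "p dvd (\<Prod>c\<in>A. [:- c, 1:] ^ n)"
    by (rule dvd_prod_linear_factors[OF assms(2)])
  obtain u where u: "A = {} \<or> (\<Sum>c\<in>A. u c) = 1"
    "\<And>c. c \<in> A \<Longrightarrow> (\<Prod>d\<in>A. [:- d, 1:] ^ n) dvd [:- c, 1:] ^ n * u c"
    by (rule partial_fraction_unity[OF A(1), where n = n]) blast
  show thesis
  proof (rule that[OF A(1)])
    fix v assume v: "poly_apply p f v = 0"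
    show "(\<Sum>c\<in>A. poly_apply (u c) f v) = v"
    proof (cases "A = {}")
      case True
      then have "poly_apply 1 f v = 0"
        using poly_apply_dvd_zero[OF assms(1) A(2) v] by simp
      then show ?thesis using True by (simp add: poly_apply_1 assms(1))
    next
      case False
      have "(\<Sum>c\<in>A. poly_apply (u c) f v) = poly_apply (\<Sum>c\<in>A. u c) f v"
        by (rule poly_apply_sum[OF assms(1), symmetric])
      then show ?thesis using u(1) False by (simp add: poly_apply_1 assms(1))
    qed
  next
    fix v c assume v: "poly_apply p f v = 0" and "c \<in> A"
    then have "p dvd [:- c, 1:] ^ n * u c" using A(2) u(2) dvd_trans by blast
    then show "poly_apply ([:- c, 1:] ^ n) f (poly_apply (u c) f v) = 0"
      using poly_apply_dvd_zero[OF assms(1) _ v] by (simp only: poly_apply_mult[OF assms(1), symmetric])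
  qed
qed

end

section \<open>Replicas of an endomorphism\<close>

text \<open>The field is regarded as a vector space over the rationals, and the value 1 at
  \<open>a\<close> is extended linearly. A rational-valued functional is wanted because its squares
  are nonnegative.\<close>

lemma additive_functional_exists:
  fixes a :: "'a::field_char_0"
  assumes "a \<noteq> 0"
  obtains \<phi> :: "'a \<Rightarrow> rat" where "\<And>x y. \<phi> (x + y) = \<phi> x + \<phi> y"
    "\<And>q x. \<phi> (of_rat q * x) = q * \<phi> x" "\<phi> a = 1"
proof -
  interpret V: vector_space "\<lambda>q x. of_rat q * x :: 'a"
    by unfold_locales (simp_all add: algebra_simps of_rat_add of_rat_mult)
  interpret Q: vector_space "(*) :: rat \<Rightarrow> rat \<Rightarrow> rat"
    by unfold_locales (simp_all add: algebra_simps)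
  interpret VQ: vector_space_pair "\<lambda>q x. of_rat q * x :: 'a" "(*) :: rat \<Rightarrow> rat \<Rightarrow> rat" ..
  have "V.independent {a}" using assms by simp
  from VQ.linear_independent_extend[OF this, of "\<lambda>_. 1"] obtain \<phi> where
    \<phi>: "Vector_Spaces.linear (\<lambda>q x. of_rat q * x) (*) \<phi>" "\<phi> a = 1" by blast
  show thesis
    using that[of \<phi>] VQ.linear_add[OF \<phi>(1)] VQ.linear_scale[OF \<phi>(1)] \<phi>(2) by blast
qed

context linear_space
begin

text \<open>Endomorphisms are vectors of this space, so the polynomial calculus above also applies
  to the adjoint action \<open>commutator T\<close>.\<close>

lemma linear_space_fun: "linear_space (\<lambda>c (g :: 'c \<Rightarrow> 'b) w. scale c (g w))"
  by unfold_locales (auto simp: fun_eq_iff scale_right_distrib scale_left_distrib)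

definition commutator :: "('b \<Rightarrow> 'b) \<Rightarrow> ('b \<Rightarrow> 'b) \<Rightarrow> 'b \<Rightarrow> 'b"
  where "commutator f g w = f (g w) - g (f w)"

text \<open>With \<open>D\<close>, \<open>Z\<close> and \<open>E\<close> the three shifted
  operators, \<open>D (g w) = Z g w + g (E w)\<close>. Each summand lowers one of the two exponents,
  so induction on \<open>m + n\<close> applies.\<close>

lemma generalized_eigenvector_shift:
  assumes T: "endomorphism T" and "endomorphism g"
    and "((\<lambda>h w. commutator T h w - scale \<mu> (h w)) ^^ m) g = (\<lambda>_. 0)"
    and "((\<lambda>w. T w - scale \<kappa> w) ^^ n) w = 0"
  shows "((\<lambda>w. T w - scale (\<kappa> + \<mu>) w) ^^ (m + n)) (g w) = 0"
proof -
  define D where "D w = T w - scale (\<kappa> + \<mu>) w" for w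
  define Z where "Z h w = commutator T h w - scale \<mu> (h w)" for h w
  define E where "E w = T w - scale \<kappa> w" for w
  note T_simps = endo.linear_add[OF T] endo.linear_diff[OF T] endo.linear_scale[OF T]
  have D_lin: "endomorphism D"
    by (rule endomorphismI)
      (simp_all add: D_def T_simps scale_right_distrib scale_right_diff_distrib mult.commute)
  have D: "(D ^^ k) (v + w) = (D ^^ k) v + (D ^^ k) w" "(D ^^ k) 0 = 0" for k v w
    by (induction k) (simp_all add: endo.linear_add[OF D_lin] endo.linear_0[OF D_lin])
  have "endomorphism g \<Longrightarrow> (Z ^^ m) g = (\<lambda>_. 0) \<Longrightarrow> (E ^^ n) w = 0 \<Longrightarrow> (D ^^ (m + n)) (g w) = 0"
  proof (induction "m + n" arbitrary: m n g w)
    case 0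
    then show ?case by simp
  next
    case (Suc k)
    note g = endo.linear_add[OF Suc.prems(1)] endo.linear_diff[OF Suc.prems(1)]
      endo.linear_scale[OF Suc.prems(1)] endo.linear_0[OF Suc.prems(1)]
    show ?case
    proof (cases "m = 0 \<or> n = 0")
      case True
      then have "g w = 0" using Suc.prems g by auto
      then show ?thesis by (simp only: D)
    next
      case False
      then obtain m' n' where mn: "m = Suc m'" "n = Suc n'" by (metis not0_implies_Suc)
      have "endomorphism (Z g)"
        by (rule endomorphismI)
          (simp_all add: Z_def commutator_def T_simps g scale_right_distrib scale_right_diff_distrib
            mult.commute)
      moreover have "(Z ^^ m') (Z g) = (\<lambda>_. 0)"
        using Suc.prems(2) unfolding mn funpow_Suc_right by simp
      ultimately have "(D ^^ (m' + n)) (Z g w) = 0"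
        using Suc.prems(3) Suc.hyps(2) mn by (intro Suc.hyps(1)) simp_all
      moreover have "(E ^^ n') (E w) = 0"
        using Suc.prems(3) unfolding mn funpow_Suc_right by simp
      then have "(D ^^ (m + n')) (g (E w)) = 0"
        using Suc.prems(1,2) Suc.hyps(2) mn by (intro Suc.hyps(1)) simp_all
      moreover have "m' + n = k" "m + n' = k" using Suc.hyps(2) mn by simp_all
      moreover have "D (g w) = Z g w + g (E w)"
        by (simp add: D_def Z_def E_def commutator_def g scale_left_distrib)
      ultimately have "(D ^^ k) (D (g w)) = 0" by (simp add: D)
      then show ?thesis unfolding Suc.hyps(2)[symmetric] funpow_Suc_right by simp
    qed
  qed
  then show ?thesis using assms(2-4) unfolding D_def[abs_def] Z_def[abs_def] E_def[abs_def] by blast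
qed

end

context ac_linear_space
begin

interpretation fn: ac_linear_space "\<lambda>c (g :: 'b \<Rightarrow> 'b) w. scale c (g w)"
  by (intro ac_linear_space.intro linear_space_fun)

lemma fn_poly_apply_linear_factor_power:
  assumes "fn.endomorphism z"
  shows "fn.poly_apply ([:- c, 1:] ^ n) z g = ((\<lambda>h w. z h w - scale c (h w)) ^^ n) g"
  unfolding fn.poly_apply_linear_factor_power[OF assms]
  by (rule arg_cong[of _ _ "\<lambda>f. (f ^^ n) g"]) (simp add: fun_eq_iff)

text \<open>The replica \<open>y\<close> of \<open>T\<close> acts on the generalized eigenspace for \<open>c\<close> as the scalar \<open>\<phi> c\<close>,
  for an additive map \<open>\<phi>\<close> into the rationals. Its adjoint action preserves every subspace that
  the adjoint action of \<open>T\<close> preserves, and applying \<open>\<phi>\<close> to the trace of \<open>T y\<close> gives a sum of squares.\<close>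

lemma nilpotent_if_trace_zero:
  assumes T: "endomorphism T"
    and C: "finite C" "independent C" "\<And>w. T w \<in> span C"
    and G: "fn.finite_dim G" "\<And>g. g \<in> G \<Longrightarrow> endomorphism g"
    and TG: "\<And>g. g \<in> G \<Longrightarrow> commutator T g \<in> G"
    and trace: "\<And>y. endomorphism y \<Longrightarrow> y ` span C \<subseteq> span C \<Longrightarrow>
      (\<And>g. g \<in> G \<Longrightarrow> commutator y g \<in> G) \<Longrightarrow> trace_on C (\<lambda>w. T (y w)) = 0"
  obtains n where "\<And>w. (T ^^ n) w = 0"
proof -
  have TC: "T ` span C \<subseteq> span C" using C(3) by blast
  obtain p0 where p0: "p0 \<noteq> 0" "\<And>v. v \<in> span C \<Longrightarrow> poly_apply p0 T v = 0"
    by (rule annihilating_poly_subspace[OF T finite_dim_span[OF C(1)] TC]) blast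
  \<comment> \<open>\<open>p0\<close> kills \<open>span C\<close> only. The extra factor
    \<open>X\<close> first maps an arbitrary vector into \<open>span C\<close>, so \<open>p\<close>
    kills everything.\<close>
  define p where "p = p0 * [:0, 1:]"
  have "p \<noteq> 0" using p0(1) by (simp add: p_def)
  have p: "poly_apply p T w = 0" for w
  proof -
    have "poly_apply [:0, 1:] T w = T w"
      by (simp add: poly_apply_pCons T endo.linear_0[OF T])
    then show ?thesis using p0(2)[OF C(3)] by (simp add: p_def poly_apply_mult[OF T] del: mult_pCons_right)
  qed
  obtain A n u where A: "finite A"
    and sum0: "\<And>v. poly_apply p T v = 0 \<Longrightarrow> (\<Sum>c\<in>A. poly_apply (u c) T v) = v"
    and eig0: "\<And>v c. poly_apply p T v = 0 \<Longrightarrow> c \<in> A \<Longrightarrow>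
      poly_apply ([:- c, 1:] ^ n) T (poly_apply (u c) T v) = 0"
    by (rule generalized_eigenspace_decomposition[OF T \<open>p \<noteq> 0\<close>]) blast
  define P where "P c = poly_apply (u c) T" for c
  have P: "endomorphism (P c)" for c unfolding P_def by (rule linear_poly_apply[OF T])
  have sumP: "(\<Sum>c\<in>A. P c v) = v" for v using sum0[OF p] by (simp add: P_def)
  have eigP: "poly_apply ([:- c, 1:] ^ n) T (P c v) = 0" if "c \<in> A" for c v
    using eig0[OF p that] by (simp add: P_def)
  have PC: "P c v \<in> span C" if "v \<in> span C" for c v
    unfolding P_def by (rule poly_apply_in_subspace[OF T subspace_span TC that])
  have P0: "P c v = 0" if "poly_apply ([:- k, 1:] ^ m) T v = 0" "c \<in> A" "c \<noteq> k" for c k m v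
  proof (rule generalized_eigenvectors_disjoint[OF T eigP[OF that(2)] _ that(3)])
    have "poly_apply ([:- k, 1:] ^ m) T (P c v) = poly_apply (u c) T (poly_apply ([:- k, 1:] ^ m) T v)"
      unfolding P_def poly_apply_mult[OF T, symmetric] by (simp only: mult.commute)
    then show "poly_apply ([:- k, 1:] ^ m) T (P c v) = 0"
      using that(1) by (simp only: endo.linear_0[OF linear_poly_apply[OF T]])
  qed
  have zlin: "fn.endomorphism (commutator T)"
    by (rule fn.endomorphismI)
      (simp_all add: fun_eq_iff commutator_def endo.linear_add[OF T] endo.linear_scale[OF T]
        scale_right_diff_distrib)
  have zG: "commutator T ` G \<subseteq> G" using TG by blast
  have subG: "fn.subspace G" using G(1) unfolding fn.finite_dim_def by blast
  \<comment> \<open>No nonzero eigenvalue survives: \<open>\<phi>\<close> is normalized by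
    \<open>\<phi> c = 1\<close>, so in the vanishing sum of squares the term of \<open>c\<close> is
    the dimension of its component.\<close>
  have nP: "P c v = 0" if c: "c \<in> A" "c \<noteq> 0" and v: "v \<in> span C" for c v
  proof -
    obtain \<phi> :: "'a \<Rightarrow> rat" where \<phi>: "\<And>x y. \<phi> (x + y) = \<phi> x + \<phi> y"
      "\<And>q x. \<phi> (of_rat q * x) = q * \<phi> x" "\<phi> c = 1"
      by (rule additive_functional_exists[OF c(2)]) blast
    have \<phi>0: "\<phi> 0 = 0" using \<phi>(1)[of 0 0] by simp
    define y where "y w = (\<Sum>c\<in>A. scale (of_rat (\<phi> c)) (P c w))" for w
    have y: "endomorphism y"
      by (rule endomorphismI)
        (simp_all add: y_def endo.linear_add[OF P] endo.linear_scale[OF P] scale_right_distrib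
          sum.distrib scale_sum_right mult.commute)
    have yeig: "y w = scale (of_rat (\<phi> k)) w" if "poly_apply ([:- k, 1:] ^ m) T w = 0" for k m w
    proof -
      have "y w = (\<Sum>c\<in>A. scale (of_rat (\<phi> k)) (P c w))"
        unfolding y_def by (intro sum.cong refl) (metis P0[OF that] scale_zero_right)
      then show ?thesis by (simp add: scale_sum_right[symmetric] sumP)
    qed
    have yC: "y ` span C \<subseteq> span C"
      unfolding y_def by (auto intro!: span_sum span_scale PC)
    \<comment> \<open>\<open>g\<close> is split into generalized eigenvectors \<open>h \<mu>\<close>
      of the adjoint action of \<open>T\<close>. Each \<open>h \<mu>\<close> shifts a generalized
      eigenvalue \<open>k\<close> to \<open>k + \<mu>\<close>, and additivity of
      \<open>\<phi>\<close> makes the commutator of \<open>y\<close> with \<open>h \<mu>\<close>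
      equal to \<open>\<phi> \<mu>\<close> times \<open>h \<mu>\<close>.\<close>
    have yG: "commutator y g \<in> G" if g: "g \<in> G" for g
    proof -
      obtain q where q: "q \<noteq> 0" "fn.poly_apply q (commutator T) g = 0"
        by (rule fn.annihilating_poly[OF zlin G(1) zG g])
      obtain B m r where B: "finite B"
        and sumB: "\<And>v. fn.poly_apply q (commutator T) v = 0 \<Longrightarrow>
          (\<Sum>c\<in>B. fn.poly_apply (r c) (commutator T) v) = v"
        and eigB: "\<And>v c. fn.poly_apply q (commutator T) v = 0 \<Longrightarrow> c \<in> B \<Longrightarrow>
          fn.poly_apply ([:- c, 1:] ^ m) (commutator T) (fn.poly_apply (r c) (commutator T) v) = 0"
        by (rule fn.generalized_eigenspace_decomposition[OF zlin q(1)]) blast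
      define h where "h c = fn.poly_apply (r c) (commutator T) g" for c
      have hG: "h c \<in> G" for c
        unfolding h_def by (rule fn.poly_apply_in_subspace[OF zlin subG zG g])
      have hlin: "endomorphism (h c)" for c using G(2) hG by blast
      have sumh: "(\<Sum>c\<in>B. h c) = g" using sumB[OF q(2)] by (simp add: h_def)
      have yh: "commutator y (h \<mu>) = (\<lambda>w. scale (of_rat (\<phi> \<mu>)) (h \<mu> w))" if \<mu>: "\<mu> \<in> B" for \<mu>
      proof
        fix w
        have "commutator y (h \<mu>) (P k w) = scale (of_rat (\<phi> \<mu>)) (h \<mu> (P k w))" if k: "k \<in> A" for k
        proof -
          have "((\<lambda>h w. commutator T h w - scale \<mu> (h w)) ^^ m) (h \<mu>) = (\<lambda>_. 0)"
            using eigB[OF q(2) \<mu>] unfolding fn_poly_apply_linear_factor_power[OF zlin]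
            by (simp add: h_def zero_fun_def)
          moreover have "((\<lambda>w. T w - scale k w) ^^ n) (P k w) = 0"
            using eigP[OF k] unfolding poly_apply_linear_factor_power[OF T] .
          ultimately have "poly_apply ([:- (k + \<mu>), 1:] ^ (m + n)) T (h \<mu> (P k w)) = 0"
            unfolding poly_apply_linear_factor_power[OF T]
            by (rule generalized_eigenvector_shift[OF T hlin])
          then have "y (h \<mu> (P k w)) = scale (of_rat (\<phi> (k + \<mu>))) (h \<mu> (P k w))" by (rule yeig)
          moreover have "y (P k w) = scale (of_rat (\<phi> k)) (P k w)" by (rule yeig[OF eigP[OF k]])
          ultimately show ?thesis
            by (simp add: commutator_def endo.linear_scale[OF hlin] \<phi>(1) of_rat_add scale_left_distrib)
        qed
        then have "commutator y (h \<mu>) (\<Sum>k\<in>A. P k w) = scale (of_rat (\<phi> \<mu>)) (h \<mu> (\<Sum>k\<in>A. P k w))"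
          by (simp add: commutator_def endo.linear_sum[OF y] endo.linear_sum[OF hlin]
              sum_subtractf[symmetric] scale_sum_right)
        then show "commutator y (h \<mu>) w = scale (of_rat (\<phi> \<mu>)) (h \<mu> w)" by (simp only: sumP)
      qed
      have comm_sum: "commutator y (\<Sum>c\<in>B. h c) = (\<Sum>c\<in>B. commutator y (h c))"
        using B
      proof (induction B rule: finite_induct)
        case empty
        then show ?case by (simp add: fun_eq_iff commutator_def endo.linear_0[OF y])
      next
        case (insert b B)
        then show ?case
          by (simp add: fun_eq_iff commutator_def endo.linear_add[OF y])
      qed
      have "commutator y g = (\<Sum>c\<in>B. (\<lambda>w. scale (of_rat (\<phi> c)) (h c w)))"
        unfolding sumh[symmetric] comm_sum by (intro sum.cong refl yh)
      also have "\<dots> \<in> G"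
        by (intro fn.subspace_sum subG fn.subspace_scale hG)
      finally show ?thesis .
    qed
    have "\<exists>C'. finite C' \<and> independent C' \<and> span C' = P k ` span C" for k
      using finite_dim_basis[OF finite_dim_linear_image[OF P finite_dim_span[OF C(1)]]] by metis
    then obtain C' where C': "\<And>k. finite (C' k)" "\<And>k. independent (C' k)" "\<And>k. span (C' k) = P k ` span C"
      by metis
    \<comment> \<open>The trace is moved to the image of \<open>P k\<close>, where \<open>T\<close>
      is the scalar \<open>k\<close> plus a nilpotent map.\<close>
    have tr: "trace_on C (\<lambda>w. T (P k w)) = k * of_nat (card (C' k))" if k: "k \<in> A" for k
    proof -
      let ?N = "\<lambda>w. T w - scale k w"
      have sub: "span (C' k) \<subseteq> span C" unfolding C'(3) using PC by blast
      have eigC': "poly_apply ([:- k, 1:] ^ n) T w = 0" if "w \<in> span (C' k)" for w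
        using that eigP[OF k] unfolding C'(3) by blast
      have fixP: "P k w = w" if "poly_apply ([:- k, 1:] ^ n) T w = 0" for w
      proof -
        have "(\<Sum>c\<in>A. P c w) = P k w"
          using P0[OF that] k A by (subst sum.remove[OF A k]) (simp add: sum.neutral)
        then show ?thesis by (simp add: sumP)
      qed
      have TC': "T w \<in> span (C' k)" if w: "w \<in> span (C' k)" for w
      proof -
        have "poly_apply ([:- k, 1:] ^ n) T (T w) = poly_apply ([:- k, 1:] ^ n * [:0, 1:]) T w"
          by (simp add: poly_apply_mult[OF T] poly_apply_pCons T endo.linear_0[OF T] del: mult_pCons_right)
        also have "\<dots> = poly_apply ([:0, 1:] * [:- k, 1:] ^ n) T w" by (simp only: mult.commute)
        also have "\<dots> = 0"
          using eigC'[OF w] by (simp only: poly_apply_mult[OF T] endo.linear_0[OF linear_poly_apply[OF T]])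
        finally have "P k (T w) = T w" by (rule fixP)
        then show ?thesis unfolding C'(3) using C(3) by (metis image_eqI)
      qed
      have "trace_on C (\<lambda>w. T (P k w)) = trace_on (C' k) (\<lambda>w. P k (T w))"
        using sub TC C'(3) by (intro trace_on_commute C C' P T) auto
      also have "\<dots> = trace_on (C' k) (\<lambda>w. ?N w + scale k w)"
      proof (rule trace_on_cong)
        fix b assume "b \<in> C' k"
        then have "T b \<in> span (C' k)" using TC' span_base by blast
        then have "P k (T b) = T b" using eigC' fixP by blast
        then show "P k (T b) = ?N b + scale k b" by simp
      qed
      also have "\<dots> = trace_on (C' k) ?N + trace_on (C' k) (\<lambda>w. scale k w)"
        using TC' by (intro trace_on_add C') (auto intro: span_diff span_scale span_base)
      also have "trace_on (C' k) ?N = 0"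
      proof (rule trace_on_nilpotent[OF C'(1,2)])
        show "endomorphism ?N"
          by (rule endomorphismI) (simp_all add: endo.linear_add[OF T] endo.linear_scale[OF T]
              scale_right_distrib scale_right_diff_distrib mult.commute)
        show "?N ` span (C' k) \<subseteq> span (C' k)"
          using TC' by (auto intro: span_diff span_scale)
        show "(?N ^^ n) w = 0" if "w \<in> span (C' k)" for w
          using eigC'[OF that] unfolding poly_apply_linear_factor_power[OF T] .
      qed
      finally show ?thesis by (simp add: trace_on_scalar C')
    qed
    have "0 = trace_on C (\<lambda>w. T (y w))" using trace[OF y yC yG] by simp
    also have "\<dots> = trace_on C (\<lambda>w. \<Sum>k\<in>A. scale (of_rat (\<phi> k)) (T (P k w)))"
      by (simp add: y_def endo.linear_sum[OF T] endo.linear_scale[OF T])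
    also have "\<dots> = (\<Sum>k\<in>A. trace_on C (\<lambda>w. scale (of_rat (\<phi> k)) (T (P k w))))"
      using C(3) by (intro trace_on_sum A C(2) span_scale) auto
    also have "\<dots> = (\<Sum>k\<in>A. of_rat (\<phi> k) * (k * of_nat (card (C' k))))"
      using C(3) by (intro sum.cong refl) (simp add: trace_on_scale[OF C(2)] tr)
    also have "\<dots> = (\<Sum>k\<in>A. of_rat (\<phi> k * of_nat (card (C' k))) * k)"
      by (simp add: of_rat_mult mult_ac)
    finally have "0 = \<phi> (\<Sum>k\<in>A. of_rat (\<phi> k * of_nat (card (C' k))) * k)" using \<phi>0 by metis
    also have "\<dots> = (\<Sum>k\<in>A. \<phi> (of_rat (\<phi> k * of_nat (card (C' k))) * k))"
      by (induction A rule: infinite_finite_induct) (simp_all add: \<phi>0 \<phi>(1))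
    also have "\<dots> = (\<Sum>k\<in>A. (\<phi> k)\<^sup>2 * of_nat (card (C' k)))"
      by (simp only: \<phi>(2)) (simp add: power2_eq_square mult_ac)
    finally have "\<forall>k\<in>A. (\<phi> k)\<^sup>2 * of_nat (card (C' k)) = 0"
      using sum_nonneg_eq_0_iff[OF A, of "\<lambda>k. (\<phi> k)\<^sup>2 * of_nat (card (C' k))"] by simp
    then have "card (C' c) = 0" using c(1) \<phi>(3) by fastforce
    then have "C' c = {}" using C'(1) by simp
    then have "P c ` span C = {0}" using C'(3)[of c] by simp
    then show ?thesis using v by blast
  qed
  have "(T ^^ n) v = 0" if v: "v \<in> span C" for v
  proof (cases "0 \<in> A")
    case True
    have "v = P 0 v"
      using sumP[of v] nP[OF _ _ v] by (subst (asm) sum.remove[OF A True]) (simp add: sum.neutral)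
    moreover have "((\<lambda>w. T w - scale 0 w) ^^ n) (P 0 v) = 0"
      using eigP[OF True] unfolding poly_apply_linear_factor_power[OF T] .
    ultimately show ?thesis by simp
  next
    case False
    then have "P c v = 0" if "c \<in> A" for c using nP[OF that _ v] that by metis
    then have "v = 0" using sumP[of v] by (simp add: sum.neutral)
    moreover have "(T ^^ n) 0 = 0" by (induction n) (simp_all add: endo.linear_0[OF T])
    ultimately show ?thesis by simp
  qed
  \<comment> \<open>One extra application carries an arbitrary vector into
    \<open>span C\<close>.\<close>
  then have "(T ^^ Suc n) w = 0" for w using C(3)[of w] by (simp add: funpow_swap1)
  then show thesis by (rule that)
qed

end

section \<open>Extension of scalars\<close>

text \<open>The scalar extension of \<open>span B\<close> is modelled by functions into the
  algebraic closure, read as coordinate columns indexed by \<open>B\<close>. The function type also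
  has entries outside \<open>B\<close>; \<open>extend_scalars\<close> ignores these and returns zero
  there, so its values lie in the span of the unit vectors of \<open>B\<close>.\<close>

locale based_linear_space = linear_space scale
  for scale :: "'a::field_char_0 \<Rightarrow> 'b::ab_group_add \<Rightarrow> 'b" +
  fixes B :: "'b set"
  assumes finite_B: "finite B" and independent_B: "independent B"
begin

definition coords :: "'b \<Rightarrow> 'b \<Rightarrow> 'a alg_closure"
  where "coords v b = (if b \<in> B then to_ac (representation B v b) else 0)"

definition extend_scalars :: "('b \<Rightarrow> 'b) \<Rightarrow> ('b \<Rightarrow> 'a alg_closure) \<Rightarrow> 'b \<Rightarrow> 'a alg_closure"
  where "extend_scalars f w b = (\<Sum>c\<in>B. coords (f c) b * w c)"

definition unit_vector :: "'b \<Rightarrow> 'b \<Rightarrow> 'a alg_closure"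
  where "unit_vector b = (\<lambda>c. if c = b then 1 else 0)"

sublocale ext: ac_linear_space "\<lambda>c (w :: 'b \<Rightarrow> 'a alg_closure) b. c * w b"
  by unfold_locales (simp_all add: fun_eq_iff algebra_simps)

lemma coords_add: "v \<in> span B \<Longrightarrow> w \<in> span B \<Longrightarrow> coords (v + w) b = coords v b + coords w b"
  by (simp add: coords_def representation_add[OF independent_B])

lemma coords_diff: "v \<in> span B \<Longrightarrow> w \<in> span B \<Longrightarrow> coords (v - w) b = coords v b - coords w b"
  by (simp add: coords_def representation_diff[OF independent_B])

lemma coords_scale: "v \<in> span B \<Longrightarrow> coords (scale c v) b = to_ac c * coords v b"
  by (simp add: coords_def representation_scale[OF independent_B])

lemma coords_eq_0: "v \<in> span B \<Longrightarrow> coords v = (\<lambda>_. 0) \<Longrightarrow> v = 0"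
  using representation_expand[OF finite_B independent_B, of v]
  by (auto simp: coords_def fun_eq_iff split: if_splits)

lemma coords_apply:
  assumes "endomorphism f" "f ` span B \<subseteq> span B" "v \<in> span B"
  shows "coords (f v) b = (\<Sum>c\<in>B. coords (f c) b * coords v c)"
proof -
  have fc: "f c \<in> span B" if "c \<in> B" for c using that assms(2) span_base by blast
  have "f v = f (\<Sum>c\<in>B. scale (representation B v c) c)"
    by (simp only: representation_expand[OF finite_B independent_B assms(3)])
  also have "\<dots> = (\<Sum>c\<in>B. scale (representation B v c) (f c))"
    by (simp add: endo.linear_sum[OF assms(1)] endo.linear_scale[OF assms(1)])
  finally have "representation B (f v) b = (\<Sum>c\<in>B. representation B (scale (representation B v c) (f c)) b)"
    using representation_sum[OF independent_B, of B "\<lambda>c. scale (representation B v c) (f c)"] fc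
    by (simp add: span_scale)
  also have "\<dots> = (\<Sum>c\<in>B. representation B v c * representation B (f c) b)"
    using fc by (simp add: representation_scale[OF independent_B])
  finally show ?thesis by (simp add: coords_def to_ac_sum mult.commute)
qed

lemma extend_scalars_coords:
  assumes "endomorphism f" "f ` span B \<subseteq> span B" "v \<in> span B"
  shows "extend_scalars f (coords v) = coords (f v)"
  by (rule ext) (simp add: extend_scalars_def coords_apply[OF assms])

lemma extend_scalars_comp:
  assumes "endomorphism f" "f ` span B \<subseteq> span B" "g ` span B \<subseteq> span B"
  shows "extend_scalars f (extend_scalars g w) = extend_scalars (\<lambda>v. f (g v)) w"
proof
  fix b
  have "extend_scalars (\<lambda>v. f (g v)) w b = (\<Sum>d\<in>B. (\<Sum>c\<in>B. coords (f c) b * coords (g d) c) * w d)"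
    unfolding extend_scalars_def
    using assms(3) span_base by (intro sum.cong refl) (subst coords_apply[OF assms(1,2)], auto)
  also have "\<dots> = (\<Sum>c\<in>B. \<Sum>d\<in>B. coords (f c) b * coords (g d) c * w d)"
    unfolding sum_distrib_right by (rule sum.swap)
  also have "\<dots> = extend_scalars f (extend_scalars g w) b"
    by (simp add: extend_scalars_def sum_distrib_left mult.assoc)
  finally show "extend_scalars f (extend_scalars g w) b = extend_scalars (\<lambda>v. f (g v)) w b" by simp
qed

lemma extend_scalars_cong:
  "(\<And>b. b \<in> B \<Longrightarrow> f b = g b) \<Longrightarrow> extend_scalars f = extend_scalars g"
  by (simp add: fun_eq_iff extend_scalars_def)

lemma endomorphism_extend_scalars: "ext.endomorphism (extend_scalars f)"
  by (rule ext.endomorphismI)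
    (auto simp: fun_eq_iff extend_scalars_def algebra_simps sum.distrib sum_distrib_left)

lemma extend_scalars_add:
  assumes "f ` span B \<subseteq> span B" "g ` span B \<subseteq> span B"
  shows "extend_scalars (\<lambda>v. f v + g v) w = extend_scalars f w + extend_scalars g w"
  using assms span_base
  by (auto simp: fun_eq_iff extend_scalars_def coords_add image_subset_iff algebra_simps sum.distrib)

lemma extend_scalars_diff:
  assumes "f ` span B \<subseteq> span B" "g ` span B \<subseteq> span B"
  shows "extend_scalars (\<lambda>v. f v - g v) w = extend_scalars f w - extend_scalars g w"
  using assms span_base
  by (auto simp: fun_eq_iff extend_scalars_def coords_diff image_subset_iff algebra_simps sum_subtractf)

lemma extend_scalars_scale:
  assumes "f ` span B \<subseteq> span B"
  shows "extend_scalars (\<lambda>v. scale c (f v)) w = (\<lambda>b. to_ac c * extend_scalars f w b)"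
  using assms span_base
  by (auto simp: fun_eq_iff extend_scalars_def coords_scale image_subset_iff algebra_simps sum_distrib_left)

lemma expand_unit_vectors:
  assumes "\<And>b. b \<notin> B \<Longrightarrow> w b = 0"
  shows "(\<Sum>b\<in>B. (\<lambda>c. w b * unit_vector b c)) = w"
proof -
  have *: "(\<Sum>b\<in>A. (\<lambda>c. w b * unit_vector b c)) d = (if d \<in> A then w d else 0)" if "finite A" for A d
    using that by (induction A rule: finite_induct) (auto simp: unit_vector_def)
  show ?thesis using assms *[OF finite_B] by (auto simp: fun_eq_iff)
qed

lemma unit_vectors_span:
  assumes "\<And>b. b \<notin> B \<Longrightarrow> w b = 0"
  shows "w \<in> ext.span (unit_vector ` B)"
  by (subst expand_unit_vectors[OF assms, symmetric])
    (assumption | intro ext.span_sum ext.span_scale ext.span_base imageI)+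

lemma inj_unit_vector: "inj_on unit_vector A"
  by (rule inj_onI) (metis unit_vector_def zero_neq_one)

lemma independent_unit_vectors: "ext.independent (unit_vector ` B)"
proof (rule ext.independent_if_scalars_zero)
  show "finite (unit_vector ` B)" using finite_B by simp
next
  fix f x assume *: "(\<Sum>x\<in>unit_vector ` B. (\<lambda>c. f x * x c)) = 0" and "x \<in> unit_vector ` B"
  then obtain b where b: "b \<in> B" "x = unit_vector b" by blast
  define w where "w b = (if b \<in> B then f (unit_vector b) else 0)" for b
  have "(\<Sum>x\<in>unit_vector ` B. (\<lambda>c. f x * x c)) = (\<Sum>b\<in>B. (\<lambda>c. w b * unit_vector b c))"
    by (subst sum.reindex[OF inj_unit_vector]) (simp add: w_def)
  then have "w = 0" using * expand_unit_vectors[of w] by (simp add: w_def)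
  then have "w b = 0" by simp
  then show "f x = 0" using b by (simp add: w_def)
qed

lemma representation_unit_vectors:
  assumes "\<And>b. b \<notin> B \<Longrightarrow> w b = 0" "b \<in> B"
  shows "ext.representation (unit_vector ` B) w (unit_vector b) = w b"
proof -
  have span: "unit_vector c \<in> ext.span (unit_vector ` B)" if "c \<in> B" for c
    using that by (auto intro: ext.span_base)
  have "ext.representation (unit_vector ` B) w (unit_vector b)
    = ext.representation (unit_vector ` B) (\<Sum>c\<in>B. (\<lambda>d. w c * unit_vector c d)) (unit_vector b)"
    using expand_unit_vectors[of w] assms(1) by simp
  also have "\<dots> = (\<Sum>c\<in>B. ext.representation (unit_vector ` B) (\<lambda>d. w c * unit_vector c d) (unit_vector b))"
    using span by (subst ext.representation_sum[OF independent_unit_vectors]) (auto intro: ext.span_scale)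
  also have "\<dots> = (\<Sum>c\<in>B. w c * (if c = b then 1 else 0))"
  proof (intro sum.cong refl)
    fix c assume c: "c \<in> B"
    have "ext.representation (unit_vector ` B) (unit_vector c) (unit_vector b) = (if unit_vector b = unit_vector c then 1 else 0)"
      using c by (subst ext.representation_basis[OF independent_unit_vectors]) simp_all
    also have "\<dots> = (if c = b then 1 else 0)"
      using inj_onD[OF inj_unit_vector, of c b UNIV] by auto
    finally show "ext.representation (unit_vector ` B) (\<lambda>d. w c * unit_vector c d) (unit_vector b)
      = w c * (if c = b then 1 else 0)"
      by (subst ext.representation_scale[OF independent_unit_vectors span[OF c]]) simp
  qed
  also have "\<dots> = w b" using assms(2) finite_B by (simp add: sum.delta' if_distrib cong: if_cong)
  finally show ?thesis .
qed

lemma extend_scalars_in_span: "extend_scalars f w \<in> ext.span (unit_vector ` B)"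
  by (rule unit_vectors_span) (simp add: extend_scalars_def coords_def)

lemma trace_extend_scalars:
  "ext.trace_on (unit_vector ` B) (extend_scalars f) = to_ac (trace_on B f)"
proof -
  have "ext.trace_on (unit_vector ` B) (extend_scalars f) = (\<Sum>b\<in>B. extend_scalars f (unit_vector b) b)"
    unfolding ext.trace_on_def sum.reindex[OF inj_unit_vector] comp_def
    by (intro sum.cong refl representation_unit_vectors) (simp_all add: extend_scalars_def coords_def)
  also have "\<dots> = (\<Sum>b\<in>B. coords (f b) b)"
    using finite_B by (intro sum.cong refl) (simp add: extend_scalars_def unit_vector_def if_distrib cong: if_cong)
  also have "\<dots> = to_ac (trace_on B f)" by (simp add: trace_on_def to_ac_sum coords_def)
  finally show ?thesis .
qed

end

section \<open>Engel's theorem and Cartan's criterion\<close>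

context leibniz_algebra
begin

lemma bracket_add_left: "bracket (x + y) z = bracket x z + bracket y z"
  and bracket_add_right: "bracket z (x + y) = bracket z x + bracket z y"
  and bracket_scale_left: "bracket (scale c x) z = scale c (bracket x z)"
  and bracket_scale_right: "bracket z (scale c x) = scale c (bracket z x)"
  using linear_bracket_left[of z] linear_bracket_right[of z]
  unfolding Vector_Spaces.linear_iff by blast+

lemma bracket_zero [simp]: "bracket 0 z = 0" "bracket z 0 = 0"
  using bracket_scale_left[of 0 0 z] bracket_scale_right[of z 0 0] by simp_all

lemma bracket_minus: "bracket (- x) z = - bracket x z" "bracket z (- x) = - bracket z x"
  using bracket_scale_left[of "- 1" x z] bracket_scale_right[of z "- 1" x] by simp_all

lemma bracket_diff: "bracket (x - y) z = bracket x z - bracket y z" "bracket z (x - y) = bracket z x - bracket z y"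
  using bracket_add_left[of "x - y" y z] bracket_add_right[of z "x - y" y] by simp_all

lemmas bracket_simps = bracket_add_left bracket_add_right bracket_scale_left bracket_scale_right
  bracket_minus bracket_diff

end

text \<open>The order of factors in \<open>\<rho>_bracket\<close> is the one obeyed by right
  multiplications. Linearity is imposed for all arguments so that the calculus of linear maps
  applies, while stability and the bracket relation are tied to \<open>S\<close> and
  \<open>M\<close>. Submodules, and actions modified by a projection, thus fit the same
  locale.\<close>

locale perfect_leibniz_rep = leibniz_algebra scale bracket + E: linear_space sc
  for scale :: "'k::field_char_0 \<Rightarrow> 'v::ab_group_add \<Rightarrow> 'v"
    and bracket :: "'v \<Rightarrow> 'v \<Rightarrow> 'v"
    and sc :: "'k \<Rightarrow> 'e::ab_group_add \<Rightarrow> 'e" +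
  fixes S :: "'v set" and M :: "'e set" and \<rho> :: "'v \<Rightarrow> 'e \<Rightarrow> 'e"
  assumes subspace_S: "subspace S"
    and S_bracket: "x \<in> S \<Longrightarrow> y \<in> S \<Longrightarrow> bracket x y \<in> S"
    and S_finite: "\<exists>D. finite D \<and> S \<subseteq> span D"
    and perfect: "S \<subseteq> span {bracket x y | x y. x \<in> S \<and> y \<in> S}"
    and \<rho>_linear: "E.endomorphism (\<rho> x)"
    and \<rho>_add: "\<rho> (x + y) e = \<rho> x e + \<rho> y e"
    and \<rho>_scale: "\<rho> (scale c x) e = sc c (\<rho> x e)"
    and finite_dim_M: "E.finite_dim M"
    and M_stable: "x \<in> S \<Longrightarrow> e \<in> M \<Longrightarrow> \<rho> x e \<in> M"
    and \<rho>_bracket: "x \<in> S \<Longrightarrow> y \<in> S \<Longrightarrow> e \<in> M \<Longrightarrow> \<rho> (bracket x y) e = \<rho> y (\<rho> x e) - \<rho> x (\<rho> y e)"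
begin

lemmas \<rho>_simps = E.endo.linear_add[OF \<rho>_linear] E.endo.linear_diff[OF \<rho>_linear]
  E.endo.linear_scale[OF \<rho>_linear] E.endo.linear_0[OF \<rho>_linear] E.endo.linear_sum[OF \<rho>_linear]

lemma \<rho>_zero [simp]: "\<rho> 0 e = 0"
  using \<rho>_scale[of 0 0 e] by simp

lemma \<rho>_diff: "\<rho> (x - y) e = \<rho> x e - \<rho> y e"
  using \<rho>_add[of "x - y" y e] by simp

lemma \<rho>_sum: "\<rho> (\<Sum>i\<in>I. f i) e = (\<Sum>i\<in>I. \<rho> (f i) e)"
  by (induction I rule: infinite_finite_induct) (simp_all add: \<rho>_add)

lemma subspace_M: "E.subspace M"
  using finite_dim_M unfolding E.finite_dim_def by blast

text \<open>The form in which perfectness enters Engel's theorem and Cartan's criterion.\<close>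

lemma perfect_induct:
  assumes "x \<in> S" "subspace {x. P x}" "\<And>a b. a \<in> S \<Longrightarrow> b \<in> S \<Longrightarrow> P (bracket a b)"
  shows "P x"
proof -
  have "span {bracket x y | x y. x \<in> S \<and> y \<in> S} \<subseteq> {x. P x}"
    using assms(2,3) by (intro span_minimal) auto
  then show ?thesis using perfect assms(1) by blast
qed

section \<open>Engel's theorem for a perfect algebra\<close>

primrec flag :: "'v set \<Rightarrow> nat \<Rightarrow> 'e set"
  where
    "flag H 0 = M"
  | "flag H (Suc j) = E.span {\<rho> h e | h e. h \<in> H \<and> e \<in> flag H j}"

lemma subspace_flag: "E.subspace (flag H j)"
  by (cases j) (auto simp: subspace_M)

lemma flag_step: "h \<in> H \<Longrightarrow> e \<in> flag H j \<Longrightarrow> \<rho> h e \<in> flag H (Suc j)"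
  by (auto intro: E.span_base)

lemma flag_Suc_subset:
  assumes "E.subspace V" "\<And>h e. h \<in> H \<Longrightarrow> e \<in> flag H j \<Longrightarrow> \<rho> h e \<in> V"
  shows "flag H (Suc j) \<subseteq> V"
  using assms unfolding flag.simps by (intro E.span_minimal) auto

lemma flag_decreasing:
  assumes "H \<subseteq> S"
  shows "flag H (Suc j) \<subseteq> flag H j"
proof (induction j)
  case 0
  show ?case using assms M_stable by (intro flag_Suc_subset) (auto simp: subspace_M)
next
  case (Suc j)
  show ?case
  proof (rule flag_Suc_subset[OF subspace_flag])
    show "\<rho> h e \<in> flag H (Suc j)" if "h \<in> H" "e \<in> flag H (Suc j)" for h e
      using that Suc.IH by (intro flag_step) blast+
  qed
qed

lemma flag_antimono: "H \<subseteq> S \<Longrightarrow> i \<le> j \<Longrightarrow> flag H j \<subseteq> flag H i"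
  by (rule lift_Suc_antimono_le) (simp_all add: flag_decreasing del: flag.simps)

lemma flag_subset: "H \<subseteq> S \<Longrightarrow> flag H j \<subseteq> M"
  using flag_antimono[of H 0 j] by simp

definition kernel :: "'v set"
  where "kernel = {x \<in> S. \<forall>e\<in>M. \<rho> x e = 0}"

lemma subspace_kernel: "subspace kernel"
  by (rule subspaceI) (auto simp: kernel_def \<rho>_add \<rho>_scale subspace_0[OF subspace_S]
      intro: subspace_add[OF subspace_S] subspace_scale[OF subspace_S])

lemma square_in_kernel: "x \<in> S \<Longrightarrow> bracket x x \<in> kernel"
  by (simp add: kernel_def S_bracket \<rho>_bracket)

lemma anticommutator_in_kernel:
  assumes "x \<in> S" "y \<in> S"
  shows "bracket x y + bracket y x \<in> kernel"
  using assms by (auto simp: kernel_def S_bracket \<rho>_bracket \<rho>_add intro: subspace_add[OF subspace_S])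

text \<open>\<open>kernel\<close> is required to lie in \<open>H\<close> because squares and
  anticommutators fall into it, which makes one-sided normalization of \<open>H\<close> sufficient,
  and because an element found to act as zero must belong to \<open>H\<close>.\<close>

definition nilpotent_part :: "'v set \<Rightarrow> bool"
  where "nilpotent_part H \<longleftrightarrow> subspace H \<and> H \<subseteq> S \<and> kernel \<subseteq> H \<and>
    (\<forall>x\<in>H. \<forall>y\<in>H. bracket x y \<in> H) \<and> (\<exists>N. flag H N = {0})"

lemma nilpotent_part_kernel: "nilpotent_part kernel"
proof -
  have "bracket x y \<in> kernel" if "x \<in> kernel" "y \<in> kernel" for x y
    using that by (auto simp: kernel_def S_bracket \<rho>_bracket \<rho>_simps)
  moreover have "flag kernel (Suc 0) \<subseteq> {0}"
    by (rule flag_Suc_subset) (auto simp: kernel_def)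
  then have "flag kernel (Suc 0) = {0}" using E.subspace_0[OF subspace_flag] by blast
  moreover have "kernel \<subseteq> S" by (auto simp: kernel_def)
  ultimately show ?thesis
    unfolding nilpotent_part_def using subspace_kernel by blast
qed

text \<open>If no element outside \<open>H\<close> normalized \<open>H\<close>, iterated brackets with \<open>H\<close> would stay outside \<open>H\<close>,
  while each of them shifts the filtration by one more step and so eventually acts as zero.\<close>

lemma normalizing_element_exists:
  assumes H: "H \<subseteq> S" "kernel \<subseteq> H" "flag H N = {0}"
    and d: "d \<in> S" "d \<notin> H"
  obtains d' where "d' \<in> S" "d' \<notin> H" "\<And>h. h \<in> H \<Longrightarrow> bracket d' h \<in> H"
proof -
  \<comment> \<open>The number \<open>m\<close> counts the brackets taken so far and
    \<open>k\<close> allows for those still to come. The offset \<open>N\<close> makes the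
    filtration hypothesis automatic for \<open>m = 0\<close>: below \<open>N\<close> the target is
    all of \<open>M\<close>, and from \<open>N\<close> on the source is zero. Once \<open>m\<close>
    reaches \<open>2 * N\<close>, \<open>M\<close> itself is sent into
    \<open>flag H N\<close>.\<close>
  have "\<exists>d'. d' \<in> S \<and> d' \<notin> H \<and> (\<forall>h\<in>H. bracket d' h \<in> H)"
    if "2 * N \<le> m + k" "d \<in> S" "d \<notin> H" "\<forall>a. \<forall>e\<in>flag H a. \<rho> d e \<in> flag H (a + m - N)" for d m k
    using that
  proof (induction k arbitrary: d m)
    case 0
    have "\<rho> d e = 0" if "e \<in> M" for e
    proof -
      have "\<rho> d e \<in> flag H (m - N)" using that "0.prems"(4) by (metis add_0 flag.simps(1))
      also have "\<dots> \<subseteq> flag H N" using "0.prems"(1) by (intro flag_antimono H(1)) simp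
      finally show ?thesis using H(3) by simp
    qed
    then have "d \<in> kernel" using "0.prems"(2) by (simp add: kernel_def)
    then show ?case using H(2) "0.prems"(3) by blast
  next
    case (Suc k)
    show ?case
    proof (cases "\<forall>h\<in>H. bracket d h \<in> H")
      case True
      then show ?thesis using Suc.prems by blast
    next
      case False
      then obtain h where h: "h \<in> H" "bracket d h \<notin> H" by blast
      have "\<rho> (bracket d h) e \<in> flag H (a + Suc m - N)" if e: "e \<in> flag H a" for a e
      proof -
        have "e \<in> M" using e flag_subset[OF H(1)] by blast
        then have eq: "\<rho> (bracket d h) e = \<rho> h (\<rho> d e) - \<rho> d (\<rho> h e)"
          using h(1) H(1) Suc.prems(2) by (intro \<rho>_bracket) auto
        have "\<rho> h (\<rho> d e) \<in> flag H (Suc (a + m - N))"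
          using Suc.prems(4) e h(1) by (intro flag_step) blast+
        moreover have "flag H (Suc (a + m - N)) \<subseteq> flag H (a + Suc m - N)"
          by (intro flag_antimono H(1)) simp
        moreover have "\<rho> d (\<rho> h e) \<in> flag H (Suc a + m - N)"
          using Suc.prems(4) flag_step[OF h(1) e] by blast
        ultimately show ?thesis
          unfolding eq using E.subspace_diff[OF subspace_flag] by auto
      qed
      then show ?thesis
        using Suc.prems h S_bracket H(1) by (intro Suc.IH[of "Suc m" "bracket d h"]) auto
    qed
  qed
  moreover have "\<forall>a. \<forall>e\<in>flag H a. \<rho> d e \<in> flag H (a + 0 - N)"
  proof (intro allI ballI)
    fix a e assume e: "e \<in> flag H a"
    show "\<rho> d e \<in> flag H (a + 0 - N)"
    proof (cases "a < N")
      case True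
      then show ?thesis using e d(1) M_stable flag_subset[OF H(1), of a] by auto
    next
      case False
      then have "e = 0" using e H(3) flag_antimono[OF H(1), of N a] by auto
      then show ?thesis by (simp add: \<rho>_simps E.subspace_0[OF subspace_flag])
    qed
  qed
  ultimately show thesis using d that by (metis add_0 order_refl)
qed

text \<open>Because \<open>d\<close> normalizes \<open>H\<close>, it preserves every
  \<open>flag H j\<close>, while \<open>H\<close> maps \<open>flag H j\<close> into the next step.
  Modulo that step, words in the enlarged algebra acting on \<open>flag H j\<close> reduce to
  multiples of powers of \<open>d\<close>, and \<open>m\<close> factors give zero. Hence
  \<open>m\<close> steps of the new flag cost one step of the old.\<close>

lemma nilpotent_part_extend:
  assumes H: "nilpotent_part H" and d: "d \<in> S" "d \<notin> H" "\<And>h. h \<in> H \<Longrightarrow> bracket d h \<in> H"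
    and nil: "\<And>e. e \<in> M \<Longrightarrow> (\<rho> d ^^ m) e = 0"
  shows "nilpotent_part (span (insert d H))"
proof -
  have sub: "subspace H" and HS: "H \<subseteq> S" and KH: "kernel \<subseteq> H"
    and Hbr: "\<And>x y. x \<in> H \<Longrightarrow> y \<in> H \<Longrightarrow> bracket x y \<in> H"
    using H unfolding nilpotent_part_def by blast+
  obtain N where N: "flag H N = {0}" using H unfolding nilpotent_part_def by blast
  let ?H = "span (insert d H)"
  have span_H: "span H = H" using sub by simp
  have H'E: "\<exists>h\<in>H. \<exists>c. x = h + scale c d" if x: "x \<in> ?H" for x
  proof -
    obtain c where "x - scale c d \<in> span H" using x unfolding span_insert by blast
    then have "x - scale c d \<in> H" by (simp only: span_H)
    then show ?thesis by (intro bexI[of _ "x - scale c d"] exI[of _ c]) simp_all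
  qed
  have H'S: "?H \<subseteq> S" using HS d(1) by (intro span_minimal subspace_S) simp
  have HH': "H \<subseteq> ?H" by (meson span_superset subset_insertI order_trans)
  have d': "d \<in> ?H" by (simp add: span_base)
  have hd: "bracket h d \<in> H" if "h \<in> H" for h
  proof -
    have "bracket h d + bracket d h \<in> H"
      using anticommutator_in_kernel[of h d] that HS d(1) KH by blast
    then show ?thesis using subspace_diff[OF sub _ d(3)[OF that]] by fastforce
  qed
  have dd: "bracket d d \<in> H" using square_in_kernel[OF d(1)] KH by blast
  have br: "bracket x y \<in> ?H" if xy: "x \<in> ?H" "y \<in> ?H" for x y
  proof -
    obtain g b where x: "x = g + scale b d" "g \<in> H" using H'E[OF xy(1)] by blast
    obtain h c where y: "y = h + scale c d" "h \<in> H" using H'E[OF xy(2)] by blast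
    have "bracket x y \<in> H"
      unfolding x(1) y(1) bracket_simps using x(2) y(2) Hbr hd dd d(3)
      by (intro subspace_add[OF sub] subspace_scale[OF sub]) blast+
    then show ?thesis using HH' by blast
  qed
  have d_flag: "\<rho> d e \<in> flag H j" if "e \<in> flag H j" for e j
    using that
  proof (induction j arbitrary: e)
    case 0
    then show ?case using M_stable d(1) by simp
  next
    case (Suc j)
    have "flag H (Suc j) \<subseteq> {e. \<rho> d e \<in> flag H (Suc j)}"
    proof (rule flag_Suc_subset)
      show "E.subspace {e. \<rho> d e \<in> flag H (Suc j)}"
        using subspace_flag[of H "Suc j"]
        by (intro E.subspaceI) (auto simp: \<rho>_simps simp del: flag.simps
            intro: E.subspace_0 E.subspace_add E.subspace_scale)
    next
      fix h e assume h: "h \<in> H" and e: "e \<in> flag H j"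
      have "e \<in> M" using e flag_subset[OF HS] by blast
      then have "\<rho> d (\<rho> h e) = \<rho> h (\<rho> d e) - \<rho> (bracket d h) e"
        using h HS d(1) by (subst \<rho>_bracket) auto
      also have "\<dots> \<in> flag H (Suc j)"
        using Suc.IH[OF e] e d(3) h by (intro E.subspace_diff[OF subspace_flag] flag_step)
      finally show "\<rho> h e \<in> {e. \<rho> d e \<in> flag H (Suc j)}" by simp
    qed
    then show ?case using Suc.prems by blast
  qed
  have step: "flag ?H (k + m) \<subseteq> flag H (Suc j)" if k: "flag ?H k \<subseteq> flag H j" for j k
  proof -
    have lin: "E.endomorphism (\<rho> d ^^ i)" for i
      by (induction i) (auto intro!: E.endomorphismI simp: \<rho>_simps E.endo.linear_add E.endo.linear_scale)
    have d_pow: "(\<rho> d ^^ i) e \<in> flag H j" if "e \<in> flag H j" for e i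
      using that d_flag by (induction i) auto
    define V where "V i = {u + (\<rho> d ^^ i) w | u w. u \<in> flag H (Suc j) \<and> w \<in> flag H j}" for i
    have V: "E.subspace (V i)" for i
    proof -
      have "E.subspace ((\<rho> d ^^ i) ` flag H j)"
        by (rule E.endo.linear_subspace_image[OF lin subspace_flag])
      then have "E.subspace {x + y |x y. x \<in> flag H (Suc j) \<and> y \<in> (\<rho> d ^^ i) ` flag H j}"
        by (rule E.subspace_sums[OF subspace_flag])
      moreover have "{x + y |x y. x \<in> flag H (Suc j) \<and> y \<in> (\<rho> d ^^ i) ` flag H j} = V i"
        unfolding V_def by blast
      ultimately show ?thesis by simp
    qed
    have "flag ?H (k + i) \<subseteq> V i" for i
    proof (induction i)
      case 0
      have "e \<in> V 0" if "e \<in> flag H j" for e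
      proof -
        have "e = 0 + (\<rho> d ^^ 0) e" by simp
        then show ?thesis
          unfolding V_def using that E.subspace_0[OF subspace_flag[of H "Suc j"]] by blast
      qed
      then show ?case using k by auto
    next
      case (Suc i)
      have "flag ?H (Suc (k + i)) \<subseteq> V (Suc i)"
      proof (rule flag_Suc_subset[OF V])
        fix x e assume "x \<in> ?H" and "e \<in> flag ?H (k + i)"
        then obtain h c where x: "x = h + scale c d" "h \<in> H" using H'E by blast
        obtain u w where e: "e = u + (\<rho> d ^^ i) w" "u \<in> flag H (Suc j)" "w \<in> flag H j"
          using Suc.IH \<open>e \<in> flag ?H (k + i)\<close> unfolding V_def by blast
        have "\<rho> x e = (\<rho> h u + sc c (\<rho> d u) + \<rho> h ((\<rho> d ^^ i) w)) + (\<rho> d ^^ Suc i) (sc c w)"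
          by (simp add: x(1) e(1) \<rho>_add \<rho>_scale \<rho>_simps E.endo.linear_scale[OF lin]
              E.scale_right_distrib algebra_simps)
        moreover have "\<rho> h u + sc c (\<rho> d u) + \<rho> h ((\<rho> d ^^ i) w) \<in> flag H (Suc j)"
        proof (intro E.subspace_add[OF subspace_flag] E.subspace_scale[OF subspace_flag])
          show "\<rho> h u \<in> flag H (Suc j)"
            using flag_step[OF x(2) e(2)] flag_decreasing[OF HS] by blast
          show "\<rho> d u \<in> flag H (Suc j)" by (rule d_flag[OF e(2)])
          show "\<rho> h ((\<rho> d ^^ i) w) \<in> flag H (Suc j)" by (rule flag_step[OF x(2) d_pow[OF e(3)]])
        qed
        moreover have "sc c w \<in> flag H j" by (rule E.subspace_scale[OF subspace_flag e(3)])
        ultimately show "\<rho> x e \<in> V (Suc i)" unfolding V_def by blast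
      qed
      then show ?case by simp
    qed
    moreover have "V m \<subseteq> flag H (Suc j)"
      unfolding V_def using nil flag_subset[OF HS, of j] by (auto simp del: flag.simps)
    ultimately show ?thesis by blast
  qed
  have "flag ?H (j * m) \<subseteq> flag H j" for j
  proof (induction j)
    case (Suc j)
    then show ?case using step[OF Suc] by (simp add: add.commute)
  qed simp
  then have "flag ?H (N * m) = {0}"
    using N E.subspace_0[OF subspace_flag, of ?H] by blast
  then show ?thesis
    unfolding nilpotent_part_def using H'S br HH' KH by auto
qed

text \<open>A nilpotent part of greatest dimension is all of \<open>S\<close>, so some
  \<open>flag S N\<close> is zero. Since a bracket acts by two-fold products, perfectness gives
  \<open>flag S (Suc j) \<subseteq> flag S (Suc (Suc j))\<close>; the flag is constant from its
  first step on and therefore already zero there.\<close>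

lemma engel:
  assumes nil: "\<And>x. x \<in> S \<Longrightarrow> \<exists>n. \<forall>e\<in>M. (\<rho> x ^^ n) e = 0"
    and "x \<in> S" "e \<in> M"
  shows "\<rho> x e = 0"
proof -
  interpret V: linear_space scale ..
  have fdS: "V.finite_dim S" unfolding V.finite_dim_def using subspace_S S_finite by blast
  have bound: "dim H < Suc (dim S)" if "nilpotent_part H" for H
  proof (cases "H = S")
    case False
    then have "H \<subset> S" "subspace H" using that unfolding nilpotent_part_def by blast+
    then show ?thesis using V.dim_psubset_finite_dim[OF fdS, of H] by simp
  qed simp
  have "\<exists>H. nilpotent_part H \<and> (\<forall>H'. nilpotent_part H' \<longrightarrow> dim H' \<le> dim H)"
    using bound by (intro ex_has_greatest_nat[where k = kernel and b = "Suc (dim S)"] nilpotent_part_kernel) blast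
  then obtain H where H: "nilpotent_part H" "\<And>H'. nilpotent_part H' \<Longrightarrow> dim H' \<le> dim H"
    by blast
  have HS: "H \<subseteq> S" using H(1) unfolding nilpotent_part_def by blast
  have "H = S"
  proof (rule ccontr)
    assume "H \<noteq> S"
    then obtain d where d: "d \<in> S" "d \<notin> H" using HS by blast
    obtain N where "flag H N = {0}" "kernel \<subseteq> H" "subspace H" using H(1) unfolding nilpotent_part_def by blast
    then obtain d' where d': "d' \<in> S" "d' \<notin> H" "\<And>h. h \<in> H \<Longrightarrow> bracket d' h \<in> H"
      using normalizing_element_exists[OF HS _ _ d] by metis
    obtain m where "\<And>e. e \<in> M \<Longrightarrow> (\<rho> d' ^^ m) e = 0" using nil[OF d'(1)] by blast
    from nilpotent_part_extend[OF H(1) d' this] have H': "nilpotent_part (span (insert d' H))" .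
    have "V.finite_dim (span (insert d' H))"
      using H' fdS V.finite_dim_subspace unfolding nilpotent_part_def by blast
    moreover have "H \<subset> span (insert d' H)" using d'(2) span_superset[of "insert d' H"] by blast
    ultimately have "dim H < dim (span (insert d' H))"
      using V.dim_psubset_finite_dim \<open>subspace H\<close> by blast
    then show False using H(2)[OF H'] by simp
  qed
  then obtain N where N: "flag S N = {0}" using H(1) unfolding nilpotent_part_def by blast
  have two: "\<rho> x e \<in> flag S (Suc (Suc j))" if "x \<in> S" "e \<in> flag S j" for x e j
    using that(1)
  proof (rule perfect_induct)
    show "subspace {x. \<rho> x e \<in> flag S (Suc (Suc j))}"
      using subspace_flag[of S "Suc (Suc j)"]
      by (intro subspaceI) (auto simp: \<rho>_add \<rho>_scale simp del: flag.simps
          intro: E.subspace_0 E.subspace_add E.subspace_scale)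
  next
    fix a b assume ab: "a \<in> S" "b \<in> S"
    have "e \<in> M" using that(2) flag_subset[of S] by blast
    then have "\<rho> (bracket a b) e = \<rho> b (\<rho> a e) - \<rho> a (\<rho> b e)" using ab by (intro \<rho>_bracket)
    also have "\<dots> \<in> flag S (Suc (Suc j))"
      using ab that(2) by (intro E.subspace_diff[OF subspace_flag] flag_step)
    finally show "\<rho> (bracket a b) e \<in> flag S (Suc (Suc j))" .
  qed
  have "flag S (Suc j) \<subseteq> flag S (Suc (Suc j))" for j
    by (rule flag_Suc_subset[OF subspace_flag two])
  then have "flag S (Suc 0) \<subseteq> flag S (Suc j)" for j
    by (induction j) (auto simp del: flag.simps)
  then have "flag S (Suc 0) \<subseteq> flag S (Suc N)" .
  also have "\<dots> \<subseteq> {0}" using flag_decreasing[of S N] N by blast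
  finally have "flag S (Suc 0) \<subseteq> {0}" .
  then show ?thesis using flag_step[of x S e 0] assms(2,3) by auto
qed

section \<open>Trace forms and Cartan's criterion\<close>

definition trace_form :: "'e set \<Rightarrow> 'v \<Rightarrow> 'v \<Rightarrow> 'k"
  where "trace_form B x y = E.trace_on B (\<lambda>e. \<rho> x (\<rho> y e))"

text \<open>Engel's theorem reduces the claim to nilpotency of each \<open>\<rho> x\<close>. This is
  tested on matrices over the algebraic closure, where the replica argument applies with
  \<open>G\<close> the span of the matrices of \<open>S\<close>.\<close>

lemma cartan_criterion:
  assumes B: "finite B" "E.independent B" "E.span B = M"
    and zero: "\<And>x y. x \<in> S \<Longrightarrow> y \<in> S \<Longrightarrow> trace_form B x y = 0"
    and xe: "x \<in> S" "e \<in> M"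
  shows "\<rho> x e = 0"
proof (rule engel[OF _ xe])
  fix x assume x: "x \<in> S"
  interpret b: based_linear_space sc B by unfold_locales (fact B)+
  interpret fn: linear_space "\<lambda>c (g :: ('e \<Rightarrow> 'k alg_closure) \<Rightarrow> 'e \<Rightarrow> 'k alg_closure) w b. c * g w b"
    by (rule b.ext.linear_space_fun)
  define A where "A y = b.extend_scalars (\<rho> y)" for y
  let ?C = "b.unit_vector ` B"
  have stab: "\<rho> y ` E.span B \<subseteq> E.span B" if "y \<in> S" for y
    using that M_stable B(3) by auto
  have stab2: "(\<lambda>e. \<rho> y (\<rho> z e)) ` E.span B \<subseteq> E.span B" if "y \<in> S" "z \<in> S" for y z
    using that M_stable B(3) by auto
  have BM: "b \<in> M" if "b \<in> B" for b using that B(3) E.span_base by blast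
  have A_lin: "b.ext.endomorphism (A y)" for y
    unfolding A_def by (rule b.endomorphism_extend_scalars)
  have A_span: "A y w \<in> b.ext.span ?C" for y w
    unfolding A_def by (rule b.extend_scalars_in_span)
  have A_add: "A (y + z) = A y + A z" if "y \<in> S" "z \<in> S" for y z
  proof
    fix w
    have "A (y + z) = b.extend_scalars (\<lambda>e. \<rho> y e + \<rho> z e)"
      unfolding A_def by (rule b.extend_scalars_cong) (simp add: \<rho>_add)
    then show "A (y + z) w = (A y + A z) w"
      using b.extend_scalars_add[OF stab stab] that by (simp add: A_def)
  qed
  have A_scale: "A (scale c y) = (\<lambda>w b. to_ac c * A y w b)" if "y \<in> S" for y c
  proof
    fix w
    have "A (scale c y) = b.extend_scalars (\<lambda>e. sc c (\<rho> y e))"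
      unfolding A_def by (rule b.extend_scalars_cong) (simp add: \<rho>_scale)
    then show "A (scale c y) w = (\<lambda>b. to_ac c * A y w b)"
      using b.extend_scalars_scale[OF stab] that by (simp add: A_def)
  qed
  have A_mult: "A y (A z w) = b.extend_scalars (\<lambda>e. \<rho> y (\<rho> z e)) w" if "y \<in> S" "z \<in> S" for y z w
    unfolding A_def by (rule b.extend_scalars_comp[OF \<rho>_linear stab stab]) (use that in auto)
  have A_bracket: "A (bracket y z) w = A z (A y w) - A y (A z w)" if "y \<in> S" "z \<in> S" for y z w
  proof -
    have "A (bracket y z) = b.extend_scalars (\<lambda>e. \<rho> z (\<rho> y e) - \<rho> y (\<rho> z e))"
      unfolding A_def using that BM by (intro b.extend_scalars_cong \<rho>_bracket)
    then show ?thesis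
      using b.extend_scalars_diff[OF stab2 stab2] that by (simp add: A_mult)
  qed
  define G where "G = fn.span (A ` S)"
  have subG: "fn.subspace G" unfolding G_def by (rule fn.subspace_span)
  have AG: "A y \<in> G" if "y \<in> S" for y
    unfolding G_def using that by (intro fn.span_base imageI)
  have G_lin: "b.ext.endomorphism g" if "g \<in> G" for g
  proof -
    have "G \<subseteq> {g. b.ext.endomorphism g}"
      unfolding G_def
    proof (rule fn.span_minimal)
      show "fn.subspace {g. b.ext.endomorphism g}"
      proof (rule fn.subspaceI)
        show "0 \<in> {g. b.ext.endomorphism g}"
          by (simp, rule b.ext.endomorphismI) (simp_all add: fun_eq_iff)
        show "g + h \<in> {g. b.ext.endomorphism g}"
          if "g \<in> {g. b.ext.endomorphism g}" "h \<in> {g. b.ext.endomorphism g}" for g h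
        proof (rule CollectI, rule b.ext.endomorphismI)
          have g: "b.ext.endomorphism g" and h: "b.ext.endomorphism h" using that by simp_all
          show "(g + h) (v + w) = (g + h) v + (g + h) w" for v w
            by (simp add: b.ext.endo.linear_add[OF g] b.ext.endo.linear_add[OF h])
          show "(g + h) (\<lambda>b. c * w b) = (\<lambda>b. c * (g + h) w b)" for c w
            by (simp add: fun_eq_iff b.ext.endo.linear_scale[OF g] b.ext.endo.linear_scale[OF h] distrib_left)
        qed
        show "(\<lambda>w b. c * g w b) \<in> {g. b.ext.endomorphism g}"
          if "g \<in> {g. b.ext.endomorphism g}" for c g
        proof (rule CollectI, rule b.ext.endomorphismI)
          have g: "b.ext.endomorphism g" using that by simp
          show "(\<lambda>b. c * g (v + w) b) = (\<lambda>b. c * g v b) + (\<lambda>b. c * g w b)" for v w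
            by (simp add: fun_eq_iff b.ext.endo.linear_add[OF g] distrib_left)
          show "(\<lambda>b. c * g (\<lambda>b. d * w b) b) = (\<lambda>b. d * (c * g w b))" for d w
            by (simp add: fun_eq_iff b.ext.endo.linear_scale[OF g])
        qed
      qed
    qed (use A_lin in auto)
    then show ?thesis using that by blast
  qed
  have G_fin: "fn.finite_dim G"
  proof -
    interpret V: linear_space scale ..
    have "V.finite_dim S" unfolding V.finite_dim_def using subspace_S S_finite by blast
    then obtain D where D: "finite D" "span D = S" by (metis V.finite_dim_basis)
    have DS: "D \<subseteq> S" using D(2) span_superset by blast
    have "S \<subseteq> {y \<in> S. A y \<in> fn.span (A ` D)}"
    proof -
      have "span D \<subseteq> {y \<in> S. A y \<in> fn.span (A ` D)}"
      proof (rule span_minimal)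
        show "D \<subseteq> {y \<in> S. A y \<in> fn.span (A ` D)}" using DS by (auto intro: fn.span_base)
        have "A 0 = 0" using A_add[of 0 0] subspace_0[OF subspace_S] by simp
        then show "subspace {y \<in> S. A y \<in> fn.span (A ` D)}"
          by (intro subspaceI)
            (auto simp: A_add A_scale subspace_0[OF subspace_S] fn.span_zero
              intro: subspace_add[OF subspace_S] subspace_scale[OF subspace_S] fn.span_add fn.span_scale)
      qed
      then show ?thesis by (simp only: D(2))
    qed
    then have "G \<subseteq> fn.span (A ` D)"
      unfolding G_def by (intro fn.span_minimal fn.subspace_span) auto
    then show ?thesis unfolding fn.finite_dim_def using subG D(1) by blast
  qed
  have G_comm: "b.ext.commutator (A x) g \<in> G" if "g \<in> G" for g
  proof -
    have "G \<subseteq> {g. b.ext.commutator (A x) g \<in> G}"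

    proof (subst G_def, rule fn.span_minimal)
      have "b.ext.commutator (A x) (A y) = A (bracket y x)" if "y \<in> S" for y
        by (simp add: fun_eq_iff b.ext.commutator_def A_bracket[OF that x])
      then show "A ` S \<subseteq> {g. b.ext.commutator (A x) g \<in> G}"
        using AG S_bracket x by auto
      have add: "b.ext.commutator (A x) (g + h) = b.ext.commutator (A x) g + b.ext.commutator (A x) h" for g h
        by (simp add: fun_eq_iff b.ext.commutator_def b.ext.endo.linear_add[OF A_lin])
      have scale: "b.ext.commutator (A x) (\<lambda>w b. c * g w b) = (\<lambda>w b. c * b.ext.commutator (A x) g w b)" for c g
        by (simp add: fun_eq_iff b.ext.commutator_def b.ext.endo.linear_scale[OF A_lin] algebra_simps)
      have "b.ext.commutator (A x) 0 = 0" using add[of 0 0] by simp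
      then show "fn.subspace {g. b.ext.commutator (A x) g \<in> G}"
        by (intro fn.subspaceI)
          (auto simp: add scale intro: fn.subspace_0[OF subG] fn.subspace_add[OF subG] fn.subspace_scale[OF subG])
    qed
    then show ?thesis using that by blast
  qed
  have G_trace: "b.ext.trace_on ?C (\<lambda>w. A y (g w)) = 0" if y: "y \<in> S" and "g \<in> G" for y g
  proof -
    have "G \<subseteq> {g. b.ext.trace_on ?C (\<lambda>w. A y (g w)) = 0}"
    proof (subst G_def, rule fn.span_minimal)
      show "A ` S \<subseteq> {g. b.ext.trace_on ?C (\<lambda>w. A y (g w)) = 0}"
        using zero[OF y] by (auto simp: A_mult[OF y] b.trace_extend_scalars trace_form_def)
      have "b.ext.trace_on ?C (\<lambda>w. A y ((g + h) w))
        = b.ext.trace_on ?C (\<lambda>w. A y (g w)) + b.ext.trace_on ?C (\<lambda>w. A y (h w))" for g h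
        unfolding plus_fun_apply[of g] b.ext.endo.linear_add[OF A_lin]
        by (intro b.ext.trace_on_add b.independent_unit_vectors A_span)
      moreover have "b.ext.trace_on ?C (\<lambda>w. A y (\<lambda>b. c * g w b)) = c * b.ext.trace_on ?C (\<lambda>w. A y (g w))" for c g
        using b.ext.trace_on_scale[OF b.independent_unit_vectors A_span]
        by (simp add: b.ext.endo.linear_scale[OF A_lin])
      moreover have "b.ext.trace_on ?C (\<lambda>w. A y (0 w)) = 0"
        using b.ext.trace_on_zero[of ?C] b.ext.endo.linear_0[OF A_lin] by (simp add: zero_fun_def)
      ultimately show "fn.subspace {g. b.ext.trace_on ?C (\<lambda>w. A y (g w)) = 0}"
        by (intro fn.subspaceI) auto
    qed
    then show ?thesis using \<open>g \<in> G\<close> by blast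
  qed
  have finC: "finite ?C" using B(1) by simp
  \<comment> \<open>The replica \<open>y\<close> need not come from \<open>S\<close>, so the
    hypothesis on the trace form does not reach it directly. For a bracket of \<open>u\<close> and
    \<open>v\<close>, cyclicity rewrites the trace of its matrix times \<open>y\<close> as the trace
    of \<open>A u\<close> times the commutator of \<open>y\<close> with \<open>A v\<close>, and that
    commutator lies in \<open>G\<close>.\<close>
  have trace: "b.ext.trace_on ?C (\<lambda>w. A x (y w)) = 0"
    if y: "b.ext.endomorphism y" "y ` b.ext.span ?C \<subseteq> b.ext.span ?C"
      and yG: "\<And>g. g \<in> G \<Longrightarrow> b.ext.commutator y g \<in> G" for y
  proof -
    let ?tr = "\<lambda>x. b.ext.trace_on ?C (\<lambda>w. A x (y w))"
    have "x \<in> S \<and> ?tr x = 0"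
      using x
    proof (rule perfect_induct)
      have add: "?tr (u + v) = ?tr u + ?tr v" if "u \<in> S" "v \<in> S" for u v
        unfolding A_add[OF that] plus_fun_apply[of "A u"]
        by (intro b.ext.trace_on_add b.independent_unit_vectors A_span)
      have scale: "?tr (scale c u) = to_ac c * ?tr u" if "u \<in> S" for c u
        unfolding A_scale[OF that] by (intro b.ext.trace_on_scale b.independent_unit_vectors A_span)
      have "?tr 0 = 0" using add[of 0 0] subspace_0[OF subspace_S] by simp
      then show "subspace {x. x \<in> S \<and> ?tr x = 0}"
        by (intro subspaceI) (simp_all add: add scale subspace_0[OF subspace_S]
            subspace_add[OF subspace_S] subspace_scale[OF subspace_S])
    next
      fix u v assume uv: "u \<in> S" "v \<in> S"
      have 1: "?tr (bracket u v) = b.ext.trace_on ?C (\<lambda>w. A v (A u (y w))) - b.ext.trace_on ?C (\<lambda>w. A u (A v (y w)))"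
        unfolding A_bracket[OF uv]
        by (intro b.ext.trace_on_diff b.independent_unit_vectors A_span)
      have 2: "b.ext.trace_on ?C (\<lambda>w. A v (A u (y w))) = b.ext.trace_on ?C (\<lambda>w. A u (y (A v w)))"
      proof (rule b.ext.trace_on_commute[OF finC b.independent_unit_vectors finC b.independent_unit_vectors])
        show "b.ext.endomorphism (\<lambda>w. A u (y w))"
          by (rule b.ext.endomorphismI)
            (simp_all add: b.ext.endo.linear_add[OF A_lin] b.ext.endo.linear_scale[OF A_lin]
              b.ext.endo.linear_add[OF y(1)] b.ext.endo.linear_scale[OF y(1)])
        show "b.ext.endomorphism (A v)" by (rule A_lin)
        show "(\<lambda>w. A u (y w)) ` b.ext.span ?C \<subseteq> b.ext.span ?C" "A v ` b.ext.span ?C \<subseteq> b.ext.span ?C"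
          using A_span by blast+
      qed
      have 3: "b.ext.trace_on ?C (\<lambda>w. A u (y (A v w))) - b.ext.trace_on ?C (\<lambda>w. A u (A v (y w)))
        = b.ext.trace_on ?C (\<lambda>w. A u (y (A v w)) - A u (A v (y w)))"
        by (intro b.ext.trace_on_diff[symmetric] b.independent_unit_vectors A_span)
      have 4: "b.ext.trace_on ?C (\<lambda>w. A u (b.ext.commutator y (A v) w)) = 0"
        by (rule G_trace[OF uv(1) yG[OF AG[OF uv(2)]]])
      have 5: "A u (y (A v w)) - A u (A v (y w)) = A u (b.ext.commutator y (A v) w)" for w
        unfolding b.ext.commutator_def by (rule b.ext.endo.linear_diff[OF A_lin, symmetric])
      have "?tr (bracket u v) = 0" unfolding 1 2 3 5 by (rule 4)
      then show "bracket u v \<in> S \<and> ?tr (bracket u v) = 0" using S_bracket[OF uv] by blast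
    qed
    then show ?thesis ..
  qed
  have "\<exists>n. \<forall>w. (A x ^^ n) w = 0"
  proof (rule b.ext.nilpotent_if_trace_zero[of "A x" ?C G])
    show "b.ext.endomorphism (A x)" by (rule A_lin)
    show "finite ?C" by (rule finC)
    show "b.ext.independent ?C" by (rule b.independent_unit_vectors)
    show "A x w \<in> b.ext.span ?C" for w by (rule A_span)
    show "fn.finite_dim G" by (rule G_fin)
    show "b.ext.endomorphism g" if "g \<in> G" for g using that by (rule G_lin)
    show "b.ext.commutator (A x) g \<in> G" if "g \<in> G" for g using that by (rule G_comm)
    show "b.ext.trace_on ?C (\<lambda>w. A x (y w)) = 0"
      if "b.ext.endomorphism y" "y ` b.ext.span ?C \<subseteq> b.ext.span ?C"
        "\<And>g. g \<in> G \<Longrightarrow> b.ext.commutator y g \<in> G" for y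
      using that by (rule trace)
    show "\<exists>n. \<forall>w. (A x ^^ n) w = 0" if "\<And>w. (A x ^^ n) w = 0" for n
      using that by (intro exI allI)
  qed
  then obtain n where n: "\<And>w. (A x ^^ n) w = 0" by (elim exE) (rule that, elim allE)
  have "(\<rho> x ^^ n) e = 0" if e: "e \<in> M" for e
  proof -
    have pow: "(\<rho> x ^^ k) e \<in> M" for k using e M_stable x by (induction k) auto
    have "(A x ^^ k) (b.coords e) = b.coords ((\<rho> x ^^ k) e)" for k
    proof (induction k)
      case (Suc k)
      then show ?case
        using pow[of k] b.extend_scalars_coords[OF \<rho>_linear stab[OF x]] B(3) by (simp add: A_def)
    qed simp
    from this[of n] have "b.coords ((\<rho> x ^^ n) e) = (\<lambda>_. 0)" by (simp only: n zero_fun_def)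
    then show ?thesis using pow[of n] B(3) by (intro b.coords_eq_0) simp_all
  qed
  then show "\<exists>n. \<forall>e\<in>M. (\<rho> x ^^ n) e = 0" by blast
qed

section \<open>Casimir operators and Whitehead's lemma\<close>

context
  fixes B
  assumes B: "finite B" "E.independent B" "E.span B = M"
begin

lemma rho_square_stable: "x \<in> S \<Longrightarrow> y \<in> S \<Longrightarrow> b \<in> B \<Longrightarrow> \<rho> x (\<rho> y b) \<in> E.span B"
  using M_stable B(3) E.span_base by blast

lemma trace_form_sym:
  assumes "x \<in> S" "y \<in> S"
  shows "trace_form B x y = trace_form B y x"
  unfolding trace_form_def
  by (rule E.trace_on_commute[OF B(1,2) B(1,2) \<rho>_linear \<rho>_linear]) (use assms M_stable B(3) in auto)

lemma trace_form_add_left: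
  assumes "x \<in> S" "y \<in> S" "z \<in> S"
  shows "trace_form B (x + y) z = trace_form B x z + trace_form B y z"
  unfolding trace_form_def \<rho>_add
  by (intro E.trace_on_add B(2) rho_square_stable assms)

lemma trace_form_scale_left:
  assumes "x \<in> S" "z \<in> S"
  shows "trace_form B (scale c x) z = c * trace_form B x z"
  unfolding trace_form_def \<rho>_scale
  by (intro E.trace_on_scale B(2) rho_square_stable assms)

lemma trace_form_zero_left: "trace_form B 0 z = 0"
  unfolding trace_form_def by (simp add: E.trace_on_zero)

lemma trace_form_add_right:
  assumes "x \<in> S" "y \<in> S" "z \<in> S"
  shows "trace_form B z (x + y) = trace_form B z x + trace_form B z y"
  using assms trace_form_add_left[of x y z] trace_form_sym subspace_add[OF subspace_S] by simp

lemma trace_form_diff_left: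
  assumes "x \<in> S" "y \<in> S" "z \<in> S"
  shows "trace_form B (x - y) z = trace_form B x z - trace_form B y z"
  using trace_form_add_left[of "x - y" y z] assms subspace_diff[OF subspace_S] by simp

lemma trace_form_diff_right:
  assumes "x \<in> S" "y \<in> S" "z \<in> S"
  shows "trace_form B z (x - y) = trace_form B z x - trace_form B z y"
  using trace_form_add_right[of "x - y" y z] assms subspace_diff[OF subspace_S] by simp

lemma trace_form_sum_left:
  assumes "\<And>i. i \<in> I \<Longrightarrow> f i \<in> S" "z \<in> S"
  shows "trace_form B (\<Sum>i\<in>I. scale (c i) (f i)) z = (\<Sum>i\<in>I. c i * trace_form B (f i) z)"
  using assms(1)
proof (induction I rule: infinite_finite_induct)
  case (insert i I)
  have "scale (c i) (f i) \<in> S" "(\<Sum>i\<in>I. scale (c i) (f i)) \<in> S"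
    using insert.prems by (auto intro!: subspace_sum[OF subspace_S] subspace_scale[OF subspace_S])
  then show ?case
    using insert assms(2) by (simp add: trace_form_add_left trace_form_scale_left)
qed (simp_all add: trace_form_zero_left)

lemma trace_form_sum_right:
  assumes "\<And>i. i \<in> I \<Longrightarrow> f i \<in> S" "z \<in> S"
  shows "trace_form B z (\<Sum>i\<in>I. scale (c i) (f i)) = (\<Sum>i\<in>I. c i * trace_form B z (f i))"
proof -
  have "(\<Sum>i\<in>I. scale (c i) (f i)) \<in> S"
    using assms(1) by (auto intro!: subspace_sum[OF subspace_S] subspace_scale[OF subspace_S])
  then have "trace_form B z (\<Sum>i\<in>I. scale (c i) (f i)) = trace_form B (\<Sum>i\<in>I. scale (c i) (f i)) z"
    by (rule trace_form_sym[OF assms(2)])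
  also have "\<dots> = (\<Sum>i\<in>I. c i * trace_form B z (f i))"
    using assms by (subst trace_form_sum_left) (auto intro!: sum.cong simp: trace_form_sym)
  finally show ?thesis .
qed

text \<open>After expansion the two sides differ only in the triple products \<open>y x z\<close>
  and \<open>x z y\<close>, whose traces agree by cyclicity.\<close>

lemma trace_form_invariant:
  assumes "x \<in> S" "y \<in> S" "z \<in> S"
  shows "trace_form B (bracket x y) z = - trace_form B x (bracket z y)"
proof -
  let ?t = "\<lambda>a b c. E.trace_on B (\<lambda>e. \<rho> a (\<rho> b (\<rho> c e)))"
  have span3: "\<rho> a (\<rho> b (\<rho> c e)) \<in> E.span B" if "a \<in> S" "b \<in> S" "c \<in> S" "e \<in> B" for a b c e
    using that M_stable B(3) E.span_base by blast
  have BM: "b \<in> M" if "b \<in> B" for b using that B(3) E.span_base by blast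
  have "trace_form B (bracket x y) z = E.trace_on B (\<lambda>e. \<rho> y (\<rho> x (\<rho> z e)) - \<rho> x (\<rho> y (\<rho> z e)))"
    unfolding trace_form_def using assms BM M_stable by (intro E.trace_on_cong \<rho>_bracket) auto
  also have "\<dots> = ?t y x z - ?t x y z"
    by (intro E.trace_on_diff B(2) span3 assms)
  finally have 1: "trace_form B (bracket x y) z = ?t y x z - ?t x y z" .
  have "trace_form B x (bracket z y) = E.trace_on B (\<lambda>e. \<rho> x (\<rho> y (\<rho> z e)) - \<rho> x (\<rho> z (\<rho> y e)))"
    unfolding trace_form_def using assms BM M_stable
    by (intro E.trace_on_cong) (simp add: \<rho>_bracket \<rho>_simps)
  also have "\<dots> = ?t x y z - ?t x z y"
    by (intro E.trace_on_diff B(2) span3 assms)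
  finally have 2: "trace_form B x (bracket z y) = ?t x y z - ?t x z y" .
  have "E.endomorphism (\<lambda>e. \<rho> x (\<rho> z e))"
    by (rule E.endomorphismI) (simp_all add: \<rho>_simps)
  moreover have "(\<lambda>e. \<rho> x (\<rho> z e)) ` E.span B \<subseteq> E.span B" "\<rho> y ` E.span B \<subseteq> E.span B"
    using assms M_stable B(3) by auto
  ultimately have "?t y x z = ?t x z y"
    using E.trace_on_commute[OF B(1,2) B(1,2), of "\<lambda>e. \<rho> x (\<rho> z e)" "\<rho> y"] \<rho>_linear by blast
  then show ?thesis using 1 2 by simp
qed

text \<open>A system of maximal length plays the role of dual bases of \<open>S\<close> modulo the
  radical of the trace form. Indexing by an initial segment of the naturals makes prolongation by
  one pair an update at \<open>m\<close>.\<close>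

definition dual_system :: "nat \<Rightarrow> (nat \<Rightarrow> 'v) \<Rightarrow> (nat \<Rightarrow> 'v) \<Rightarrow> bool"
  where "dual_system m e f \<longleftrightarrow> (\<forall>i<m. e i \<in> S \<and> f i \<in> S) \<and>
    (\<forall>i<m. \<forall>j<m. trace_form B (e i) (f j) = (if i = j then 1 else 0))"

lemma dual_system_swap: "dual_system m e f \<Longrightarrow> dual_system m f e"
  unfolding dual_system_def using trace_form_sym by (metis (mono_tags))

lemma dual_system_bound:
  assumes "finite D" "S \<subseteq> span D" "dual_system m e f"
  shows "m \<le> card D"
proof -
  have eS: "e i \<in> S" "f i \<in> S" if "i < m" for i using assms(3) that unfolding dual_system_def by blast+
  have ef: "trace_form B (e i) (f j) = (if i = j then 1 else 0)" if "i < m" "j < m" for i j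
    using assms(3) that unfolding dual_system_def by blast
  have inj: "inj_on e {..<m}"
  proof (rule inj_onI)
    fix i j assume "i \<in> {..<m}" "j \<in> {..<m}" "e i = e j"
    then have "(if i = j then 1 else 0 :: 'k) = 1" using ef[of i j] ef[of j j] by simp
    then show "i = j" by (simp split: if_splits)
  qed
  have "independent (e ` {..<m})"
  proof (rule independent_if_scalars_zero)
    fix u v assume sum: "(\<Sum>x\<in>e ` {..<m}. scale (u x) x) = 0" and "v \<in> e ` {..<m}"
    then obtain j where j: "j < m" "v = e j" by auto
    have "0 = trace_form B (\<Sum>i<m. scale (u (e i)) (e i)) (f j)"
      using sum by (simp add: sum.reindex[OF inj] trace_form_zero_left)
    also have "\<dots> = (\<Sum>i<m. u (e i) * trace_form B (e i) (f j))"
      using eS j(1) by (intro trace_form_sum_left) auto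
    also have "\<dots> = (\<Sum>i<m. if i = j then u (e i) else 0)"
      using j(1) by (intro sum.cong refl) (simp add: ef)
    also have "\<dots> = u (e j)" using j(1) by simp
    finally show "u v = 0" using j(2) by simp
  qed simp
  moreover have "e ` {..<m} \<subseteq> span D" using eS assms(2) by blast
  ultimately have "card (e ` {..<m}) \<le> card D" using independent_span_bound[OF assms(1)] by blast
  then show ?thesis by (simp add: card_image[OF inj])
qed

text \<open>Otherwise the system could be prolonged by the components of \<open>x\<close> and \<open>y\<close> orthogonal to it.\<close>

lemma maximal_dual_system_expansion:
  assumes ds: "dual_system m e f" and max: "\<And>e f. \<not> dual_system (Suc m) e f"
    and "x \<in> S" "y \<in> S"
  shows "trace_form B (x - (\<Sum>i<m. scale (trace_form B x (f i)) (e i))) y = 0"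
proof (rule ccontr)
  have eS: "e i \<in> S" "f i \<in> S" if "i < m" for i using ds that unfolding dual_system_def by blast+
  have ef: "trace_form B (e i) (f j) = (if i = j then 1 else 0)" if "i < m" "j < m" for i j
    using ds that unfolding dual_system_def by blast
  define x' where "x' = x - (\<Sum>i<m. scale (trace_form B x (f i)) (e i))"
  define y' where "y' = y - (\<Sum>i<m. scale (trace_form B (e i) y) (f i))"
  have sums: "(\<Sum>i<m. scale (trace_form B x (f i)) (e i)) \<in> S" "(\<Sum>i<m. scale (trace_form B (e i) y) (f i)) \<in> S"
    using eS by (auto intro!: subspace_sum[OF subspace_S] subspace_scale[OF subspace_S])
  have x'y'S: "x' \<in> S" "y' \<in> S"
    unfolding x'_def y'_def using sums assms(3,4) by (auto intro: subspace_diff[OF subspace_S])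
  have x'f: "trace_form B x' (f j) = 0" if j: "j < m" for j
  proof -
    have "trace_form B x' (f j) = trace_form B x (f j) - (\<Sum>i<m. trace_form B x (f i) * trace_form B (e i) (f j))"
      unfolding x'_def trace_form_diff_left[OF assms(3) sums(1) eS(2)[OF j]]
      by (subst trace_form_sum_left) (use eS j in auto)
    also have "(\<Sum>i<m. trace_form B x (f i) * trace_form B (e i) (f j)) = (\<Sum>i<m. if i = j then trace_form B x (f i) else 0)"
      using j by (intro sum.cong refl) (simp add: ef)
    finally show ?thesis using j by simp
  qed
  have ey': "trace_form B (e j) y' = 0" if j: "j < m" for j
  proof -
    have "trace_form B (e j) y' = trace_form B (e j) y - (\<Sum>i<m. trace_form B (e i) y * trace_form B (e j) (f i))"
      unfolding y'_def trace_form_diff_right[OF assms(4) sums(2) eS(1)[OF j]]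
      by (subst trace_form_sum_right) (use eS j in auto)
    also have "(\<Sum>i<m. trace_form B (e i) y * trace_form B (e j) (f i)) = (\<Sum>i<m. if i = j then trace_form B (e i) y else 0)"
      using j by (intro sum.cong refl) (simp add: ef)
    finally show ?thesis using j by simp
  qed
  have "trace_form B x' y' = trace_form B x' y - (\<Sum>i<m. trace_form B (e i) y * trace_form B x' (f i))"
    unfolding y'_def trace_form_diff_right[OF assms(4) sums(2) x'y'S(1)]
    by (subst trace_form_sum_right) (use eS x'y'S in auto)
  then have x'y': "trace_form B x' y' = trace_form B x' y" by (simp add: x'f)
  assume "trace_form B x' y \<noteq> 0"
  then have c: "trace_form B x' y' \<noteq> 0" using x'y' by simp
  define e' where "e' = e(m := scale (inverse (trace_form B x' y')) x')"
  define f' where "f' = f(m := y')"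
  have "dual_system (Suc m) e' f'"
    unfolding dual_system_def
    using eS ef x'f ey' x'y'S c
    by (auto simp: e'_def f'_def less_Suc_eq trace_form_scale_left intro: subspace_scale[OF subspace_S])
  then show False using max by blast
qed

text \<open>The operator is built from a maximal dual system, and each of its terms has trace 1. By
  invariance the coefficients of \<open>bracket (e i) y\<close> and of
  \<open>bracket (f i) y\<close> form a matrix and its negative transpose, so the double sums in the
  commutator with \<open>\<rho> y\<close> cancel. These expansions hold up to the radical, which by
  \<open>rad\<close> acts as zero.\<close>

lemma casimir:
  assumes rad: "\<And>x. x \<in> S \<Longrightarrow> (\<And>y. y \<in> S \<Longrightarrow> trace_form B x y = 0) \<Longrightarrow> (\<And>v. v \<in> M \<Longrightarrow> \<rho> x v = 0)"
    and nonzero: "x0 \<in> S" "y0 \<in> S" "trace_form B x0 y0 \<noteq> 0"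
  obtains m e f where "m > 0" "\<And>i. i < m \<Longrightarrow> e i \<in> S" "\<And>i. i < m \<Longrightarrow> f i \<in> S"
    "E.trace_on B (\<lambda>v. \<Sum>i<m. \<rho> (e i) (\<rho> (f i) v)) = of_nat m"
    "\<And>y v. y \<in> S \<Longrightarrow> v \<in> M \<Longrightarrow>
      (\<Sum>i<m. \<rho> (e i) (\<rho> (f i) (\<rho> y v))) = \<rho> y (\<Sum>i<m. \<rho> (e i) (\<rho> (f i) v))"
proof -
  let ?b = "trace_form B"
  obtain D where D: "finite D" "S \<subseteq> span D" using S_finite by blast
  have one: "dual_system 1 (\<lambda>_. scale (inverse (?b x0 y0)) x0) (\<lambda>_. y0)"
    using nonzero unfolding dual_system_def
    by (auto simp: trace_form_scale_left intro: subspace_scale[OF subspace_S])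
  have "\<exists>m. (\<exists>e f. dual_system m e f) \<and> (\<forall>m'. (\<exists>e f. dual_system m' e f) \<longrightarrow> m' \<le> m)"
    using one dual_system_bound[OF D]
    by (intro ex_has_greatest_nat[where k = 1 and b = "Suc (card D)" and f = "\<lambda>m. m"]) (auto simp: less_Suc_eq_le)
  then obtain m e f where ds: "dual_system m e f"
    and max: "\<And>m' e f. dual_system m' e f \<Longrightarrow> m' \<le> m" by blast
  have "m > 0" using max[OF one] by simp
  have no: "\<not> dual_system (Suc m) e f" for e f using max[of "Suc m" e f] by auto
  have eS: "e i \<in> S" "f i \<in> S" if "i < m" for i using ds that unfolding dual_system_def by blast+
  have expand: "\<rho> x v = (\<Sum>i<m. sc (?b x (g i)) (\<rho> (h i) v))"
    if ds': "dual_system m h g" and x: "x \<in> S" and v: "v \<in> M" for x v h g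
  proof -
    have "h i \<in> S" if "i < m" for i using ds' that unfolding dual_system_def by blast
    then have "x - (\<Sum>i<m. scale (?b x (g i)) (h i)) \<in> S"
      using x by (auto intro!: subspace_diff[OF subspace_S] subspace_sum[OF subspace_S] subspace_scale[OF subspace_S])
    then have "\<rho> (x - (\<Sum>i<m. scale (?b x (g i)) (h i))) v = 0"
      using maximal_dual_system_expansion[OF ds' no x] v by (rule rad)
    then show ?thesis by (simp add: \<rho>_diff \<rho>_sum \<rho>_scale)
  qed
  have comm: "(\<Sum>i<m. \<rho> (e i) (\<rho> (f i) (\<rho> y v))) = \<rho> y (\<Sum>i<m. \<rho> (e i) (\<rho> (f i) v))"
    if y: "y \<in> S" and v: "v \<in> M" for y v
  proof -
    define a where "a i j = ?b (bracket (e i) y) (f j)" for i j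
    have 1: "\<rho> (bracket (e i) y) w = (\<Sum>j<m. sc (a i j) (\<rho> (e j) w))" if "i < m" "w \<in> M" for i w
      unfolding a_def using that eS S_bracket y by (intro expand[OF ds]) auto
    have 2: "\<rho> (bracket (f i) y) w = (\<Sum>j<m. sc (- a j i) (\<rho> (f j) w))" if i: "i < m" and w: "w \<in> M" for i w
    proof -
      have "\<rho> (bracket (f i) y) w = (\<Sum>j<m. sc (?b (bracket (f i) y) (e j)) (\<rho> (f j) w))"
        using i w eS S_bracket y by (intro expand[OF dual_system_swap[OF ds]]) auto
      also have "\<dots> = (\<Sum>j<m. sc (- a j i) (\<rho> (f j) w))"
      proof (intro sum.cong refl)
        fix j assume "j \<in> {..<m}"
        then have j: "j < m" by simp
        have "?b (bracket (f i) y) (e j) = - ?b (f i) (bracket (e j) y)"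
          by (rule trace_form_invariant[OF eS(2)[OF i] y eS(1)[OF j]])
        also have "?b (f i) (bracket (e j) y) = a j i"
          unfolding a_def by (rule trace_form_sym[OF eS(2)[OF i] S_bracket[OF eS(1)[OF j] y]])
        finally show "sc (?b (bracket (f i) y) (e j)) (\<rho> (f j) w) = sc (- a j i) (\<rho> (f j) w)" by simp
      qed
      finally show ?thesis .
    qed
    have "\<rho> y (\<rho> (e i) (\<rho> (f i) v)) - \<rho> (e i) (\<rho> (f i) (\<rho> y v))
      = (\<Sum>j<m. sc (a i j) (\<rho> (e j) (\<rho> (f i) v))) + (\<Sum>j<m. sc (- a j i) (\<rho> (e i) (\<rho> (f j) v)))"
      if i: "i < m" for i
    proof -
      have fv: "\<rho> (f i) v \<in> M" using M_stable eS(2)[OF i] v by blast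
      have "\<rho> (bracket (e i) y) (\<rho> (f i) v) = \<rho> y (\<rho> (e i) (\<rho> (f i) v)) - \<rho> (e i) (\<rho> y (\<rho> (f i) v))"
        by (rule \<rho>_bracket[OF eS(1)[OF i] y fv])
      moreover have "\<rho> (e i) (\<rho> (bracket (f i) y) v) = \<rho> (e i) (\<rho> y (\<rho> (f i) v)) - \<rho> (e i) (\<rho> (f i) (\<rho> y v))"
        by (simp add: \<rho>_bracket[OF eS(2)[OF i] y v] \<rho>_simps)
      ultimately have "\<rho> y (\<rho> (e i) (\<rho> (f i) v)) - \<rho> (e i) (\<rho> (f i) (\<rho> y v))
        = \<rho> (bracket (e i) y) (\<rho> (f i) v) + \<rho> (e i) (\<rho> (bracket (f i) y) v)" by simp
      then show ?thesis unfolding 1[OF i fv] 2[OF i v] by (simp only: \<rho>_simps)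
    qed
    then have "(\<Sum>i<m. \<rho> y (\<rho> (e i) (\<rho> (f i) v)) - \<rho> (e i) (\<rho> (f i) (\<rho> y v)))
      = (\<Sum>i<m. \<Sum>j<m. sc (a i j) (\<rho> (e j) (\<rho> (f i) v))) + (\<Sum>i<m. \<Sum>j<m. sc (- a j i) (\<rho> (e i) (\<rho> (f j) v)))"
      by (simp add: sum.distrib)
    also have "(\<Sum>i<m. \<Sum>j<m. sc (- a j i) (\<rho> (e i) (\<rho> (f j) v)))
      = - (\<Sum>i<m. \<Sum>j<m. sc (a i j) (\<rho> (e j) (\<rho> (f i) v)))"
      by (subst sum.swap) (simp add: sum_negf)
    finally show ?thesis by (simp add: sum_subtractf \<rho>_simps)
  qed
  have "E.trace_on B (\<lambda>v. \<Sum>i<m. \<rho> (e i) (\<rho> (f i) v)) = (\<Sum>i<m. E.trace_on B (\<lambda>v. \<rho> (e i) (\<rho> (f i) v)))"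
    using eS rho_square_stable by (intro E.trace_on_sum B(2)) auto
  also have "\<dots> = (\<Sum>i<m. 1)"
    using ds unfolding dual_system_def trace_form_def by (intro sum.cong refl) auto
  finally have "E.trace_on B (\<lambda>v. \<Sum>i<m. \<rho> (e i) (\<rho> (f i) v)) = of_nat m" by simp
  then show thesis using \<open>m > 0\<close> eS comm by (intro that[of m e f])
qed

end

section \<open>Whitehead's lemma, absolute and relative to a submodule\<close>

lemma perfect_leibniz_rep_submodule:
  assumes "E.subspace F" "F \<subseteq> M" "\<And>x e. x \<in> S \<Longrightarrow> e \<in> F \<Longrightarrow> \<rho> x e \<in> F"
  shows "perfect_leibniz_rep scale bracket sc S F \<rho>"
proof (intro perfect_leibniz_rep.intro perfect_leibniz_rep_axioms.intro)
  show "E.finite_dim F" using E.finite_dim_subspace[OF finite_dim_M assms(1,2)] .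
  show "\<rho> (bracket x y) e = \<rho> y (\<rho> x e) - \<rho> x (\<rho> y e)" if "x \<in> S" "y \<in> S" "e \<in> F" for x y e
    using that assms(2) by (intro \<rho>_bracket) auto
qed (fact leibniz_algebra_axioms E.linear_space_axioms assms subspace_S S_bracket S_finite perfect
    \<rho>_linear \<rho>_add \<rho>_scale)+

text \<open>A submodule of least dimension not contained in \<open>M'\<close> has zero trace form: otherwise the
  Casimir operator, which maps into \<open>M'\<close> and has nonzero trace, has a generalized kernel that is a
  smaller such submodule.\<close>

lemma whitehead:
  assumes R_maximal: "\<And>J. subspace J \<Longrightarrow> R \<subseteq> J \<Longrightarrow> J \<subseteq> S \<Longrightarrow>
      (\<And>a x. a \<in> J \<Longrightarrow> x \<in> S \<Longrightarrow> bracket a x \<in> J \<and> bracket x a \<in> J) \<Longrightarrow> J = R \<or> J = S"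
    and R: "R \<subseteq> S" "\<And>x e. x \<in> R \<Longrightarrow> e \<in> M \<Longrightarrow> \<rho> x e = 0"
    and M': "E.subspace M'" "\<not> M \<subseteq> M'" "\<And>x e. x \<in> S \<Longrightarrow> e \<in> M \<Longrightarrow> \<rho> x e \<in> M'"
  obtains e where "e \<in> M" "e \<notin> M'" "\<And>x. x \<in> S \<Longrightarrow> \<rho> x e = 0"
proof -
  define P where "P F \<longleftrightarrow> E.subspace F \<and> F \<subseteq> M \<and> (\<forall>x\<in>S. \<forall>e\<in>F. \<rho> x e \<in> F) \<and> \<not> F \<subseteq> M'" for F
  have "P M" using subspace_M M_stable M'(2) by (simp add: P_def)
  then have "\<exists>F. P F \<and> (\<forall>F'. P F' \<longrightarrow> E.dim F \<le> E.dim F')"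
    by (rule ex_has_least_nat)
  then obtain F where F: "P F" and least: "\<And>F'. P F' \<Longrightarrow> E.dim F \<le> E.dim F'" by blast
  have subF: "E.subspace F" and FM: "F \<subseteq> M" and F_stable: "\<And>x e. x \<in> S \<Longrightarrow> e \<in> F \<Longrightarrow> \<rho> x e \<in> F"
    and FM': "\<not> F \<subseteq> M'"
    using F unfolding P_def by blast+
  interpret F: perfect_leibniz_rep scale bracket sc S F \<rho>
    using perfect_leibniz_rep_submodule[OF subF FM F_stable] .
  obtain B where B: "finite B" "E.independent B" "E.span B = F"
    using E.finite_dim_basis[OF F.finite_dim_M] by metis
  \<comment> \<open>The radical of the trace form on \<open>F\<close> is an ideal containing
    \<open>R\<close>. If it is \<open>S\<close>, Cartan's criterion makes the action on
    \<open>F\<close> trivial, and any vector of \<open>F\<close> outside \<open>M'\<close> will do.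
    If it is \<open>R\<close> and the form is nonzero, the radical acts as zero and there is a
    Casimir operator.\<close>
  define J where "J = {x \<in> S. \<forall>y\<in>S. trace_form B x y = 0}"
  have BM: "b \<in> M" if "b \<in> B" for b using that B(3) E.span_base FM by blast
  have "J = R \<or> J = S"
  proof (rule R_maximal)
    show "subspace J"
      unfolding J_def by (rule subspaceI)
        (auto simp: F.trace_form_add_left[OF B] F.trace_form_scale_left[OF B] F.trace_form_zero_left[OF B]
          intro: subspace_0[OF subspace_S] subspace_add[OF subspace_S] subspace_scale[OF subspace_S])
    have "trace_form B x y = 0" if "x \<in> R" "y \<in> S" for x y
    proof -
      have "trace_form B x y = E.trace_on B (\<lambda>e. 0)"
        unfolding trace_form_def using that R BM M_stable by (intro E.trace_on_cong) auto
      then show ?thesis by (simp add: E.trace_on_zero)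
    qed
    then show "R \<subseteq> J" unfolding J_def using R(1) by blast
    show "J \<subseteq> S" unfolding J_def by blast
  next
    fix a x assume a: "a \<in> J" and x: "x \<in> S"
    have aS: "a \<in> S" using a by (simp add: J_def)
    have 1: "trace_form B (bracket a x) y = 0" if "y \<in> S" for y
      using a x that S_bracket by (simp add: F.trace_form_invariant[OF B] J_def)
    have "trace_form B (bracket x a) y = 0" if y: "y \<in> S" for y
    proof -
      have "trace_form B (bracket x a) y = trace_form B (scale (- 1) (bracket a x)) y"
        unfolding trace_form_def
      proof (rule E.trace_on_cong)
        fix b assume "b \<in> B"
        then have "\<rho> y b \<in> M" using BM M_stable y by blast
        then show "\<rho> (bracket x a) (\<rho> y b) = \<rho> (scale (- 1) (bracket a x)) (\<rho> y b)"
          using x aS by (simp only: \<rho>_scale) (simp add: \<rho>_bracket)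
      qed
      also have "\<dots> = 0"
        using 1[OF y] x aS y S_bracket by (simp only: F.trace_form_scale_left[OF B]) simp
      finally show ?thesis .
    qed
    then show "bracket a x \<in> J \<and> bracket x a \<in> J"
      using 1 x aS S_bracket by (auto simp: J_def)
  qed
  moreover have "\<exists>x0\<in>S. \<exists>y0\<in>S. trace_form B x0 y0 \<noteq> 0 \<Longrightarrow> J \<noteq> R"
  proof
    assume "\<exists>x0\<in>S. \<exists>y0\<in>S. trace_form B x0 y0 \<noteq> 0" and JR: "J = R"
    then obtain x0 y0 where xy0: "x0 \<in> S" "y0 \<in> S" "F.trace_form B x0 y0 \<noteq> 0" by blast
    have rad: "\<rho> x v = 0" if "x \<in> S" "\<And>y. y \<in> S \<Longrightarrow> F.trace_form B x y = 0" "v \<in> F" for x v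
      using that JR R(2) FM unfolding J_def by blast
    obtain m e f where m: "m > 0" and ef: "\<And>i. i < m \<Longrightarrow> e i \<in> S" "\<And>i. i < m \<Longrightarrow> f i \<in> S"
      and tr: "E.trace_on B (\<lambda>v. \<Sum>i<m. \<rho> (e i) (\<rho> (f i) v)) = of_nat m"
      and comm0: "\<And>y v. y \<in> S \<Longrightarrow> v \<in> F \<Longrightarrow>
        (\<Sum>i<m. \<rho> (e i) (\<rho> (f i) (\<rho> y v))) = \<rho> y (\<Sum>i<m. \<rho> (e i) (\<rho> (f i) v))"
      by (rule F.casimir[OF B rad xy0]) blast+
    define C where "C v = (\<Sum>i<m. \<rho> (e i) (\<rho> (f i) v))" for v
    have comm: "C (\<rho> y v) = \<rho> y (C v)" if "y \<in> S" "v \<in> F" for y v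
      unfolding C_def by (rule comm0[OF that])
    have C: "E.endomorphism C"
      by (rule E.endomorphismI) (simp_all add: C_def \<rho>_simps sum.distrib E.scale_sum_right)
    have CF: "C v \<in> F" if "v \<in> F" for v
      unfolding C_def using that ef F_stable by (auto intro!: E.subspace_sum[OF subF])
    have CM': "C v \<in> M'" if "v \<in> F" for v
      unfolding C_def
    proof (rule E.subspace_sum[OF M'(1)])
      fix i assume "i \<in> {..<m}"
      then have "e i \<in> S" "\<rho> (f i) v \<in> M" using that ef F_stable FM by auto
      then show "\<rho> (e i) (\<rho> (f i) v) \<in> M'" by (rule M'(3))
    qed
    have C_pow: "E.endomorphism (C ^^ n)" for n
      by (induction n) (auto intro!: E.endomorphismI simp: E.endo.linear_add[OF C] E.endo.linear_scale[OF C]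
          E.endo.linear_add E.endo.linear_scale)
    have C_pow_F: "(C ^^ n) v \<in> F" if "v \<in> F" for n v
      using that CF by (induction n) auto
    have C_pow_comm: "(C ^^ n) (\<rho> y v) = \<rho> y ((C ^^ n) v)" if "y \<in> S" "v \<in> F" for n y v
      by (induction n) (simp_all add: comm C_pow_F that)
    have C_pow_0: "(C ^^ n) v = 0" if "(C ^^ k) v = 0" "k \<le> n" for n k v
    proof -
      have "(C ^^ n) v = (C ^^ (n - k)) ((C ^^ k) v)"
        using that(2) by (metis comp_apply funpow_add le_add_diff_inverse2)
      then show ?thesis using that(1) E.endo.linear_0[OF C_pow] by simp
    qed
    \<comment> \<open>The Fitting null component of \<open>C\<close>. It is a submodule because
      \<open>C\<close> commutes with the action, and it is proper because a nilpotent
      \<open>C\<close> would have trace zero rather than \<open>m\<close>.\<close>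
    define F0 where "F0 = {v \<in> F. \<exists>n. (C ^^ n) v = 0}"
    have subF0: "E.subspace F0"
    proof (rule E.subspaceI)
      show "0 \<in> F0" unfolding F0_def using E.subspace_0[OF subF] by (auto intro: exI[of _ 0])
    next
      fix v w assume "v \<in> F0" "w \<in> F0"
      then obtain k l where kl: "v \<in> F" "w \<in> F" "(C ^^ k) v = 0" "(C ^^ l) w = 0" unfolding F0_def by blast
      have "(C ^^ max k l) (v + w) = 0"
        using C_pow_0[OF kl(3), of "max k l"] C_pow_0[OF kl(4), of "max k l"]
        by (simp add: E.endo.linear_add[OF C_pow])
      then show "v + w \<in> F0" unfolding F0_def using kl E.subspace_add[OF subF] by blast
    next
      fix c v assume "v \<in> F0"
      then show "sc c v \<in> F0"
        unfolding F0_def using E.subspace_scale[OF subF] E.endo.linear_scale[OF C_pow] by auto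
    qed
    have "F0 \<noteq> F"
    proof
      assume eq: "F0 = F"
      have "\<forall>b\<in>B. \<exists>n. (C ^^ n) b = 0" using B(3) E.span_base eq unfolding F0_def by blast
      from bchoice[OF this] obtain n where n: "\<And>b. b \<in> B \<Longrightarrow> (C ^^ n b) b = 0" by blast
      define N where "N = (\<Sum>b\<in>B. n b)"
      have "(C ^^ N) b = 0" if "b \<in> B" for b
        using that C_pow_0[OF n[OF that]] member_le_sum[OF that, of n] B(1) by (simp add: N_def)
      then have "(C ^^ N) v = 0" if "v \<in> E.span B" for v
        by (rule E.endo.linear_eq_0_on_span[OF C_pow _ that])
      moreover have "C ` E.span B \<subseteq> E.span B" using CF B(3) by auto
      ultimately have "E.trace_on B C = 0" by (intro E.trace_on_nilpotent[OF B(1,2) C])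
      then show False using tr m by (simp add: C_def[abs_def])
    qed
    then have psub: "F0 \<subset> F" unfolding F0_def by blast
    have "P F0"
    proof -
      have "\<rho> x v \<in> F0" if xv: "x \<in> S" "v \<in> F0" for x v
      proof -
        obtain n where "v \<in> F" "(C ^^ n) v = 0" using xv(2) unfolding F0_def by blast
        then have "(C ^^ n) (\<rho> x v) = 0" using C_pow_comm xv(1) by (simp add: \<rho>_simps)
        then show ?thesis unfolding F0_def using F_stable xv(1) \<open>v \<in> F\<close> by blast
      qed
      moreover have "\<not> F0 \<subseteq> M'"
      proof
        assume F0M': "F0 \<subseteq> M'"
        obtain v where v: "v \<in> F" "v \<notin> M'" using FM' by blast
        define I where "I n = (C ^^ n) ` F" for n
        have I_fd: "E.finite_dim (I n)" for n
          unfolding I_def by (rule E.finite_dim_linear_image[OF C_pow F.finite_dim_M])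
        have I_anti: "I (n + k) \<subseteq> I n" for n k
        proof
          fix w assume "w \<in> I (n + k)"
          then obtain u where "u \<in> F" "w = (C ^^ n) ((C ^^ k) u)" by (auto simp: I_def funpow_add)
          then show "w \<in> I n" using C_pow_F unfolding I_def by blast
        qed
        \<comment> \<open>From an exponent of least image dimension on, the images of the powers of
          \<open>C\<close> are constant.\<close>
        obtain n where n: "\<And>k. E.dim (I n) \<le> E.dim (I k)"
          using ex_has_least_nat[of "\<lambda>_. True" 0 "\<lambda>n. E.dim (I n)"] by blast
        have I_eq: "I (n + k) = I n" for k
        proof (rule ccontr)
          assume "I (n + k) \<noteq> I n"
          then have "I (n + k) \<subset> I n" using I_anti by blast
          then have "E.dim (I (n + k)) < E.dim (I n)"
            using E.dim_psubset_finite_dim[OF I_fd] I_fd unfolding E.finite_dim_def by blast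
          then show False using n[of "n + k"] by simp
        qed
        \<comment> \<open>The exponent is \<open>2 * Suc n\<close>, so that
          \<open>(C ^^ Suc n) v\<close> becomes \<open>C ^^ Suc n\<close> applied to
          \<open>w = (C ^^ Suc n) u\<close>. Then \<open>v - w\<close> is in the null component and
          \<open>w\<close>, being a value of \<open>C\<close>, is in \<open>M'\<close>, although
          \<open>v\<close> is not.\<close>
        have "(C ^^ Suc n) v \<in> I (n + Suc n + 1)"
          using v(1) I_eq[of 1] I_eq[of "Suc n + 1"] unfolding I_def by (metis Suc_eq_plus1 add.assoc image_eqI)
        then obtain u where u: "u \<in> F" "(C ^^ Suc n) v = (C ^^ (n + Suc n + 1)) u"
          unfolding I_def by blast
        define w where "w = (C ^^ Suc n) u"
        have "n + Suc n + 1 = Suc n + Suc n" by simp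
        then have "(C ^^ Suc n) v = (C ^^ Suc n) w"
          using u(2) unfolding w_def by (metis comp_apply funpow_add)
        then have "(C ^^ Suc n) (v - w) = 0" by (simp only: E.endo.linear_diff[OF C_pow] diff_self)
        moreover have wF: "w \<in> F" unfolding w_def by (rule C_pow_F[OF u(1)])
        ultimately have "v - w \<in> F0" unfolding F0_def using E.subspace_diff[OF subF v(1)] by blast
        moreover have "w \<in> M'" unfolding w_def using CM' C_pow_F u(1) by simp
        ultimately have "(v - w) + w \<in> M'" using F0M' E.subspace_add[OF M'(1)] by blast
        then show False using v(2) by simp
      qed
      ultimately show ?thesis unfolding P_def using subF0 FM psub by blast
    qed
    then show False using least[of F0] E.dim_psubset_finite_dim[OF F.finite_dim_M subF0 psub] by simp
  qed
  ultimately have "trace_form B x y = 0" if "x \<in> S" "y \<in> S" for x y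
    using that unfolding J_def by blast
  then have "\<rho> x e = 0" if "x \<in> S" "e \<in> F" for x e
    using F.cartan_criterion[OF B] that by blast
  then show thesis using that FM FM' by blast
qed

text \<open>The quotient by \<open>A\<close> is replaced by \<open>q\<close>, the identity minus a
  projection onto \<open>A\<close>. It kills exactly \<open>A\<close>, and since \<open>S\<close>
  preserves \<open>A\<close>, the action composed with \<open>q\<close> again satisfies the bracket
  relation. A vector annihilated by the composed action is one that \<open>S\<close> maps into
  \<open>A\<close>.\<close>

lemma whitehead_relative:
  assumes R_maximal: "\<And>J. subspace J \<Longrightarrow> R \<subseteq> J \<Longrightarrow> J \<subseteq> S \<Longrightarrow>
      (\<And>a x. a \<in> J \<Longrightarrow> x \<in> S \<Longrightarrow> bracket a x \<in> J \<and> bracket x a \<in> J) \<Longrightarrow> J = R \<or> J = S"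
    and R: "R \<subseteq> S" "\<And>x e. x \<in> R \<Longrightarrow> e \<in> M \<Longrightarrow> \<rho> x e \<in> A"
    and M': "E.subspace M'" "\<not> M \<subseteq> M'" "M' \<subseteq> M" "\<And>x e. x \<in> S \<Longrightarrow> e \<in> M \<Longrightarrow> \<rho> x e \<in> M'"
    and A: "E.subspace A" "A \<subseteq> M'" "\<And>x e. x \<in> S \<Longrightarrow> e \<in> A \<Longrightarrow> \<rho> x e \<in> A"
  obtains e where "e \<in> M" "e \<notin> M'" "\<And>x. x \<in> S \<Longrightarrow> \<rho> x e \<in> A"
proof -
  obtain p where p: "E.endomorphism p" "range p \<subseteq> A" "\<And>a. a \<in> A \<Longrightarrow> p a = a"
    using E.projection_exists[OF A(1)] by blast
  note p_simps = E.endo.linear_add[OF p(1)] E.endo.linear_diff[OF p(1)] E.endo.linear_scale[OF p(1)]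
    E.endo.linear_0[OF p(1)]
  define q where "q e = e - p e" for e
  have q0: "q e = 0" if "e \<in> A" for e using p(3)[OF that] by (simp add: q_def)
  have qA: "e - q e \<in> A" for e using p(2) by (auto simp: q_def)
  have AM: "A \<subseteq> M" using A(2) M'(3) by blast
  have qM': "q e \<in> M'" if "e \<in> M'" for e
    unfolding q_def using that p(2) A(2) by (intro E.subspace_diff[OF M'(1)]) auto
  have q_lin: "E.endomorphism q"
    by (rule E.endomorphismI) (simp_all add: q_def p_simps E.scale_right_diff_distrib)
  note q_simps = E.endo.linear_add[OF q_lin] E.endo.linear_diff[OF q_lin] E.endo.linear_scale[OF q_lin]
  interpret Q: perfect_leibniz_rep scale bracket sc S M "\<lambda>x e. q (\<rho> x e)"
  proof (intro perfect_leibniz_rep.intro perfect_leibniz_rep_axioms.intro)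
    show "E.endomorphism (\<lambda>e. q (\<rho> x e))" for x
      by (rule E.endomorphismI) (simp_all add: \<rho>_simps q_simps)
    show "q (\<rho> x e) \<in> M" if "x \<in> S" "e \<in> M" for x e
      using qM' M'(3,4) that by blast
    show "q (\<rho> (x + y) e) = q (\<rho> x e) + q (\<rho> y e)" for x y e by (simp add: \<rho>_add q_simps)
    show "q (\<rho> (scale c x) e) = sc c (q (\<rho> x e))" for c x e by (simp add: \<rho>_scale q_simps)
  next
    fix x y e assume xy: "x \<in> S" "y \<in> S" and e: "e \<in> M"
    have qq: "q (\<rho> u (q (\<rho> v e))) = q (\<rho> u (\<rho> v e))" if "u \<in> S" for u v
    proof -
      have "\<rho> u (\<rho> v e - q (\<rho> v e)) \<in> A" using A(3)[OF that qA] .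
      then have "q (\<rho> u (\<rho> v e - q (\<rho> v e))) = 0" by (rule q0)
      then show ?thesis by (simp add: \<rho>_simps q_simps)
    qed
    show "q (\<rho> (bracket x y) e) = q (\<rho> y (q (\<rho> x e))) - q (\<rho> x (q (\<rho> y e)))"
      unfolding qq[OF xy(1)] qq[OF xy(2)] by (simp add: \<rho>_bracket[OF xy e] q_simps)
  qed (fact leibniz_algebra_axioms E.linear_space_axioms subspace_S S_bracket S_finite perfect finite_dim_M)+
  obtain e where e: "e \<in> M" "e \<notin> M'" "\<And>x. x \<in> S \<Longrightarrow> q (\<rho> x e) = 0"
  proof (rule Q.whitehead[OF R_maximal R(1) _ M'(1,2)])
    show "q (\<rho> x e) = 0" if "x \<in> R" "e \<in> M" for x e by (rule q0[OF R(2)[OF that]])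
    show "q (\<rho> x e) \<in> M'" if "x \<in> S" "e \<in> M" for x e by (rule qM'[OF M'(4)[OF that]])
  qed blast+
  then show thesis using that qA by (metis diff_zero)
qed

end

section \<open>Levi's argument\<close>

context leibniz_algebra
begin

section \<open>Derived series and solvable extensions\<close>

definition subalgebra :: "'v set \<Rightarrow> bool"
  where "subalgebra T \<longleftrightarrow> subspace T \<and> (\<forall>x\<in>T. \<forall>y\<in>T. bracket x y \<in> T)"

definition ideal_of :: "'v set \<Rightarrow> 'v set \<Rightarrow> bool"
  where "ideal_of J T \<longleftrightarrow> subspace J \<and> J \<subseteq> T \<and> (\<forall>a\<in>J. \<forall>x\<in>T. bracket a x \<in> J \<and> bracket x a \<in> J)"

definition derived :: "'v set \<Rightarrow> 'v set"
  where "derived T = span {bracket x y | x y. x \<in> T \<and> y \<in> T}"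

definition solvable_set :: "'v set \<Rightarrow> bool"
  where "solvable_set T \<longleftrightarrow> (\<exists>n. (derived ^^ n) T = {0})"

lemma subspace_derived: "subspace (derived T)"
  unfolding derived_def by (rule subspace_span)

lemma bracket_in_derived: "x \<in> T \<Longrightarrow> y \<in> T \<Longrightarrow> bracket x y \<in> derived T"
  unfolding derived_def by (rule span_base) blast

lemma derived_subset:
  assumes "subspace V" "\<And>x y. x \<in> T \<Longrightarrow> y \<in> T \<Longrightarrow> bracket x y \<in> V"
  shows "derived T \<subseteq> V"
  unfolding derived_def using assms by (intro span_minimal) auto

lemma derived_mono: "T \<subseteq> U \<Longrightarrow> derived T \<subseteq> derived U"
  using bracket_in_derived by (intro derived_subset subspace_derived) blast

lemma derived_funpow_mono: "T \<subseteq> U \<Longrightarrow> (derived ^^ n) T \<subseteq> (derived ^^ n) U"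
  by (induction n) (simp_all add: derived_mono)

lemma derived_subalgebra_subset: "subalgebra T \<Longrightarrow> derived T \<subseteq> T"
  unfolding subalgebra_def by (intro derived_subset) auto

lemma subalgebra_derived: "subalgebra T \<Longrightarrow> subalgebra (derived T)"
  unfolding subalgebra_def[of "derived T"]
  using derived_subalgebra_subset subspace_derived bracket_in_derived by blast

lemma subalgebra_derived_funpow: "subalgebra T \<Longrightarrow> subalgebra ((derived ^^ n) T)"
  by (induction n) (simp_all add: subalgebra_derived)

lemma derived_funpow_subset: "subalgebra T \<Longrightarrow> (derived ^^ n) T \<subseteq> T"
  using derived_subalgebra_subset[OF subalgebra_derived_funpow] by (induction n) (simp, fastforce)

lemma solvable_set_subset:
  assumes "solvable_set U" "T \<subseteq> U" "subalgebra T"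
  shows "solvable_set T"
proof -
  obtain n where "(derived ^^ n) U = {0}" using assms(1) unfolding solvable_set_def by blast
  then have "(derived ^^ n) T \<subseteq> {0}" using derived_funpow_mono[OF assms(2)] by metis
  moreover have "0 \<in> (derived ^^ n) T"
    using subalgebra_derived_funpow[OF assms(3)] subspace_0 unfolding subalgebra_def by blast
  ultimately show ?thesis unfolding solvable_set_def by blast
qed

lemma solvable_set_derived_funpow: "solvable_set ((derived ^^ n) T) \<Longrightarrow> solvable_set T"
  unfolding solvable_set_def by (metis comp_apply funpow_add)

lemma ideal_subalgebra: "ideal_of J T \<Longrightarrow> subalgebra J"
  unfolding ideal_of_def subalgebra_def by blast

text \<open>Right multiplication by \<open>x\<close> is a derivation, and the Leibniz identity also
  writes a left multiple of a bracket as a difference of two brackets of elements of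
  \<open>J\<close>.\<close>

lemma ideal_derived:
  assumes "ideal_of J T"
  shows "ideal_of (derived J) T"
proof -
  have J: "subspace J" "J \<subseteq> T" and JT: "\<And>a x. a \<in> J \<Longrightarrow> x \<in> T \<Longrightarrow> bracket a x \<in> J \<and> bracket x a \<in> J"
    using assms unfolding ideal_of_def by blast+
  note sub = subspace_derived[of J]
  have "bracket a x \<in> derived J \<and> bracket x a \<in> derived J" if a: "a \<in> derived J" and x: "x \<in> T" for a x
  proof -
    have "derived J \<subseteq> {a. bracket a x \<in> derived J \<and> bracket x a \<in> derived J}"
    proof (rule derived_subset)
      show "subspace {a. bracket a x \<in> derived J \<and> bracket x a \<in> derived J}"
        by (rule subspaceI) (auto simp: bracket_simps intro: subspace_0[OF sub] subspace_add[OF sub] subspace_scale[OF sub])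
    next
      fix m n assume mn: "m \<in> J" "n \<in> J"
      have "bracket (bracket m n) x = bracket m (bracket n x) + bracket (bracket m x) n"
        by (simp add: leibniz_identity)
      moreover have "bracket m (bracket n x) \<in> derived J" "bracket (bracket m x) n \<in> derived J"
        using mn JT x by (auto intro!: bracket_in_derived)
      moreover have "bracket x (bracket m n) \<in> derived J"
        unfolding leibniz_identity using mn JT x by (auto intro!: subspace_diff[OF sub] bracket_in_derived)
      ultimately show "bracket m n \<in> {a. bracket a x \<in> derived J \<and> bracket x a \<in> derived J}"
        using subspace_add[OF sub] by simp
    qed
    then show ?thesis using a by blast
  qed
  moreover have "derived J \<subseteq> T"
    using derived_subalgebra_subset[OF ideal_subalgebra[OF assms]] J(2) by blast
  ultimately show ?thesis unfolding ideal_of_def using sub by blast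
qed

text \<open>Stage by stage, the derived series of \<open>S\<close> stays within that of
  \<open>K\<close> plus \<open>R\<close>. When the series of \<open>K\<close> vanishes, the one of
  \<open>S\<close> has entered \<open>R\<close>.\<close>

lemma solvable_set_extension:
  assumes K: "subalgebra K" "K \<subseteq> S" "solvable_set K"
    and R: "ideal_of R S" "solvable_set R"
    and S: "subalgebra S" "\<And>x. x \<in> S \<Longrightarrow> \<exists>k\<in>K. x - k \<in> R"
  shows "solvable_set S"
proof -
  have subR: "subspace R" and RS: "\<And>a x. a \<in> R \<Longrightarrow> x \<in> S \<Longrightarrow> bracket a x \<in> R \<and> bracket x a \<in> R"
    and R_sub: "R \<subseteq> S"
    using R(1) unfolding ideal_of_def by blast+
  have incl: "\<exists>k\<in>(derived ^^ n) K. x - k \<in> R" if "x \<in> (derived ^^ n) S" for n x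
    using that
  proof (induction n arbitrary: x)
    case 0
    then show ?case using S(2) by simp
  next
    case (Suc n)
    let ?V = "{x. \<exists>k\<in>(derived ^^ Suc n) K. x - k \<in> R}"
    have subK: "subspace ((derived ^^ Suc n) K)" by (simp add: subspace_derived)
    have "derived ((derived ^^ n) S) \<subseteq> ?V"
    proof (rule derived_subset)
      show "subspace ?V"
      proof (rule subspaceI)
        show "0 \<in> ?V" using subspace_0[OF subK] subspace_0[OF subR] by force
      next
        fix x y assume "x \<in> ?V" "y \<in> ?V"
        then obtain k l where "k \<in> (derived ^^ Suc n) K" "x - k \<in> R" "l \<in> (derived ^^ Suc n) K" "y - l \<in> R"
          by blast
        then show "x + y \<in> ?V"
          using subspace_add[OF subK, of k l] subspace_add[OF subR, of "x - k" "y - l"]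
          by (auto simp: algebra_simps intro!: bexI[of _ "k + l"])
      next
        fix c x assume "x \<in> ?V"
        then obtain k where "k \<in> (derived ^^ Suc n) K" "x - k \<in> R" by blast
        then show "scale c x \<in> ?V"
          using subspace_scale[OF subK, of k c] subspace_scale[OF subR, of "x - k" c]
          by (auto simp: scale_right_diff_distrib intro!: bexI[of _ "scale c k"])
      qed
    next
      fix x y assume "x \<in> (derived ^^ n) S" "y \<in> (derived ^^ n) S"
      then obtain k l where k: "k \<in> (derived ^^ n) K" "x - k \<in> R" and l: "l \<in> (derived ^^ n) K" "y - l \<in> R"
        using Suc.IH by blast
      have kl: "k \<in> S" "l \<in> S" "y \<in> S"
        using k(1) l(1) \<open>y \<in> (derived ^^ n) S\<close> derived_funpow_subset K(1,2) S(1) by blast+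
      have "bracket x y - bracket k l = bracket (x - k) y + bracket k (y - l)"
        by (simp add: bracket_simps)
      also have "\<dots> \<in> R" using RS k(2) l(2) kl by (intro subspace_add[OF subR]) auto
      finally show "bracket x y \<in> ?V" using bracket_in_derived[OF k(1) l(1)] by auto
    qed
    then show ?case using Suc.prems by auto
  qed
  obtain n where "(derived ^^ n) K = {0}" using K(3) unfolding solvable_set_def by blast
  then have "(derived ^^ n) S \<subseteq> R" using incl[of _ n] by fastforce
  then have "solvable_set ((derived ^^ n) S)"
    by (rule solvable_set_subset[OF R(2) _ subalgebra_derived_funpow[OF S(1)]])
  then show ?thesis by (rule solvable_set_derived_funpow)
qed

lemma derived_zero: "derived {0} = {0}"
proof -
  have "derived {0} \<subseteq> {0}" by (rule derived_subset) (auto simp: subspace_single_0)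
  then show ?thesis using subspace_0[OF subspace_derived] by blast
qed

lemma derived_series_eq: "derived_series n = (derived ^^ n) UNIV"
  by (induction n) (simp_all add: derived_def)

lemma solvable_if_solvable_UNIV:
  assumes "solvable_set UNIV"
  shows solvable
proof -
  obtain n where "(derived ^^ n) UNIV = {0}" using assms unfolding solvable_set_def by blast
  \<comment> \<open>\<open>solvable\<close> asks for an index at least 1, and the index found may be
    0; one more derived step keeps \<open>{0}\<close>.\<close>
  then have "derived_series (Suc n) = {0}" by (simp add: derived_series_eq derived_zero del: derived_series.simps)
  then show ?thesis unfolding solvable_def by (intro exI[of _ "Suc n"]) simp
qed

end

text \<open>The spanning maps \<open>e b c\<close> are the matrix units for \<open>B\<close>. The
  bound makes the module of maps in Levi's argument finite-dimensional.\<close>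

lemma (in linear_space) endomorphisms_finite_dim:
  assumes B: "finite B" "independent B" "span B = UNIV"
  obtains F where "finite F"
    "{f. endomorphism f} \<subseteq> module.span (\<lambda>c (g :: 'b \<Rightarrow> 'b) w. scale c (g w)) F"
proof -
  interpret fn: linear_space "\<lambda>c (g :: 'b \<Rightarrow> 'b) w. scale c (g w)" by (rule linear_space_fun)
  define e where "e b c v = scale (representation B v b) c" for b c v
  let ?F = "(\<lambda>(b, c). e b c) ` (B \<times> B)"
  have "f \<in> fn.span ?F" if f: "endomorphism f" for f
  proof -
    have sum_apply: "(\<Sum>i\<in>I. g i) v = (\<Sum>i\<in>I. g i v)" for I and g :: "'b \<Rightarrow> 'b \<Rightarrow> 'b" and v
      by (induction I rule: infinite_finite_induct) simp_all
    have "f = (\<Sum>b\<in>B. \<Sum>c\<in>B. (\<lambda>v. scale (representation B (f b) c) (e b c v)))"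
    proof
      fix v
      have "f v = f (\<Sum>b\<in>B. scale (representation B v b) b)"
        using representation_expand[OF B(1,2), of v] B(3) by simp
      also have "\<dots> = (\<Sum>b\<in>B. scale (representation B v b) (f b))"
        by (simp add: endo.linear_sum[OF f] endo.linear_scale[OF f])
      also have "\<dots> = (\<Sum>b\<in>B. \<Sum>c\<in>B. scale (representation B (f b) c) (e b c v))"
      proof (intro sum.cong refl)
        fix b
        have "scale (representation B v b) (f b)
          = scale (representation B v b) (\<Sum>c\<in>B. scale (representation B (f b) c) c)"
          using representation_expand[OF B(1,2), of "f b"] B(3) by simp
        then show "scale (representation B v b) (f b) = (\<Sum>c\<in>B. scale (representation B (f b) c) (e b c v))"
          by (simp add: e_def scale_sum_right mult.commute)
      qed
      finally show "f v = (\<Sum>b\<in>B. \<Sum>c\<in>B. (\<lambda>v. scale (representation B (f b) c) (e b c v))) v"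
        by (simp add: sum_apply)
    qed
    also have "\<dots> \<in> fn.span ?F"
      by (intro fn.span_sum fn.span_scale fn.span_base) auto
    finally show ?thesis .
  qed
  then show thesis using B(1) by (intro that[of ?F]) auto
qed

section \<open>Levi's argument for a maximal ideal\<close>

locale leibniz_algebra_fd = leibniz_algebra scale bracket + finite_dimensional_vector_space scale Basis
  for scale :: "'k::field_char_0 \<Rightarrow> 'v::ab_group_add \<Rightarrow> 'v" and bracket Basis
begin

sublocale lin: linear_space scale ..

interpretation fn: linear_space "\<lambda>c (g :: 'v \<Rightarrow> 'v) w. scale c (g w)"
  by (rule lin.linear_space_fun)

text \<open>Levi's argument relative to \<open>derived R\<close>: the Whitehead lemma, applied to the maps into \<open>R\<close> that are
  scalar on \<open>R\<close> modulo \<open>derived R\<close>, yields such a map \<open>\<phi>\<close> with nonzero scalar whose commutators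
  with right multiplications are right multiplications by elements of \<open>R\<close>. The elements commuting
  with \<open>\<phi>\<close>, and then the kernel of \<open>\<phi>\<close>, are supplements of \<open>R\<close> (everything modulo \<open>derived R\<close>).\<close>

lemma maximal_ideal_perfect:
  assumes S: "subalgebra S" "derived S = S"
    and supplement: "\<And>K. subalgebra K \<Longrightarrow> K \<subseteq> S \<Longrightarrow> (\<And>x. x \<in> S \<Longrightarrow> \<exists>k\<in>K. x - k \<in> R) \<Longrightarrow> K = S"
    and R: "ideal_of R S"
    and R_maximal: "\<And>J. ideal_of J S \<Longrightarrow> R \<subseteq> J \<Longrightarrow> J = R \<or> J = S"
  shows "derived R = R"
proof (rule ccontr)
  assume neq: "derived R \<noteq> R"
  let ?R' = "derived R"
  have subS: "subspace S" and SS: "\<And>x y. x \<in> S \<Longrightarrow> y \<in> S \<Longrightarrow> bracket x y \<in> S"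
    using S(1) unfolding subalgebra_def by blast+
  have subR: "subspace R" and R_S: "R \<subseteq> S"
    and RS: "\<And>a x. a \<in> R \<Longrightarrow> x \<in> S \<Longrightarrow> bracket a x \<in> R" "\<And>a x. a \<in> R \<Longrightarrow> x \<in> S \<Longrightarrow> bracket x a \<in> R"
    using R unfolding ideal_of_def by blast+
  have R'_R: "?R' \<subseteq> R" by (rule derived_subalgebra_subset[OF ideal_subalgebra[OF R]])
  have R'S: "\<And>a x. a \<in> ?R' \<Longrightarrow> x \<in> S \<Longrightarrow> bracket a x \<in> ?R'"
    using ideal_derived[OF R] unfolding ideal_of_def by blast
  note subR' = subspace_derived[of R]
  note in_R' = subspace_add[OF subR'] subspace_diff[OF subR'] subspace_scale[OF subR'] subspace_neg[OF subR']
  obtain \<pi> where \<pi>: "lin.endomorphism \<pi>" "range \<pi> \<subseteq> S" "\<And>x. x \<in> S \<Longrightarrow> \<pi> x = x"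
    using lin.projection_exists[OF subS] by blast
  obtain \<phi>0 where \<phi>0: "lin.endomorphism \<phi>0" "range \<phi>0 \<subseteq> R" "\<And>x. x \<in> R \<Longrightarrow> \<phi>0 x = x"
    using lin.projection_exists[OF subR] by blast
  note \<pi>_simps = lin.endo.linear_add[OF \<pi>(1)] lin.endo.linear_scale[OF \<pi>(1)]
  have \<pi>S: "\<pi> v \<in> S" for v using \<pi>(2) by blast
  \<comment> \<open>Precomposition with \<open>\<pi>\<close> and, in \<open>\<rho>\<close> below, with the projection \<open>p\<close> onto the endomorphisms extends the
    action of \<open>S\<close> bilinearly to arbitrary vectors and arbitrary functions.\<close>
  define r where "r y v = bracket (\<pi> v) y" for y v
  have r_lin: "r y (v + w) = r y v + r y w" "r y (scale c v) = scale c (r y v)"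
    "r (x + y) v = r x v + r y v" "r (scale c y) v = scale c (r y v)" for x y v w c
    by (simp_all add: r_def \<pi>_simps bracket_simps)
  have r_diff: "r y (v - w) = r y v - r y w" for y v w
    using r_lin(1)[of y "v - w" w] by simp
  have r_S: "r y v = bracket v y" if "v \<in> S" for y v using that by (simp add: r_def \<pi>(3))
  have r_R: "r y v = bracket v y" if "v \<in> R" for y v using that R_S by (blast intro: r_S)
  have r_neg: "r (- y) v = - r y v" for y v by (simp add: r_def bracket_simps)
  have r_bracket: "r (bracket x y) v = r y (r x v) - r x (r y v)" if "x \<in> S" "y \<in> S" for x y v
    using that \<pi>S SS by (simp add: r_def \<pi>(3) leibniz_identity)
  let ?End = "{f. lin.endomorphism f}"
  have sub_End: "fn.subspace ?End"
    by (rule fn.subspaceI)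
      (auto intro!: lin.endomorphismI simp: lin.endo.linear_add lin.endo.linear_scale scale_right_distrib mult.commute)
  obtain p where p: "fn.endomorphism p" "range p \<subseteq> ?End" "\<And>f. f \<in> ?End \<Longrightarrow> p f = f"
    using fn.projection_exists[OF sub_End] by blast
  have p_End: "lin.endomorphism (p f)" for f using p(2) by blast
  define \<rho> where "\<rho> y f = (\<lambda>v. r y (p f v) - p f (r y v))" for y f
  have \<rho>: "\<rho> y f v = r y (f v) - f (r y v)" if "lin.endomorphism f" for y f v
    using p(3)[of f] that by (simp add: \<rho>_def)
  define M where "M = {f. lin.endomorphism f \<and> range f \<subseteq> R \<and> (\<exists>c. \<forall>n\<in>R. f n - scale c n \<in> ?R')}"
  define M' where "M' = {f. lin.endomorphism f \<and> range f \<subseteq> R \<and> f ` R \<subseteq> ?R'}"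
  \<comment> \<open>Modulo maps into \<open>derived R\<close>, these are the inner maps, right
    multiplications by elements of \<open>R\<close>. Invariance up to \<open>A\<close> means that
    the failure of a map to commute with a right multiplication is itself inner, so that an element
    of \<open>R\<close> can compensate for it.\<close>
  define A where "A = {f \<in> M'. \<exists>n\<in>R. \<forall>v. f v - r n v \<in> ?R'}"
  have M_lin: "lin.endomorphism f" if "f \<in> M" for f using that unfolding M_def by blast
  have M'_M: "M' \<subseteq> M"
  proof
    fix f assume f: "f \<in> M'"
    then have "f n - scale 0 n \<in> ?R'" if "n \<in> R" for n using that unfolding M'_def by auto
    then show "f \<in> M" using f unfolding M_def M'_def by blast
  qed
  have sub_M: "fn.subspace M"
  proof (rule fn.subspaceI)
    show "0 \<in> M"
      unfolding M_def using subspace_0[OF subR] subspace_0[OF subR'] fn.subspace_0[OF sub_End]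
      by (auto intro!: exI[of _ 0])
  next
    fix f g assume "f \<in> M" "g \<in> M"
    then obtain c d where f: "lin.endomorphism f" "range f \<subseteq> R" "\<And>n. n \<in> R \<Longrightarrow> f n - scale c n \<in> ?R'"
      and g: "lin.endomorphism g" "range g \<subseteq> R" "\<And>n. n \<in> R \<Longrightarrow> g n - scale d n \<in> ?R'"
      unfolding M_def by blast
    have "(f + g) n - scale (c + d) n \<in> ?R'" if "n \<in> R" for n
      using subspace_add[OF subR' f(3)[OF that] g(3)[OF that]] by (simp add: scale_left_distrib algebra_simps)
    moreover have "range (f + g) \<subseteq> R" using f(2) g(2) subspace_add[OF subR] by auto
    moreover have "lin.endomorphism (f + g)" using fn.subspace_add[OF sub_End] f(1) g(1) by blast
    ultimately show "f + g \<in> M" unfolding M_def by blast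
  next
    fix c f assume "f \<in> M"
    then obtain d where f: "lin.endomorphism f" "range f \<subseteq> R" "\<And>n. n \<in> R \<Longrightarrow> f n - scale d n \<in> ?R'"
      unfolding M_def by blast
    have "scale c (f n) - scale (c * d) n \<in> ?R'" if "n \<in> R" for n
      using subspace_scale[OF subR' f(3)[OF that], of c] by (simp add: scale_right_diff_distrib)
    moreover have "range (\<lambda>w. scale c (f w)) \<subseteq> R" using f(2) subspace_scale[OF subR] by auto
    moreover have "lin.endomorphism (\<lambda>w. scale c (f w))" using fn.subspace_scale[OF sub_End] f(1) by blast
    ultimately show "(\<lambda>w. scale c (f w)) \<in> M" unfolding M_def by blast
  qed
  have sub_M': "fn.subspace M'"
  proof (rule fn.subspaceI)
    show "0 \<in> M'"
      unfolding M'_def using subspace_0[OF subR] subspace_0[OF subR'] fn.subspace_0[OF sub_End] by auto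
    show "f + g \<in> M'" if "f \<in> M'" "g \<in> M'" for f g
      using that fn.subspace_add[OF sub_End] subspace_add[OF subR] subspace_add[OF subR']
      unfolding M'_def by (auto simp: image_subset_iff)
    show "(\<lambda>w. scale c (f w)) \<in> M'" if "f \<in> M'" for c f
      using that fn.subspace_scale[OF sub_End] subspace_scale[OF subR] subspace_scale[OF subR']
      unfolding M'_def by (auto simp: image_subset_iff)
  qed
  have sub_A: "fn.subspace A"
  proof (rule fn.subspaceI)
    have "(0 :: 'v \<Rightarrow> 'v) v - r 0 v \<in> ?R'" for v
      using subspace_0[OF subR'] by (simp add: r_def)
    then show "0 \<in> A" unfolding A_def using fn.subspace_0[OF sub_M'] subspace_0[OF subR] by blast
  next
    fix f g assume "f \<in> A" "g \<in> A"
    then obtain m n where f: "f \<in> M'" "m \<in> R" "\<And>v. f v - r m v \<in> ?R'"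
      and g: "g \<in> M'" "n \<in> R" "\<And>v. g v - r n v \<in> ?R'" unfolding A_def by blast
    have "(f + g) v - r (m + n) v \<in> ?R'" for v
      using subspace_add[OF subR' f(3)[of v] g(3)[of v]] by (simp add: r_lin algebra_simps)
    then show "f + g \<in> A"
      unfolding A_def using fn.subspace_add[OF sub_M' f(1) g(1)] subspace_add[OF subR f(2) g(2)] by blast
  next
    fix c f assume "f \<in> A"
    then obtain m where f: "f \<in> M'" "m \<in> R" "\<And>v. f v - r m v \<in> ?R'" unfolding A_def by blast
    have "scale c (f v) - r (scale c m) v \<in> ?R'" for v
      using subspace_scale[OF subR' f(3)[of v], of c] by (simp add: r_lin scale_right_diff_distrib)
    then show "(\<lambda>w. scale c (f w)) \<in> A"
      unfolding A_def using fn.subspace_scale[OF sub_M' f(1)] subspace_scale[OF subR f(2)] by blast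
  qed
  have \<rho>_End: "lin.endomorphism (\<rho> y f)" if "lin.endomorphism f" for y f
    by (rule lin.endomorphismI)
      (simp_all add: \<rho>[OF that] r_lin lin.endo.linear_add[OF that] lin.endo.linear_scale[OF that]
        scale_right_diff_distrib)
  have \<rho>_range: "range (\<rho> y f) \<subseteq> R" if "f \<in> M" "y \<in> S" for y f
  proof safe
    fix v
    have fR: "f w \<in> R" for w using that(1) unfolding M_def by blast
    have "\<rho> y f v = bracket (f v) y - f (r y v)"
      by (simp add: \<rho>[OF M_lin[OF that(1)]] r_R[OF fR])
    then show "\<rho> y f v \<in> R" using RS(1)[OF fR that(2)] fR subspace_diff[OF subR] by simp
  qed
  have \<rho>_M': "\<rho> y f \<in> M'" if f: "f \<in> M" and y: "y \<in> S" for y f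
  proof -
    obtain c where c: "\<And>n. n \<in> R \<Longrightarrow> f n - scale c n \<in> ?R'" using f unfolding M_def by blast
    have "\<rho> y f n \<in> ?R'" if n: "n \<in> R" for n
    proof -
      have "f n \<in> R" using f unfolding M_def by blast
      then have "\<rho> y f n = bracket (f n) y - f (bracket n y)"
        by (simp add: \<rho>[OF M_lin[OF f]] r_R n)
      \<comment> \<open>The scalar \<open>c\<close> commutes with right multiplication and drops
        out, leaving the deviation of \<open>f\<close> from \<open>c\<close>, which on
        \<open>R\<close> takes values in \<open>derived R\<close>.\<close>
      also have "\<dots> = bracket (f n - scale c n) y - (f (bracket n y) - scale c (bracket n y))"
        by (simp add: bracket_simps)
      also have "\<dots> \<in> ?R'"
        using R'S[OF c[OF n] y] c[OF RS(1)[OF n y]] by (rule in_R')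
      finally show ?thesis .
    qed
    then show ?thesis unfolding M'_def using \<rho>_End[OF M_lin[OF f]] \<rho>_range[OF f y] by blast
  qed
  obtain F where F: "finite F" "?End \<subseteq> fn.span F"
    by (rule lin.endomorphisms_finite_dim[OF finite_Basis independent_Basis span_Basis])
  have fd_M: "fn.finite_dim M"
    unfolding fn.finite_dim_def using sub_M F M_lin by blast
  interpret rep: perfect_leibniz_rep scale bracket "\<lambda>c (g :: 'v \<Rightarrow> 'v) w. scale c (g w)" S M \<rho>
  proof (intro perfect_leibniz_rep.intro perfect_leibniz_rep_axioms.intro)
    show "leibniz_algebra scale bracket" by (rule leibniz_algebra_axioms)
    show "linear_space (\<lambda>c (g :: 'v \<Rightarrow> 'v) w. scale c (g w))" by (rule fn.linear_space_axioms)
    show "subspace S" by (rule subS)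
    show "bracket x y \<in> S" if "x \<in> S" "y \<in> S" for x y using that by (rule SS)
    show "\<exists>D. finite D \<and> S \<subseteq> span D" using finite_Basis span_Basis by blast
    show "S \<subseteq> span {bracket x y |x y. x \<in> S \<and> y \<in> S}" using S(2) unfolding derived_def by simp
    show "fn.endomorphism (\<rho> y)" for y
      by (rule fn.endomorphismI)
        (simp_all add: fun_eq_iff \<rho>_def fn.endo.linear_add[OF p(1)] fn.endo.linear_scale[OF p(1)] r_lin
          scale_right_diff_distrib)
    show "\<rho> (x + y) f = \<rho> x f + \<rho> y f" for x y f
      by (simp add: fun_eq_iff \<rho>_def r_lin lin.endo.linear_add[OF p_End])
    show "\<rho> (scale c x) f = (\<lambda>w. scale c (\<rho> x f w))" for c x f
      by (simp add: fun_eq_iff \<rho>_def r_lin lin.endo.linear_scale[OF p_End] scale_right_diff_distrib)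
    show "fn.finite_dim M" by (rule fd_M)
    show "\<rho> x f \<in> M" if "x \<in> S" "f \<in> M" for x f using \<rho>_M' M'_M that by blast
    show "\<rho> (bracket x y) f = \<rho> y (\<rho> x f) - \<rho> x (\<rho> y f)" if "x \<in> S" "y \<in> S" "f \<in> M" for x y f
      using that
      by (simp add: fun_eq_iff \<rho> \<rho>_End M_lin r_bracket r_diff lin.endo.linear_diff[OF M_lin])
  qed
  obtain \<phi> where \<phi>: "\<phi> \<in> M" "\<phi> \<notin> M'" and \<phi>A: "\<And>x. x \<in> S \<Longrightarrow> \<rho> x \<phi> \<in> A"
  proof (rule rep.whitehead_relative[of R A M'])
    show "J = R \<or> J = S" if "subspace J" "R \<subseteq> J" "J \<subseteq> S"
      "\<And>a x. a \<in> J \<Longrightarrow> x \<in> S \<Longrightarrow> bracket a x \<in> J \<and> bracket x a \<in> J" for J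
      using that by (intro R_maximal) (auto simp: ideal_of_def)
    show "R \<subseteq> S" by (rule R_S)
    show "\<rho> x f \<in> A" if x: "x \<in> R" and f: "f \<in> M" for x f
    proof -
      obtain c where c: "\<And>n. n \<in> R \<Longrightarrow> f n - scale c n \<in> ?R'" using f unfolding M_def by blast
      \<comment> \<open>Both \<open>f v\<close> and \<open>x\<close> lie in \<open>R\<close>, so
        their bracket vanishes modulo \<open>derived R\<close>; on \<open>r x v\<close>, an element
        of \<open>R\<close>, the map \<open>f\<close> is the scalar \<open>c\<close>. What remains
        is right multiplication by \<open>- c\<close> times \<open>x\<close>.\<close>
      have "\<rho> x f v - r (scale (- c) x) v \<in> ?R'" for v
      proof -
        have fv: "f v \<in> R" using f unfolding M_def by blast
        then have "\<rho> x f v - r (scale (- c) x) v = bracket (f v) x - (f (r x v) - scale c (r x v))"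
          by (simp add: \<rho>[OF M_lin[OF f]] r_R r_lin r_neg)
        also have "\<dots> \<in> ?R'"
        proof (rule in_R'(2)[OF bracket_in_derived[OF fv x] c])
          show "r x v \<in> R" unfolding r_def using RS(2)[OF x \<pi>S] .
        qed
        finally show ?thesis .
      qed
      moreover have "\<rho> x f \<in> M'" using \<rho>_M'[OF f] x R_S by blast
      ultimately show ?thesis unfolding A_def using subspace_scale[OF subR x] by blast
    qed
    show "fn.subspace M'" by (rule sub_M')
    show "\<not> M \<subseteq> M'"
    proof
      assume "M \<subseteq> M'"
      \<comment> \<open>The projection onto \<open>R\<close> has scalar 1, hence lies in
        \<open>M\<close>; it is outside \<open>M'\<close> because
        \<open>derived R \<noteq> R\<close>.\<close>
      have "\<phi>0 n - scale 1 n \<in> ?R'" if "n \<in> R" for n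
        using \<phi>0(3)[OF that] subspace_0[OF subR'] by simp
      then have "\<phi>0 \<in> M" unfolding M_def using \<phi>0 by blast
      then have "\<phi>0 ` R \<subseteq> ?R'" using \<open>M \<subseteq> M'\<close> unfolding M'_def by blast
      then have "R \<subseteq> ?R'" using \<phi>0(3) by auto
      then show False using R'_R neq by blast
    qed
    show "M' \<subseteq> M" by (rule M'_M)
    show "\<rho> x f \<in> M'" if "x \<in> S" "f \<in> M" for x f using \<rho>_M' that by blast
    show "fn.subspace A" by (rule sub_A)
    show "A \<subseteq> M'" unfolding A_def by blast
    show "\<rho> x f \<in> A" if x: "x \<in> S" and f: "f \<in> A" for x f
    proof -
      obtain n where n: "n \<in> R" "\<And>v. f v - r n v \<in> ?R'" and fM: "f \<in> M"
        using f M'_M unfolding A_def by blast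
      \<comment> \<open>Modulo \<open>derived R\<close>, \<open>f\<close> is \<open>r n\<close>, and
        the commutator of \<open>r x\<close> with \<open>r n\<close> is
        \<open>r (bracket n x)\<close>.\<close>
      have "\<rho> x f v - r (bracket n x) v \<in> ?R'" for v
      proof -
        have "f v - r n v \<in> S" using n(2) R'_R R_S by blast
        then have "r x (f v) - r x (r n v) = bracket (f v - r n v) x"
          by (simp add: r_S r_diff[symmetric])
        then have "\<rho> x f v - r (bracket n x) v = bracket (f v - r n v) x - (f (r x v) - r n (r x v))"
          using \<rho>[OF M_lin[OF fM]] r_bracket[of n x v] n(1) x R_S by auto
        also have "\<dots> \<in> ?R'" by (rule in_R'(2)[OF R'S[OF n(2) x] n(2)])
        finally show ?thesis .
      qed
      then show ?thesis unfolding A_def using \<rho>_M'[OF fM x] RS(1)[OF n(1) x] by blast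
    qed
  qed blast
  note \<phi>_lin = M_lin[OF \<phi>(1)]
  have \<phi>R: "\<phi> v \<in> R" for v using \<phi>(1) unfolding M_def by blast
  obtain c where c: "\<And>n. n \<in> R \<Longrightarrow> \<phi> n - scale c n \<in> ?R'" using \<phi>(1) unfolding M_def by blast
  have "c \<noteq> 0"
  proof
    assume "c = 0"
    then have "\<phi> ` R \<subseteq> ?R'" using c by auto
    then show False using \<phi> unfolding M_def M'_def by blast
  qed
  have \<phi>R': "\<phi> v \<in> ?R'" if "v \<in> ?R'" for v
  proof -
    have "(\<phi> v - scale c v) + scale c v \<in> ?R'"
      using c that R'_R subspace_scale[OF subR' that] by (intro subspace_add[OF subR']) auto
    then show ?thesis by simp
  qed
  define K where "K = {y \<in> S. \<forall>v. \<rho> y \<phi> v \<in> ?R'}"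
  have "K = S"
  proof (rule supplement)
    show "K \<subseteq> S" unfolding K_def by blast
    have "subspace K"
      by (rule subspaceI) (auto simp: K_def rep.\<rho>_add rep.\<rho>_scale subspace_0[OF subS] subspace_0[OF subR']
          intro: in_R' subspace_add[OF subS] subspace_scale[OF subS])
    moreover have "bracket x y \<in> K" if x: "x \<in> K" and y: "y \<in> K" for x y
    proof -
      have xS: "x \<in> S" "y \<in> S" using x y unfolding K_def by blast+
      have "\<rho> u (\<rho> w \<phi>) v \<in> ?R'" if u: "u \<in> K" and w: "w \<in> K" for u w v
      proof -
        have uS: "u \<in> S" and wv: "\<And>v. \<rho> w \<phi> v \<in> ?R'" using u w unfolding K_def by blast+
        have "\<rho> w \<phi> v \<in> S" using wv R'_R R_S by blast
        then have "\<rho> u (\<rho> w \<phi>) v = bracket (\<rho> w \<phi> v) u - \<rho> w \<phi> (r u v)"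
          using \<rho>[OF \<rho>_End[OF \<phi>_lin]] r_S by simp
        also have "\<dots> \<in> ?R'" by (rule in_R'(2)[OF R'S[OF wv uS] wv])
        finally show ?thesis .
      qed
      then have "\<rho> (bracket x y) \<phi> v \<in> ?R'" for v
        using x y by (simp add: rep.\<rho>_bracket[OF xS \<phi>(1)] in_R'(2))
      then show ?thesis unfolding K_def using SS[OF xS] by blast
    qed
    ultimately show "subalgebra K" unfolding subalgebra_def by blast
  next
    fix y assume y: "y \<in> S"
    obtain n where n: "n \<in> R" "\<And>v. \<rho> y \<phi> v - r n v \<in> ?R'" using \<phi>A[OF y] unfolding A_def by blast
    \<comment> \<open>Modulo \<open>derived R\<close>, \<open>\<rho> ?m \<phi>\<close> is right
      multiplication by \<open>- c\<close> times \<open>?m\<close>, that is by \<open>- n\<close>.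
      It cancels \<open>\<rho> y \<phi>\<close>, so \<open>y + ?m\<close> lies in
      \<open>K\<close>.\<close>
    let ?m = "scale (inverse c) n"
    have m: "?m \<in> R" by (rule subspace_scale[OF subR n(1)])
    have "\<rho> (y + ?m) \<phi> v \<in> ?R'" for v
    proof -
      have "\<rho> ?m \<phi> v = bracket (\<phi> v) ?m - \<phi> (r ?m v)"
        by (simp add: \<rho>[OF \<phi>_lin] r_R[OF \<phi>R])
      then have "\<rho> (y + ?m) \<phi> v = (\<rho> y \<phi> v - r n v) + (bracket (\<phi> v) ?m - (\<phi> (r ?m v) - scale c (r ?m v)))"
        using \<open>c \<noteq> 0\<close> by (simp add: rep.\<rho>_add r_lin)
      also have "\<dots> \<in> ?R'"
      proof (rule in_R'(1)[OF n(2) in_R'(2)[OF bracket_in_derived[OF \<phi>R m] c]])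
        show "r ?m v \<in> R" unfolding r_def using RS(2)[OF m \<pi>S] .
      qed
      finally show ?thesis .
    qed
    then have "y + ?m \<in> K" unfolding K_def using subspace_add[OF subS y] m R_S by blast
    moreover have "y - (y + ?m) \<in> R" using subspace_neg[OF subR m] by simp
    ultimately show "\<exists>k\<in>K. y - k \<in> R" by blast
  qed
  define K1 where "K1 = {x \<in> S. \<phi> x \<in> ?R'}"
  have "K1 = S"
  proof (rule supplement)
    show "K1 \<subseteq> S" unfolding K1_def by blast
    have "subspace K1"
      by (rule subspaceI) (auto simp: K1_def lin.endo.linear_0[OF \<phi>_lin] lin.endo.linear_add[OF \<phi>_lin]
          lin.endo.linear_scale[OF \<phi>_lin] subspace_0[OF subS] subspace_0[OF subR']
          intro: in_R' subspace_add[OF subS] subspace_scale[OF subS])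
    moreover have "bracket x y \<in> K1" if x: "x \<in> K1" and y: "y \<in> K1" for x y
    proof -
      have xS: "x \<in> S" "y \<in> S" and \<phi>x: "\<phi> x \<in> ?R'" using x y unfolding K1_def by blast+
      have "\<rho> y \<phi> x \<in> ?R'" using xS(2) \<open>K = S\<close> unfolding K_def by blast
      moreover have "\<phi> (bracket x y) = bracket (\<phi> x) y - \<rho> y \<phi> x"
        by (simp add: \<rho>[OF \<phi>_lin] r_R[OF \<phi>R] r_S[OF xS(1)])
      ultimately have "\<phi> (bracket x y) \<in> ?R'"
        using in_R'(2)[OF R'S[OF \<phi>x xS(2)]] by simp
      then show ?thesis unfolding K1_def using SS[OF xS] by simp
    qed
    ultimately show "subalgebra K1" unfolding subalgebra_def by blast
  next
    fix x assume x: "x \<in> S"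
    \<comment> \<open>On \<open>R\<close> the map \<open>\<phi>\<close> is \<open>c\<close> modulo
      \<open>derived R\<close>, so \<open>\<phi> ?n\<close> agrees there with
      \<open>\<phi> x\<close>, and subtracting \<open>?n\<close> moves \<open>x\<close> into
      \<open>K1\<close>.\<close>
    let ?n = "scale (inverse c) (\<phi> x)"
    have n: "?n \<in> R" by (rule subspace_scale[OF subR \<phi>R])
    have "\<phi> (x - ?n) = - (\<phi> ?n - scale c ?n)"
      using \<open>c \<noteq> 0\<close> by (simp add: lin.endo.linear_diff[OF \<phi>_lin])
    also have "\<dots> \<in> ?R'" by (rule in_R'(4)[OF c[OF n]])
    finally have "x - ?n \<in> K1" unfolding K1_def using subspace_diff[OF subS x] n R_S by blast
    moreover have "x - (x - ?n) \<in> R" using n by simp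
    ultimately show "\<exists>k\<in>K1. x - k \<in> R" by blast
  qed
  then have "\<phi> ` R \<subseteq> ?R'" using R_S unfolding K1_def by blast
  then show False using \<phi> unfolding M_def M'_def by blast
qed

section \<open>Minimal non-solvable subalgebras and the final contradiction\<close>

lemma minimal_unsolvable_has_no_squares:
  assumes S: "subalgebra S" "\<not> solvable_set S"
    and minimal: "\<And>K. subalgebra K \<Longrightarrow> K \<subset> S \<Longrightarrow> solvable_set K"
    and x: "x \<in> S"
  shows "derived S = S" and "bracket x x = 0"
proof -
  have subS: "subspace S" and SS: "\<And>x y. x \<in> S \<Longrightarrow> y \<in> S \<Longrightarrow> bracket x y \<in> S"
    using S(1) unfolding subalgebra_def by blast+
  have "solvable_set (derived S) \<Longrightarrow> solvable_set S"
    using solvable_set_derived_funpow[of 1 S] by simp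
  then show perfect: "derived S = S"
    using minimal[OF subalgebra_derived[OF S(1)]] derived_subalgebra_subset[OF S(1)] S(2) by blast
  define P where "P J \<longleftrightarrow> ideal_of J S \<and> J \<noteq> S" for J
  have solvable_P: "solvable_set J" if "P J" for J
    using that minimal[OF ideal_subalgebra] unfolding P_def ideal_of_def by blast
  have zero: "solvable_set {0}"
    unfolding solvable_set_def by (rule exI[of _ 0]) simp
  have "P {0}"
    unfolding P_def ideal_of_def using zero S(2) subspace_0[OF subS] by (auto simp: subspace_single_0)
  moreover have "\<forall>J. P J \<longrightarrow> dim J < Suc dimension"
    using dim_subset_UNIV le_imp_less_Suc by blast
  ultimately have "\<exists>R. P R \<and> (\<forall>J. P J \<longrightarrow> dim J \<le> dim R)"
    by (rule ex_has_greatest_nat)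
  then obtain R where R: "P R" and max: "\<And>J. P J \<Longrightarrow> dim J \<le> dim R" by blast
  have R_ideal: "ideal_of R S" "R \<noteq> S" using R unfolding P_def by blast+
  have "derived R = R"
  proof (rule maximal_ideal_perfect[OF S(1) perfect _ R_ideal(1)])
    \<comment> \<open>A proper supplement is solvable by minimality, and so is \<open>R\<close>; the
      extension \<open>S\<close> would then be solvable.\<close>
    show "K = S" if "subalgebra K" "K \<subseteq> S" "\<And>x. x \<in> S \<Longrightarrow> \<exists>k\<in>K. x - k \<in> R" for K
      using that S solvable_set_extension[OF that(1,2) _ R_ideal(1) solvable_P[OF R] S(1)] minimal[OF that(1)]
      by blast
    show "J = R \<or> J = S" if "ideal_of J S" "R \<subseteq> J" for J
    proof (cases "J = S")
      case False
      then have "dim J \<le> dim R" using that(1) max unfolding P_def by blast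
      then have "R = J"
        using subspace_dim_equal[of R J] that R_ideal(1) unfolding ideal_of_def by blast
      then show ?thesis by simp
    qed simp
  qed
  then have "(derived ^^ n) R = R" for n by (induction n) simp_all
  then have R0: "R = {0}" using solvable_P[OF R] unfolding solvable_set_def by blast
  \<comment> \<open>The Leibniz kernel. The Leibniz identity gives zero whenever one of its elements
    stands on the right of a bracket, which also prevents it from equalling \<open>S\<close>, a
    perfect and nonzero algebra.\<close>
  define I where "I = span {bracket x x | x. x \<in> S}"
  have subI: "subspace I" unfolding I_def by (rule subspace_span)
  have sq: "bracket x x \<in> I" if "x \<in> S" for x unfolding I_def using that by (intro span_base) blast
  have I_induct: "I \<subseteq> {a. Q a}" if "subspace {a. Q a}" "\<And>x. x \<in> S \<Longrightarrow> Q (bracket x x)" for Q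
    unfolding I_def using that by (intro span_minimal) auto
  have IS: "I \<subseteq> S" using I_induct[of "\<lambda>a. a \<in> S"] subS SS by simp
  have left: "bracket y a = 0" if "a \<in> I" for y a
  proof -
    have "I \<subseteq> {a. bracket y a = 0}"
      by (rule I_induct) (auto intro!: subspaceI simp: bracket_simps leibniz_identity)
    then show ?thesis using that by blast
  qed
  have right: "bracket a y \<in> I" if "a \<in> I" "y \<in> S" for a y
  proof -
    have "I \<subseteq> {a. bracket a y \<in> I}"
    proof (rule I_induct)
      show "subspace {a. bracket a y \<in> I}"
        by (rule subspaceI) (auto simp: bracket_simps intro: subspace_0[OF subI] subspace_add[OF subI] subspace_scale[OF subI])
    next
      fix x assume x: "x \<in> S"
      let ?z = "bracket x y"
      have z: "?z \<in> S" using SS x that(2) by blast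
      \<comment> \<open>Polarization: the sum of the two mixed brackets of \<open>x\<close> and
        \<open>?z\<close> is a combination of squares.\<close>
      have "bracket (bracket x x) y = bracket x ?z + bracket ?z x"
        by (simp add: leibniz_identity)
      also have "\<dots> = bracket (x + ?z) (x + ?z) - bracket x x - bracket ?z ?z"
        by (simp add: bracket_simps)
      also have "\<dots> \<in> I"
        by (intro subspace_diff[OF subI] sq subspace_add[OF subS] x z)
      finally show "bracket (bracket x x) y \<in> I" .
    qed
    then show ?thesis using that by blast
  qed
  have "ideal_of I S"
    unfolding ideal_of_def using subI IS left right subspace_0[OF subI] by simp
  moreover have "I \<noteq> S"
  proof
    assume "I = S"
    then have "derived S \<subseteq> {0}" using left by (intro derived_subset) (auto simp: subspace_single_0)
    then have "S = {0}" using perfect subspace_0[OF subS] by blast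
    then show False using S(2) zero by blast
  qed
  ultimately have "dim I \<le> dim R" using max unfolding P_def by blast
  then have "I \<subseteq> {0}" unfolding R0 by simp
  then show "bracket x x = 0" using sq[OF x] by blast
qed

lemma CL_algebra_solvable:
  assumes CL_algebra
  shows solvable
proof (rule solvable_if_solvable_UNIV, rule ccontr)
  define P where "P S \<longleftrightarrow> subalgebra S \<and> \<not> solvable_set S" for S
  assume "\<not> solvable_set UNIV"
  then have "P UNIV" unfolding P_def subalgebra_def by simp
  then have "\<exists>S. P S \<and> (\<forall>T. P T \<longrightarrow> dim S \<le> dim T)" by (rule ex_has_least_nat)
  then obtain S where S: "subalgebra S" "\<not> solvable_set S" and least: "\<And>T. P T \<Longrightarrow> dim S \<le> dim T"
    unfolding P_def by blast
  have minimal: "solvable_set K" if "subalgebra K" "K \<subset> S" for K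
  proof (rule ccontr)
    assume "\<not> solvable_set K"
    then have "dim S \<le> dim K" using that(1) least unfolding P_def by blast
    then have "K = S" using subspace_dim_equal[of K S] that S(1) unfolding subalgebra_def by blast
    then show False using that(2) by blast
  qed
  have subS: "subspace S" and SS: "\<And>x y. x \<in> S \<Longrightarrow> y \<in> S \<Longrightarrow> bracket x y \<in> S"
    using S(1) unfolding subalgebra_def by blast+
  have perfect: "derived S = S" and sq: "bracket x x = 0" if "x \<in> S" for x
    using minimal_unsolvable_has_no_squares[OF S minimal that] by blast+
  have anti: "bracket x y = - bracket y x" if "x \<in> S" "y \<in> S" for x y
  proof -
    have "bracket (x + y) (x + y) = 0" using sq subspace_add[OF subS that] by blast
    then show ?thesis using sq[OF that(1)] sq[OF that(2)]
      by (simp add: bracket_simps eq_neg_iff_add_eq_0 add.commute)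
  qed
  \<comment> \<open>The CL property is used in the whole algebra: only \<open>x\<close> is taken in
    \<open>S\<close>, and \<open>y\<close> is arbitrary.\<close>
  have engel: "bracket (bracket y x) x = 0" if "x \<in> S" for x y
  proof -
    have "two_sided_ideal (centralizer x)" using assms unfolding CL_algebra_def by blast
    moreover have "x \<in> centralizer x" using sq[OF that] by (simp add: centralizer_def)
    ultimately have "bracket y x \<in> centralizer x" unfolding two_sided_ideal_def by blast
    then show ?thesis by (simp add: centralizer_def)
  qed
  have engel2: "bracket (bracket y x) z = - bracket (bracket y z) x" if "x \<in> S" "z \<in> S" for x y z
  proof -
    have "bracket (bracket y (x + z)) (x + z) = 0" using engel subspace_add[OF subS that] by blast
    then show ?thesis
      using engel[OF that(1), of y] engel[OF that(2), of y]
      by (simp add: bracket_simps eq_neg_iff_add_eq_0 add.commute)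
  qed
  have nil: "bracket (bracket x y) z = 0" if "x \<in> S" "y \<in> S" "z \<in> S" for x y z
  proof -
    let ?t = "bracket (bracket x y) z"
    \<comment> \<open>The Leibniz identity with \<open>engel2\<close> gives twice \<open>?t\<close>;
      antisymmetry and \<open>engel2\<close> once more return the same element as
      \<open>- ?t\<close>, whence the factor 3.\<close>
    have "?t + ?t = bracket x (bracket y z)"
      using leibniz_identity[of x y z] engel2[OF that(3,2), of x] by simp
    also have "\<dots> = - bracket (bracket y z) x"
      by (rule anti[OF that(1) SS[OF that(2,3)]])
    also have "bracket (bracket y z) x = - bracket (bracket y x) z"
      by (rule engel2[OF that(3,1)])
    also have "bracket (bracket y x) z = - ?t"
      using anti[OF that(2,1)] by (simp add: bracket_simps)
    finally have "?t + ?t + ?t = 0" by simp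
    then have "scale 3 ?t = 0"
      using scale_left_distrib[of 1 1 ?t] scale_left_distrib[of 2 1 ?t] by simp
    then show ?thesis by simp
  qed
  have "bracket a z = 0" if "a \<in> S" "z \<in> S" for a z
  proof -
    have "derived S \<subseteq> {a. bracket a z = 0}"
      using nil that(2) by (intro derived_subset subspaceI) (auto simp: bracket_simps)
    then show ?thesis using that perfect by blast
  qed
  then have "derived S \<subseteq> {0}" by (intro derived_subset) (auto simp: subspace_single_0)
  then have "(derived ^^ 1) S = {0}" using subspace_0[OF subspace_derived] by auto
  then show False using S(2) unfolding solvable_set_def by blast
qed

end

theorem theorem6p1:
  fixes scale :: "'k::field_char_0 \<Rightarrow> 'v::ab_group_add \<Rightarrow> 'v"
    and bracket :: "'v \<Rightarrow> 'v \<Rightarrow> 'v"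
    and Basis :: "'v set"
  assumes "finite_dimensional_vector_space scale Basis"
    and "leibniz_algebra scale bracket"
    and "leibniz_algebra.CL_algebra scale bracket"
  shows "leibniz_algebra.solvable scale bracket"
proof -
  interpret leibniz_algebra_fd scale bracket Basis
    using assms(1,2) by (rule leibniz_algebra_fd.intro[rotated])
  show ?thesis using assms(3) by (rule CL_algebra_solvable)
qed

end
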